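(* Let $Q$ be in the Frobenius normal form described in the context, let $(X_i)$ be the associated absorbed Markov chain with initial distribution $\pi$ and absorption time $T$, and assume: (A1) for all $i\in\{1,\dots,k\}$ with $\rho_i<\rho_{\max}$, the diagonal block $Q_{ii}$ is scalar; (A2) there is $\theta\in\mathcal{P}_{\max}$ with $\alpha_\theta\neq0$ and $\pi_{\theta_1}v_{\theta_1}\neq0$. Let $\ell\in\{1,\dots,k\}$. Then: (i) if $\rho_\ell<\rho_{\max}$ or $\mathcal{P}^{(\ell)}_{\max}=\emptyset$, then $\lim_{n\to\infty}\mathbb{E}_\pi\big[\tfrac{1}{n+1}\#\{m\in\{0,\dots,n\}:X_m\in I_\ell\}\,\big|\,T>n\big]=0$; (ii) if $\rho_\ell=\rho_{\max}$ and $\mathcal{P}^{(\ell)}_{\max}\neq\emptyset$, then \[ \lim_{n\to\infty}\mathbb{E}_\pi\Big[\tfrac{1}{n+1}\#\{m\in\{0,\dots,n\}:X_m\in I_\ell\}\,\Big|\,T>n\Big]=\frac{\sum_{\theta\in\mathcal{P}^{(\ell)}_{\max}}\alpha_\theta\pi_{\theta_1}v_{\theta_1}\prod_{u\in H^-(\theta)}\frac{1}{\rho_{\max}-\rho_{\theta_u}}}{h^+_{\max}\sum_{\theta\in\mathcal{P}_{\max}}\alpha_\theta\pi_{\theta_1}v_{\theta_1}\prod_{u\in H^-(\theta)}\frac{1}{\rho_{\max}-\rho_{\theta_u}}}. \]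
   Context: Let $d\ge2$, $P=\begin{pmatrix}1&0\\R&Q\end{pmatrix}$ a stochastic $(d+1)\times(d+1)$ matrix with $R\in\mathbb{R}^{d\times1}$, $Q\in\mathbb{R}^{d\times d}$, $R,Q\ne0$, all eigenvalues of $Q$ of modulus $<1$. $(X_i)_{i\in\mathbb{N}_0}$ is the Markov chain with transition matrix $P$ (state $0$ absorbing), initial distribution $\pi$ on $\{1,\dots,d\}$, $T=\min\{i:X_i=0\}$. $Q$ is in Frobenius normal form: block lower triangular with blocks $Q_{ij}\in\mathbb{R}^{d_i\times d_j}$, $i,j\in\{1,\dots,k\}$, $Q_{ij}=0$ for $j>i$, each $Q_{ii}$ eventually positive with Perron--Frobenius eigenvalue $\rho_i$; $I_j=\{1+\sum_{i<j}d_i,\dots,\sum_{i\le j}d_i\}$; $\pi=(\pi_1,\dots,\pi_k)$ with $\pi_i\in\mathbb{R}^{1\times d_i}$. $v_i$ is a fixed normed positive right eigenvector of $Q_{ii}$ for $\rho_i$ ($v_i=1$ if $d_i=1$), $V_i^-$ the sum of the generalised eigenspaces of $Q_{ii}$ for its other eigenvalues. Admissible path: strictly decreasing $\theta=(\theta_1,\dots,\theta_\kappa)$ in $\{1,\dots,k\}$ with $Q_{\theta_u\theta_{u+1}}\ne0$ for $u<\kappa$; $\mathcal{P}$ the set of them, $\mathcal{P}^{(\ell)}$ those containing $\ell$. $\rho(\theta)=\max_u\rho_{\theta_u}$, $H^+(\theta)=\{u:\rho_{\theta_u}=\rho(\theta)\}$, $H^-(\theta)=\{u:\rho_{\theta_u}<\rho(\theta)\}$,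 $h^+(\theta)=\#H^+(\theta)$. $\rho_{\max}=\max_i\rho_i$, $h^+_{\max}=\max\{h^+(\theta):\theta\in\mathcal{P},\rho(\theta)=\rho_{\max}\}$, $\mathcal{P}_{\max}=\{\theta\in\mathcal{P}:h^+(\theta)=h^+_{\max},\ \rho(\theta)=\rho_{\max}\}$, $\mathcal{P}^{(\ell)}_{\max}=\mathcal{P}^{(\ell)}\cap\mathcal{P}_{\max}$. $\alpha_\theta=\alpha_{\theta_\kappa}\cdots\alpha_{\theta_1}$, where $\mathbf1=\alpha_{\theta_\kappa}v_{\theta_\kappa}+w_{\theta_\kappa}$ with $w_{\theta_\kappa}\in V^-_{\theta_\kappa}$ ($\mathbf 1$ the all-ones vector) and, for $u=\kappa-1,\dots,1$, $Q_{\theta_u\theta_{u+1}}v_{\theta_{u+1}}=\alpha_{\theta_u}v_{\theta_u}+w_{\theta_u}$ with $w_{\theta_u}\in V^-_{\theta_u}$. *)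

theory Defs
  imports Complex_Main "Jordan_Normal_Form.Spectral_Radius"
begin

text \<open>Conventions. The transient states of the chain are 1..d; the matrix Q is a
JNF matrix of dimension d x d whose (0-based) entry (a,b) is the transition
probability from chain state a+1 to chain state b+1. R is a vector of dimension d
whose entry a is the probability to go from state a+1 to the absorbing state 0.
Blocks are numbered 1..k, block j has size ds j, and its (0-based) matrix
positions are blk_idx ds j; the paper's I_j (chain states) is the set of
chain states a+1 with a in blk_idx ds j.\<close>

definition blk_off :: "(nat \<Rightarrow> nat) \<Rightarrow> nat \<Rightarrow> nat" where
  "blk_off ds j = (\<Sum>i\<in>{1..<j}. ds i)"

definition blk_idx :: "(nat \<Rightarrow> nat) \<Rightarrow> nat \<Rightarrow> nat set" where
  "blk_idx ds j = {blk_off ds j ..< blk_off ds j + ds j}"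

definition blk :: "real mat \<Rightarrow> (nat \<Rightarrow> nat) \<Rightarrow> nat \<Rightarrow> nat \<Rightarrow> real mat" where
  "blk Q ds i j = mat (ds i) (ds j) (\<lambda>(a,b). Q $$ (blk_off ds i + a, blk_off ds j + b))"

definition eventually_positive :: "real mat \<Rightarrow> bool" where
  "eventually_positive A = (\<exists>N. \<forall>n\<ge>N. \<forall>a<dim_row A. \<forall>b<dim_col A. (A ^\<^sub>m n) $$ (a,b) > 0)"

definition cmat :: "real mat \<Rightarrow> complex mat" where
  "cmat A = map_mat complex_of_real A"

text \<open>Perron--Frobenius eigenvalue rho_i of the (eventually positive) block Q_ii,
i.e. its spectral radius.\<close>
definition rho :: "real mat \<Rightarrow> (nat \<Rightarrow> nat) \<Rightarrow> nat \<Rightarrow> real" where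
  "rho Q ds i = spectral_radius (cmat (blk Q ds i i))"

definition gen_eigenspace :: "complex mat \<Rightarrow> complex \<Rightarrow> complex vec set" where
  "gen_eigenspace A \<mu> = {w \<in> carrier_vec (dim_row A).
      \<exists>m. ((A - \<mu> \<cdot>\<^sub>m 1\<^sub>m (dim_row A)) ^\<^sub>m m) *\<^sub>v w = 0\<^sub>v (dim_row A)}"

definition Vminus :: "real mat \<Rightarrow> (nat \<Rightarrow> nat) \<Rightarrow> nat \<Rightarrow> real vec set" where
  "Vminus Q ds i = (let A = cmat (blk Q ds i i); S = spectrum A - {complex_of_real (rho Q ds i)} in
     {w \<in> carrier_vec (ds i). \<exists>f. (\<forall>\<mu>\<in>S. f \<mu> \<in> gen_eigenspace A \<mu>) \<and>
        (\<forall>a<ds i. complex_of_real (w $ a) = (\<Sum>\<mu>\<in>S. f \<mu> $ a))})"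

definition ones_vec :: "nat \<Rightarrow> real vec" where
  "ones_vec n = vec n (\<lambda>_. 1)"

definition alpha_last :: "real mat \<Rightarrow> (nat \<Rightarrow> nat) \<Rightarrow> (nat \<Rightarrow> real vec) \<Rightarrow> nat \<Rightarrow> real" where
  "alpha_last Q ds v i = (THE a. \<exists>w\<in>Vminus Q ds i. ones_vec (ds i) = a \<cdot>\<^sub>v v i + w)"

definition alpha_step :: "real mat \<Rightarrow> (nat \<Rightarrow> nat) \<Rightarrow> (nat \<Rightarrow> real vec) \<Rightarrow> nat \<Rightarrow> nat \<Rightarrow> real" where
  "alpha_step Q ds v i j = (THE a. \<exists>w\<in>Vminus Q ds i. blk Q ds i j *\<^sub>v v j = a \<cdot>\<^sub>v v i + w)"

fun alpha_path :: "real mat \<Rightarrow> (nat \<Rightarrow> nat) \<Rightarrow> (nat \<Rightarrow> real vec) \<Rightarrow> nat list \<Rightarrow> real" where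
  "alpha_path Q ds v [] = 1"
| "alpha_path Q ds v [i] = alpha_last Q ds v i"
| "alpha_path Q ds v (i # j # rest) = alpha_step Q ds v i j * alpha_path Q ds v (j # rest)"

definition admissible :: "nat \<Rightarrow> real mat \<Rightarrow> (nat \<Rightarrow> nat) \<Rightarrow> nat list \<Rightarrow> bool" where
  "admissible k Q ds \<theta> = (\<theta> \<noteq> [] \<and> sorted_wrt (>) \<theta> \<and> set \<theta> \<subseteq> {1..k} \<and>
     (\<forall>u. Suc u < length \<theta> \<longrightarrow>
        blk Q ds (\<theta> ! u) (\<theta> ! Suc u) \<noteq> 0\<^sub>m (ds (\<theta> ! u)) (ds (\<theta> ! Suc u))))"

definition adm_paths :: "nat \<Rightarrow> real mat \<Rightarrow> (nat \<Rightarrow> nat) \<Rightarrow> nat list set" where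
  "adm_paths k Q ds = {\<theta>. admissible k Q ds \<theta>}"

definition rho_path :: "real mat \<Rightarrow> (nat \<Rightarrow> nat) \<Rightarrow> nat list \<Rightarrow> real" where
  "rho_path Q ds \<theta> = Max ((\<lambda>u. rho Q ds (\<theta> ! u)) ` {..<length \<theta>})"

definition Hplus :: "real mat \<Rightarrow> (nat \<Rightarrow> nat) \<Rightarrow> nat list \<Rightarrow> nat set" where
  "Hplus Q ds \<theta> = {u. u < length \<theta> \<and> rho Q ds (\<theta> ! u) = rho_path Q ds \<theta>}"

definition Hminus :: "real mat \<Rightarrow> (nat \<Rightarrow> nat) \<Rightarrow> nat list \<Rightarrow> nat set" where
  "Hminus Q ds \<theta> = {u. u < length \<theta> \<and> rho Q ds (\<theta> ! u) < rho_path Q ds \<theta>}"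

definition hplus :: "real mat \<Rightarrow> (nat \<Rightarrow> nat) \<Rightarrow> nat list \<Rightarrow> nat" where
  "hplus Q ds \<theta> = card (Hplus Q ds \<theta>)"

definition rho_max :: "nat \<Rightarrow> real mat \<Rightarrow> (nat \<Rightarrow> nat) \<Rightarrow> real" where
  "rho_max k Q ds = Max (rho Q ds ` {1..k})"

definition hplus_max :: "nat \<Rightarrow> real mat \<Rightarrow> (nat \<Rightarrow> nat) \<Rightarrow> nat" where
  "hplus_max k Q ds = Max (hplus Q ds ` {\<theta> \<in> adm_paths k Q ds. rho_path Q ds \<theta> = rho_max k Q ds})"

definition P_max :: "nat \<Rightarrow> real mat \<Rightarrow> (nat \<Rightarrow> nat) \<Rightarrow> nat list set" where
  "P_max k Q ds = {\<theta> \<in> adm_paths k Q ds. hplus Q ds \<theta> = hplus_max k Q ds \<and> rho_path Q ds \<theta> = rho_max k Q ds}"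

definition P_max_at :: "nat \<Rightarrow> real mat \<Rightarrow> (nat \<Rightarrow> nat) \<Rightarrow> nat \<Rightarrow> nat list set" where
  "P_max_at k Q ds l = {\<theta> \<in> P_max k Q ds. l \<in> set \<theta>}"

definition pi_v :: "real vec \<Rightarrow> (nat \<Rightarrow> nat) \<Rightarrow> (nat \<Rightarrow> real vec) \<Rightarrow> nat \<Rightarrow> real" where
  "pi_v \<pi> ds v i = (\<Sum>a<ds i. \<pi> $ (blk_off ds i + a) * v i $ a)"

definition path_weight :: "nat \<Rightarrow> real mat \<Rightarrow> (nat \<Rightarrow> nat) \<Rightarrow> (nat \<Rightarrow> real vec) \<Rightarrow> real vec \<Rightarrow> nat list \<Rightarrow> real" where
  "path_weight k Q ds v \<pi> \<theta> = alpha_path Q ds v \<theta> * pi_v \<pi> ds v (hd \<theta>) *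
     (\<Prod>u\<in>Hminus Q ds \<theta>. 1 / (rho_max k Q ds - rho Q ds (\<theta> ! u)))"

definition Ptrans :: "real mat \<Rightarrow> real vec \<Rightarrow> nat \<Rightarrow> nat \<Rightarrow> real" where
  "Ptrans Q R a b = (if a = 0 then (if b = 0 then 1 else 0)
      else if b = 0 then R $ (a - 1) else Q $$ (a - 1, b - 1))"

definition init_dist :: "real vec \<Rightarrow> nat \<Rightarrow> real" where
  "init_dist \<pi> a = (if a = 0 then 0 else \<pi> $ (a - 1))"

definition path_prob :: "real mat \<Rightarrow> real vec \<Rightarrow> real vec \<Rightarrow> nat list \<Rightarrow> real" where
  "path_prob Q R \<pi> xs = init_dist \<pi> (xs ! 0) *
      (\<Prod>m<length xs - 1. Ptrans Q R (xs ! m) (xs ! Suc m))"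

definition state_paths :: "nat \<Rightarrow> nat \<Rightarrow> nat list set" where
  "state_paths d n = {xs. length xs = Suc n \<and> set xs \<subseteq> {0..d}}"

definition T_gt :: "nat \<Rightarrow> nat list \<Rightarrow> bool" where
  "T_gt n xs = (\<forall>m\<le>n. xs ! m \<noteq> 0)"

definition occ_frac :: "(nat \<Rightarrow> nat) \<Rightarrow> nat \<Rightarrow> nat \<Rightarrow> nat list \<Rightarrow> real" where
  "occ_frac ds l n xs = real (card {m \<in> {0..n}. xs ! m \<noteq> 0 \<and> xs ! m - 1 \<in> blk_idx ds l}) / real (Suc n)"

definition cond_occ :: "nat \<Rightarrow> real mat \<Rightarrow> real vec \<Rightarrow> real vec \<Rightarrow> (nat \<Rightarrow> nat) \<Rightarrow> nat \<Rightarrow> nat \<Rightarrow> real" where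
  "cond_occ d Q R \<pi> ds l n =
     (\<Sum>xs\<in>{xs \<in> state_paths d n. T_gt n xs}. path_prob Q R \<pi> xs * occ_frac ds l n xs) /
     (\<Sum>xs\<in>{xs \<in> state_paths d n. T_gt n xs}. path_prob Q R \<pi> xs)"

end

theory Submission
  imports Defs
begin

text \<open>
  Both the survival probabilities \<open>\<pi> Q\<^sup>n 1\<close> and the summed occupation weights
  \<open>\<Sum>m\<le>n. \<pi> Q\<^sup>m D Q\<^bsup>n-m\<^esup> 1\<close>, with \<open>D\<close> the projection to block \<open>l\<close>, split into
  contributions of descending block paths. Along a path each block of maximal Perron-Frobenius
  eigenvalue \<open>\<rho>\<close> raises the polynomial order of the contribution, normalised by \<open>\<rho>\<^sup>n\<close>, by
  one, because only the component along the right eigenvector survives; this component is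
  extracted by the normalised left eigenvector, which also computes the coefficients \<open>\<alpha>\<close>. A scalar
  block with smaller eigenvalue \<open>\<rho>\<^sub>i\<close> contributes the factor \<open>1 / (\<rho> - \<rho>\<^sub>i)\<close> of a geometric series.
  The occupation weight of a path through \<open>l\<close> is the contribution of the same path with \<open>l\<close>
  doubled, so for a maximal block it has one order more and the same coefficient, and the
  quotient of \<open>n^h / fact h\<close> and \<open>n * n^(h - 1) / fact (h - 1)\<close> yields the factor \<open>1 / h\<close>.
\<close>

section \<open>Growth of linear recursions\<close>

text \<open>The asymptotics use no spectral decomposition of \<open>Q\<close>. Conjugating a block
  by its positive right eigenvector and dividing by the eigenvalue gives a stochastic matrix with a
  strictly positive power. Such a power shrinks the oscillation, maximum minus minimum, by a fixed
  factor below one, so a forced recursion differs from its average under the stationary weights only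
  by terms of lower order, and the average merely sums the source. Complex eigenvalues and Jordan
  forms enter at one place: to show that \<open>Vminus\<close>, defined through generalised
  eigenspaces, is the kernel of pairing with the left eigenvector. Writing the coefficients \<alpha>
  as such pairings also shows that they are nonnegative, so leading terms of different paths cannot
  cancel and the single path of (A2) keeps the denominator of the limit positive. Eventual
  positivity and (A1) force the blocks below the maximum to have size one, which reduces them to
  scalar recursions.\<close>

text \<open>Iteration over \<open>j\<close> windows gives a geometric bound. Since the hypothesis
  links only times \<open>N\<close> apart, a time is split into one of \<open>N\<close> consecutive
  start times and a number of windows.\<close>

lemma contracting_windows_tendsto_zero:
  fixes e \<delta> :: "nat \<Rightarrow> real"
  assumes N: "N \<ge> 1" and q: "0 \<le> q" "q < 1" and nonneg: "\<And>n. 0 \<le> e n"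
    and rec: "\<forall>\<^sub>F n in sequentially. e (n + N) \<le> q * e n + \<delta> n"
    and \<delta>: "\<delta> \<longlonglongrightarrow> 0"
  shows "e \<longlonglongrightarrow> 0"
proof (rule LIMSEQ_I)
  fix \<epsilon> :: real assume \<epsilon>: "0 < \<epsilon>"
  \<comment> \<open>This threshold makes \<open>\<epsilon> / 2\<close> the fixed point of the map x
    -> q x + (1 - q) \<epsilon> / 2, so the accumulated error never exceeds it.\<close>
  have "0 < (1 - q) * (\<epsilon> / 2)" using \<epsilon> q by simp
  hence "\<forall>\<^sub>F n in sequentially. \<delta> n < (1 - q) * (\<epsilon> / 2)"
    using \<delta> by (rule order_tendstoD(2)[rotated])
  with rec have "\<forall>\<^sub>F n in sequentially. e (n + N) \<le> q * e n + (1 - q) * (\<epsilon> / 2)"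
    by eventually_elim auto
  then obtain M where M: "\<And>n. n \<ge> M \<Longrightarrow> e (n + N) \<le> q * e n + (1 - q) * (\<epsilon> / 2)"
    by (auto simp: eventually_sequentially)
  have geo: "e (n + j * N) \<le> q ^ j * e n + \<epsilon> / 2" if "n \<ge> M" for n j
  proof (induction j)
    case 0
    then show ?case using \<epsilon> by simp
  next
    case (Suc j)
    have "e (n + Suc j * N) = e ((n + j * N) + N)" by (simp add: algebra_simps)
    also have "\<dots> \<le> q * e (n + j * N) + (1 - q) * (\<epsilon> / 2)" using M that by simp
    also have "\<dots> \<le> q * (q ^ j * e n + \<epsilon> / 2) + (1 - q) * (\<epsilon> / 2)"
      using Suc q by (intro add_mono mult_left_mono) auto
    also have "\<dots> = q ^ Suc j * e n + \<epsilon> / 2" by (simp add: field_simps)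
    finally show ?case .
  qed
  \<comment> \<open>A common bound for the start values of all \<open>N\<close> residue
    classes.\<close>
  define E where "E = (\<Sum>i<N. e (M + i)) + 1"
  have E: "E > 0" using nonneg by (simp add: E_def add_nonneg_pos sum_nonneg)
  have eE: "e (M + i) \<le> E" if "i < N" for i
  proof -
    have "e (M + i) \<le> (\<Sum>i<N. e (M + i))"
      using member_le_sum[of i "{..<N}" "\<lambda>i. e (M + i)"] that nonneg by simp
    thus ?thesis by (simp add: E_def)
  qed
  have "(\<lambda>j. q ^ j * E) \<longlonglongrightarrow> 0"
    by (intro tendsto_mult_left_zero LIMSEQ_realpow_zero q)
  hence "\<forall>\<^sub>F j in sequentially. q ^ j * E < \<epsilon> / 2"
    using \<epsilon> by (intro order_tendstoD(2)) auto
  then obtain J where J: "\<And>j. j \<ge> J \<Longrightarrow> q ^ j * E < \<epsilon> / 2" by (auto simp: eventually_sequentially)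
  show "\<exists>n0. \<forall>n\<ge>n0. norm (e n - 0) < \<epsilon>"
  proof (intro exI allI impI)
    fix n assume n: "M + J * N \<le> n"
    define j i where "j = (n - M) div N" and "i = (n - M) mod N"
    have i: "i < N" using N by (simp add: i_def)
    have nn: "n = (M + i) + j * N" using n by (simp add: i_def j_def)
    have "J \<le> j" using n N by (simp add: j_def less_eq_div_iff_mult_less_eq)
    have "e n \<le> q ^ j * e (M + i) + \<epsilon> / 2" using geo[of "M + i" j] nn by simp
    also have "\<dots> \<le> q ^ j * E + \<epsilon> / 2" using eE[OF i] q by (simp add: mult_left_mono)
    also have "\<dots> < \<epsilon>" using J[OF \<open>J \<le> j\<close>] by simp
    finally show "norm (e n - 0) < \<epsilon>" using nonneg[of n] by simp
  qed
qed

lemma contracting_tendsto_zero: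
  fixes x r b :: "nat \<Rightarrow> real"
  assumes rec: "\<And>n. x (Suc n) = r n * x n + b n"
    and r: "r \<longlonglongrightarrow> R" "\<bar>R\<bar> < 1" and b: "b \<longlonglongrightarrow> 0"
  shows "x \<longlonglongrightarrow> 0"
proof -
  obtain q where q: "\<bar>R\<bar> < q" "q < 1" using r(2) dense by blast
  have "(\<lambda>n. \<bar>r n\<bar>) \<longlonglongrightarrow> \<bar>R\<bar>" using r(1) by (rule tendsto_rabs)
  hence "\<forall>\<^sub>F n in sequentially. \<bar>r n\<bar> < q" using q(1) by (rule order_tendstoD(2))
  hence ev: "\<forall>\<^sub>F n in sequentially. \<bar>x (n + 1)\<bar> \<le> q * \<bar>x n\<bar> + \<bar>b n\<bar>"
  proof eventually_elim
    case (elim n)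
    have "\<bar>x (n + 1)\<bar> \<le> \<bar>r n\<bar> * \<bar>x n\<bar> + \<bar>b n\<bar>"
      using abs_triangle_ineq[of "r n * x n" "b n"] by (simp add: rec abs_mult)
    also have "\<dots> \<le> q * \<bar>x n\<bar> + \<bar>b n\<bar>" using elim by (intro add_right_mono mult_right_mono) auto
    finally show ?case .
  qed
  have "(\<lambda>n. \<bar>x n\<bar>) \<longlonglongrightarrow> 0"
    by (rule contracting_windows_tendsto_zero[OF _ _ _ _ ev])
       (use q b tendsto_rabs_zero in auto)
  thus ?thesis by (simp add: tendsto_rabs_zero_iff)
qed

text \<open>The limit must solve c = r c + a. After division by \<open>g\<close> the coefficient
  becomes \<open>r * (g n / g (Suc n))\<close>, which varies with \<open>n\<close> but tends to
  \<open>r\<close>; subtracting c leaves a contraction with vanishing source.\<close>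

lemma contracting_tendsto:
  fixes w z g :: "nat \<Rightarrow> real"
  assumes rec: "\<And>n. w (Suc n) = r * w n + z n" and r: "\<bar>r\<bar> < 1"
    and z: "(\<lambda>n. z n / g n) \<longlonglongrightarrow> a" and g: "\<And>n. g n > 0" "(\<lambda>n. g n / g (Suc n)) \<longlonglongrightarrow> 1"
  shows "(\<lambda>n. w n / g n) \<longlonglongrightarrow> a / (1 - r)"
proof -
  define c where "c = a / (1 - r)"
  have "c * (1 - r) = a" using r by (simp add: c_def)
  hence c: "a = c - r * c" by (simp add: algebra_simps)
  have g0: "g n \<noteq> 0" for n using g(1)[of n] by simp
  have "(\<lambda>n. w n / g n - c) \<longlonglongrightarrow> 0"
  proof (rule contracting_tendsto_zero)
    show "w (Suc n) / g (Suc n) - c = (r * (g n / g (Suc n))) * (w n / g n - c)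
        + ((g n / g (Suc n)) * (z n / g n) + r * c * (g n / g (Suc n)) - c)" for n
    proof -
      let ?t = "g n / g (Suc n)"
      have t: "?t * (x / g n) = x / g (Suc n)" for x using g0 by simp
      have "(r * ?t) * (w n / g n - c) + (?t * (z n / g n) + r * c * ?t - c)
          = r * (?t * (w n / g n)) + ?t * (z n / g n) - c" by (simp only: algebra_simps)
      also have "\<dots> = r * (w n / g (Suc n)) + z n / g (Suc n) - c" by (simp only: t)
      finally show ?thesis by (simp add: rec add_divide_distrib)
    qed
    show "(\<lambda>n. r * (g n / g (Suc n))) \<longlonglongrightarrow> r" using tendsto_mult_left[OF g(2), of r] by simp
    have "(\<lambda>n. (g n / g (Suc n)) * (z n / g n) + r * c * (g n / g (Suc n)) - c) \<longlonglongrightarrow> 1 * a + r * c * 1 - c"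
      by (intro tendsto_intros g z)
    thus "(\<lambda>n. (g n / g (Suc n)) * (z n / g n) + r * c * (g n / g (Suc n)) - c) \<longlonglongrightarrow> 0"
      by (simp add: c)
  qed (use r in auto)
  thus ?thesis unfolding c_def by (rule LIM_zero_cancel)
qed

section \<open>Asymptotics of powers and of partial sums\<close>

lemma Suc_ratio_tendsto_1: "(\<lambda>n. real (Suc n) / real (Suc (Suc n))) \<longlonglongrightarrow> 1"
proof -
  have "(\<lambda>n. 1 - inverse (real (Suc (Suc n)))) \<longlonglongrightarrow> 1 - 0"
    by (intro tendsto_intros LIMSEQ_Suc[OF LIMSEQ_inverse_real_of_nat])
  thus ?thesis by (simp add: field_simps)
qed

lemma Suc_ratio_power_tendsto_1: "(\<lambda>n. real (Suc n) ^ h / real (Suc (Suc n)) ^ h) \<longlonglongrightarrow> 1"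
  using tendsto_power[OF Suc_ratio_tendsto_1, of h] by (simp add: power_divide)

text \<open>A discrete derivative: with t = n / (n + 1) the quotient is the geometric sum 1 + t +
  ... + t^h, each term of which tends to one.\<close>

lemma telescoping_power_ratio:
  "(\<lambda>n. (real (Suc n) ^ Suc h - real n ^ Suc h) / real (Suc n) ^ h) \<longlonglongrightarrow> real (Suc h)"
proof -
  have "(\<lambda>n. real n / real (Suc n)) \<longlonglongrightarrow> 1"
    using Suc_ratio_tendsto_1 by (subst filterlim_sequentially_Suc[symmetric]) simp
  hence "(\<lambda>n. \<Sum>i<Suc h. (real n / real (Suc n)) ^ i) \<longlonglongrightarrow> (\<Sum>i<Suc h. 1 ^ i)"
    by (intro tendsto_intros)
  moreover have "(\<Sum>i<Suc h. (real n / real (Suc n)) ^ i)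
      = (real (Suc n) ^ Suc h - real n ^ Suc h) / real (Suc n) ^ h" for n
  proof -
    let ?t = "real n / real (Suc n)"
    have s: "real (Suc n) * (1 - ?t) = 1" by (simp add: field_simps)
    have "(\<Sum>i<Suc h. ?t ^ i) = real (Suc n) * ((1 - ?t) * (\<Sum>i<Suc h. ?t ^ i))"
      using s by (simp only: mult.assoc[symmetric] mult_1)
    also have "(1 - ?t) * (\<Sum>i<Suc h. ?t ^ i) = 1 - ?t ^ Suc h" by (rule one_diff_power_eq[symmetric])
    also have "real (Suc n) * \<dots> = (real (Suc n) ^ Suc h - real n ^ Suc h) / real (Suc n) ^ h"
      by (simp add: divide_simps del: of_nat_Suc)
    finally show ?thesis .
  qed
  ultimately show ?thesis by simp
qed

text \<open>A Cesaro argument: terms from \<open>M\<close> on are at most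
  \<open>\<epsilon> / 2 * g n\<close> by monotonicity, and the finitely many earlier ones add up to
  a constant that the factor \<open>Suc n\<close> absorbs.\<close>

lemma sum_ratio_tendsto_zero:
  fixes s g :: "nat \<Rightarrow> real"
  assumes s: "(\<lambda>n. s n / g n) \<longlonglongrightarrow> 0" and g: "\<And>n. 0 < g n" "mono g"
  shows "(\<lambda>n. (\<Sum>m<n. s m) / (real (Suc n) * g n)) \<longlonglongrightarrow> 0"
proof (rule LIMSEQ_I)
  fix \<epsilon> :: real assume \<epsilon>: "0 < \<epsilon>"
  obtain M where M: "\<And>n. n \<ge> M \<Longrightarrow> \<bar>s n / g n\<bar> < \<epsilon> / 2"
    using LIMSEQ_D[OF s, of "\<epsilon> / 2"] \<epsilon> by auto
  define C where "C = (\<Sum>m<M. \<bar>s m\<bar>) / g 0"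
  obtain K :: nat where K: "C / (\<epsilon> / 2) < real K" using reals_Archimedean2 by blast
  have C0: "0 \<le> C" using g(1)[of 0] by (simp add: C_def sum_nonneg)
  show "\<exists>n0. \<forall>n\<ge>n0. norm ((\<Sum>m<n. s m) / (real (Suc n) * g n) - 0) < \<epsilon>"
  proof (intro exI allI impI)
    fix n assume n: "max M K \<le> n"
    have gn: "0 < g n" "g 0 \<le> g n" using g by (auto simp: mono_def)
    have "\<bar>\<Sum>m<n. s m\<bar> \<le> (\<Sum>m<n. \<bar>s m\<bar>)" by (rule sum_abs)
    also have "\<dots> = (\<Sum>m<M. \<bar>s m\<bar>) + (\<Sum>m=M..<n. \<bar>s m\<bar>)"
      using n by (subst sum.atLeastLessThan_concat[of 0 M n, symmetric, folded atLeast0LessThan[symmetric]]) (auto simp: atLeast0LessThan)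
    also have "(\<Sum>m=M..<n. \<bar>s m\<bar>) \<le> (\<Sum>m=M..<n. \<epsilon> / 2 * g n)"
    proof (rule sum_mono)
      fix m assume m: "m \<in> {M..<n}"
      have "\<bar>s m\<bar> \<le> \<epsilon> / 2 * g m" using M[of m] m g(1)[of m] by (simp add: field_simps)
      also have "\<dots> \<le> \<epsilon> / 2 * g n" using m \<epsilon> g(2) by (intro mult_left_mono) (auto simp: mono_def)
      finally show "\<bar>s m\<bar> \<le> \<epsilon> / 2 * g n" .
    qed
    also have "\<dots> \<le> real (Suc n) * (\<epsilon> / 2 * g n)"
      using \<epsilon> gn by (simp add: mult_right_mono)
    also have "(\<Sum>m<M. \<bar>s m\<bar>) = C * g 0" using g(1)[of 0] by (simp add: C_def)
    also have "C * g 0 \<le> C * g n" using C0 gn by (simp add: mult_left_mono)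
    also have "C < real (Suc n) * (\<epsilon> / 2)"
    proof -
      have "C < real K * (\<epsilon> / 2)" using K \<epsilon> by (simp add: field_simps)
      also have "\<dots> \<le> real (Suc n) * (\<epsilon> / 2)" using n \<epsilon> by (intro mult_right_mono) auto
      finally show ?thesis .
    qed
    finally have "\<bar>\<Sum>m<n. s m\<bar> < (real (Suc n) * g n) * \<epsilon>" using gn by (simp add: algebra_simps)
    thus "norm ((\<Sum>m<n. s m) / (real (Suc n) * g n) - 0) < \<epsilon>"
      using gn by (simp add: abs_mult pos_divide_less_eq mult.commute del: of_nat_Suc)
  qed
qed

text \<open>As in the Stolz-Cesaro theorem, \<open>s\<close> is compared with a multiple of
  differences of \<open>n ^ Suc h\<close>, whose sums telescope; the choice of \<open>a'\<close>
  makes the remainder o(n^h).\<close>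

lemma sum_power_growth:
  fixes s :: "nat \<Rightarrow> real"
  assumes "(\<lambda>n. s n / real (Suc n) ^ h) \<longlonglongrightarrow> a"
  shows "(\<lambda>n. (\<Sum>m<n. s m) / real (Suc n) ^ Suc h) \<longlonglongrightarrow> a / real (Suc h)"
proof -
  define a' where "a' = a / real (Suc h)"
  define t where "t n = s n - a' * (real (Suc n) ^ Suc h - real n ^ Suc h)" for n
  have "(\<lambda>n. s n / real (Suc n) ^ h - a' * ((real (Suc n) ^ Suc h - real n ^ Suc h) / real (Suc n) ^ h))
      \<longlonglongrightarrow> a - a' * real (Suc h)"
    by (intro tendsto_diff tendsto_mult_left assms telescoping_power_ratio)
  hence t: "(\<lambda>n. t n / real (Suc n) ^ h) \<longlonglongrightarrow> a - a' * real (Suc h)"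
    by (simp only: t_def diff_divide_distrib[of "s _"] times_divide_eq_right)
  have "(\<lambda>n. (\<Sum>m<n. t m) / (real (Suc n) * real (Suc n) ^ h)) \<longlonglongrightarrow> 0"
    by (rule sum_ratio_tendsto_zero) (use t in \<open>auto simp: a'_def mono_def intro!: power_mono\<close>)
  moreover have "(\<lambda>n. real n ^ Suc h / real (Suc n) ^ Suc h) \<longlonglongrightarrow> 1"
    by (subst filterlim_sequentially_Suc[symmetric]) (rule Suc_ratio_power_tendsto_1)
  ultimately have "(\<lambda>n. (\<Sum>m<n. t m) / (real (Suc n) * real (Suc n) ^ h)
      + a' * (real n ^ Suc h / real (Suc n) ^ Suc h)) \<longlonglongrightarrow> 0 + a' * 1"
    by (intro tendsto_intros)
  moreover have "(\<Sum>m<n. t m) = (\<Sum>m<n. s m) - a' * real n ^ Suc h" for n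
    using sum_lessThan_telescope[of "\<lambda>n. real n ^ Suc h" n]
    by (simp add: t_def sum_subtractf sum_distrib_left[symmetric] del: power_Suc of_nat_Suc)
  ultimately show ?thesis by (simp add: a'_def diff_divide_distrib)
qed

text \<open>For \<open>h \<ge> 1\<close> the second condition says that \<open>y n\<close> grows like
  \<open>c * n ^ (h - 1) / fact (h - 1)\<close> and implies the first one; for \<open>h = 0\<close> the two conditions say that
  \<open>y\<close> sums to \<open>c\<close> and is \<open>o(1 / n)\<close>. Both are needed to start the induction along a path whose
  last blocks have Perron-Frobenius eigenvalues below the maximum.\<close>

definition growth :: "nat \<Rightarrow> (nat \<Rightarrow> real) \<Rightarrow> real \<Rightarrow> bool" where
  "growth h y c \<longleftrightarrow> (\<lambda>n. (\<Sum>m<n. y m) / real (Suc n) ^ h) \<longlonglongrightarrow> c / fact h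
     \<and> (\<lambda>n. y n / (real (Suc n) ^ h / real (Suc n))) \<longlonglongrightarrow> c * real h / fact h"

section \<open>Calculus of orders and leading coefficients\<close>

lemma growth_add: "growth h y c \<Longrightarrow> growth h y' c' \<Longrightarrow> growth h (\<lambda>n. y n + y' n) (c + c')"
  unfolding growth_def
  by (auto simp: sum.distrib add_divide_distrib distrib_right intro!: tendsto_add simp del: of_nat_Suc)

lemma growth_cmult: "growth h y c \<Longrightarrow> growth h (\<lambda>n. b * y n) (b * c)"
  unfolding growth_def sum_distrib_left[symmetric] mult.assoc times_divide_eq_right[symmetric]
  by (auto intro!: tendsto_mult_left simp del: of_nat_Suc times_divide_eq_right)

lemma growth_zero: "growth h (\<lambda>n. 0) 0"
  by (simp add: growth_def)

lemma growth_sum: "(\<And>a. a \<in> A \<Longrightarrow> growth h (y a) (c a)) \<Longrightarrow> growth h (\<lambda>n. \<Sum>a\<in>A. y a n) (\<Sum>a\<in>A. c a)"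
  by (induction A rule: infinite_finite_induct) (auto intro: growth_add growth_zero)

text \<open>The source feeding the last block of every path: summable with total one and zero from
  time 1 on, hence of order 0.\<close>

lemma growth_impulse: "growth 0 (\<lambda>n. if n = 0 then 1 else 0) 1"
proof -
  have "\<forall>\<^sub>F n in sequentially. (\<Sum>m<n. if m = 0 then 1 else 0) = (1::real)"
    by (intro eventually_sequentiallyI[of 1]) simp
  hence "(\<lambda>n. \<Sum>m<n. if m = 0 then 1 else (0::real)) \<longlonglongrightarrow> 1" by (rule tendsto_eventually)
  moreover have "\<forall>\<^sub>F n in sequentially. (if n = 0 then 1 else 0) * real (Suc n) = 0"
    by (intro eventually_sequentiallyI[of 1]) simp
  hence "(\<lambda>n. (if n = 0 then 1 else 0) * real (Suc n)) \<longlonglongrightarrow> 0" by (rule tendsto_eventually)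
  ultimately show ?thesis by (simp add: growth_def)
qed

text \<open>The means of discarding subdominant paths: the additional factor 1 / (n + 1) sends both
  limits to zero.\<close>

lemma growth_Suc_zero:
  assumes "growth h y c"
  shows "growth (Suc h) y 0"
proof -
  have i: "(\<lambda>n. inverse (real (Suc n))) \<longlonglongrightarrow> 0" by (rule LIMSEQ_inverse_real_of_nat)
  have "(\<lambda>n. (\<Sum>m<n. y m) / real (Suc n) ^ h * inverse (real (Suc n))) \<longlonglongrightarrow> c / fact h * 0"
    using assms by (intro tendsto_mult i) (simp add: growth_def)
  moreover have "(\<lambda>n. y n / (real (Suc n) ^ h / real (Suc n)) * inverse (real (Suc n))) \<longlonglongrightarrow> c * real h / fact h * 0"
    using assms by (intro tendsto_mult i) (simp add: growth_def)
  ultimately show ?thesis by (simp add: growth_def field_simps del: of_nat_Suc)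
qed

lemma growth_less_zero:
  assumes "growth h y c" "h < h'"
  shows "growth h' y 0"
  using assms(2)
proof (induction h')
  case (Suc h')
  then show ?case using assms(1) by (auto simp: less_Suc_eq intro: growth_Suc_zero)
qed simp

text \<open>Because \<open>y 0 = 0\<close>, the partial sums obey the same recursion without a
  boundary term. Both limits are then instances of \<open>contracting_tendsto\<close>, for the
  weights \<open>real (Suc n) ^ h\<close> and \<open>real (Suc n) ^ h / real (Suc n)\<close>; the
  latter also makes sense for \<open>h = 0\<close>.\<close>

lemma growth_contraction:
  assumes rec: "\<And>n. y (Suc n) = r * y n + z n" and y0: "y 0 = 0" and r: "\<bar>r\<bar> < 1"
    and z: "growth h z c"
  shows "growth h y (c / (1 - r))"
proof -
  have "(\<lambda>n. (\<Sum>m<n. y m) / real (Suc n) ^ h) \<longlonglongrightarrow> (c / fact h) / (1 - r)"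
  proof (rule contracting_tendsto[where z = "\<lambda>n. \<Sum>m<n. z m"])
    show "(\<Sum>m<Suc n. y m) = r * (\<Sum>m<n. y m) + (\<Sum>m<n. z m)" for n
      unfolding sum.lessThan_Suc_shift by (simp add: y0 rec sum.distrib sum_distrib_left)
  qed (use r z Suc_ratio_power_tendsto_1 in \<open>auto simp: growth_def\<close>)
  moreover have "(\<lambda>n. y n / (real (Suc n) ^ h / real (Suc n))) \<longlonglongrightarrow> (c * real h / fact h) / (1 - r)"
  proof (rule contracting_tendsto[where z = z])
    have "(\<lambda>n. real (Suc n) ^ h / real (Suc (Suc n)) ^ h / (real (Suc n) / real (Suc (Suc n)))) \<longlonglongrightarrow> 1 / 1"
      by (intro tendsto_divide Suc_ratio_power_tendsto_1 Suc_ratio_tendsto_1) simp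
    thus "(\<lambda>n. real (Suc n) ^ h / real (Suc n) / (real (Suc (Suc n)) ^ h / real (Suc (Suc n)))) \<longlonglongrightarrow> 1"
      by (simp add: field_simps del: of_nat_Suc)
  qed (use rec r z in \<open>auto simp: growth_def\<close>)
  ultimately show ?thesis by (simp add: growth_def mult.commute)
qed

text \<open>Summation turns c n^h / h! into c n^(h+1) / (h+1)!, so at positive order the pointwise
  condition suffices. The factorials of \<open>growth\<close> are chosen for this.\<close>

lemma growth_SucI:
  assumes "(\<lambda>n. y n / real (Suc n) ^ h) \<longlonglongrightarrow> c / fact h"
  shows "growth (Suc h) y c"
  using sum_power_growth[OF assms] assms
  by (simp add: growth_def field_simps del: of_nat_Suc)

text \<open>Dropping the initial value must not change the partial sums, which is the role of
  \<open>y 0 = 0\<close>: at order 0 the coefficient is the total sum.\<close>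

lemma growth_Suc_shift:
  assumes "growth h y c" "y 0 = 0"
  shows "growth h (\<lambda>n. y (Suc n)) c"
proof -
  have p: "(\<lambda>n. real (Suc (Suc n)) ^ h / real (Suc n) ^ h) \<longlonglongrightarrow> 1" for h
    using tendsto_inverse[OF Suc_ratio_power_tendsto_1[of h]] by (simp del: of_nat_Suc)
  have s: "(\<Sum>m<n. y (Suc m)) = (\<Sum>m<Suc n. y m)" for n
    unfolding sum.lessThan_Suc_shift by (simp add: assms)
  have "(\<lambda>n. (\<Sum>m<Suc n. y m) / real (Suc (Suc n)) ^ h * (real (Suc (Suc n)) ^ h / real (Suc n) ^ h))
      \<longlonglongrightarrow> c / fact h * 1"
    by (intro tendsto_mult p LIMSEQ_Suc[where f = "\<lambda>n. (\<Sum>m<n. y m) / real (Suc n) ^ h"])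
       (use assms in \<open>simp add: growth_def\<close>)
  moreover have "(\<lambda>n. y (Suc n) / (real (Suc (Suc n)) ^ h / real (Suc (Suc n))) *
      (real (Suc (Suc n)) ^ h / real (Suc n) ^ h) * (real (Suc n) ^ 1 / real (Suc (Suc n)) ^ 1)) \<longlonglongrightarrow> c * real h / fact h * 1 * 1"
    by (intro tendsto_mult p Suc_ratio_power_tendsto_1 LIMSEQ_Suc[where f = "\<lambda>n. y n / (real (Suc n) ^ h / real (Suc n))"])
       (use assms in \<open>simp add: growth_def\<close>)
  ultimately show ?thesis by (simp add: growth_def s field_simps del: of_nat_Suc sum.lessThan_Suc)
qed

section \<open>Primitive stochastic matrices\<close>

text \<open>It vanishes on constants, the fixed functions of a stochastic matrix, so convergence to
  equilibrium can be measured before a stationary vector is known.\<close>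

definition osc :: "'a set \<Rightarrow> ('a \<Rightarrow> real) \<Rightarrow> real" where
  "osc I x = Max (x ` I) - Min (x ` I)"

lemma osc_bounds:
  assumes "finite I" "a \<in> I" "b \<in> I"
  shows "x a - x b \<le> osc I x"
proof -
  have "x a \<le> Max (x ` I)" "Min (x ` I) \<le> x b" using assms by auto
  thus ?thesis by (simp add: osc_def)
qed

lemma osc_leI:
  assumes "finite I" "I \<noteq> {}" "\<And>a b. a \<in> I \<Longrightarrow> b \<in> I \<Longrightarrow> x a - x b \<le> C"
  shows "osc I x \<le> C"
proof -
  have "Max (x ` I) \<in> x ` I" "Min (x ` I) \<in> x ` I" using assms(1,2) by (auto intro!: Max_in Min_in)
  thus ?thesis using assms(3) by (auto simp: osc_def)
qed

lemma osc_cong: "(\<And>a. a \<in> I \<Longrightarrow> x a = y a) \<Longrightarrow> osc I x = osc I y"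
  by (simp add: osc_def cong: image_cong)

lemma osc_nonneg:
  assumes "finite I" "I \<noteq> {}"
  shows "0 \<le> osc I x"
proof -
  obtain a where "a \<in> I" using assms(2) by blast
  thus ?thesis using osc_bounds[OF assms(1), of a a x] by simp
qed

lemma osc_add:
  assumes "finite I" "I \<noteq> {}"
  shows "osc I (\<lambda>a. x a + y a) \<le> osc I x + osc I y"
proof (rule osc_leI[OF assms])
  fix a b assume "a \<in> I" "b \<in> I"
  thus "x a + y a - (x b + y b) \<le> osc I x + osc I y"
    using osc_bounds[OF assms(1), of a b x] osc_bounds[OF assms(1), of a b y] by linarith
qed

lemma osc_le_sum_abs:
  assumes "finite I" "I \<noteq> {}"
  shows "osc I x \<le> 2 * (\<Sum>a\<in>I. \<bar>x a\<bar>)"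
proof (rule osc_leI[OF assms])
  fix a b assume "a \<in> I" "b \<in> I"
  hence "\<bar>x a\<bar> \<le> (\<Sum>a\<in>I. \<bar>x a\<bar>)" "\<bar>x b\<bar> \<le> (\<Sum>a\<in>I. \<bar>x a\<bar>)"
    using assms member_le_sum[of _ I "\<lambda>a. \<bar>x a\<bar>"] by auto
  thus "x a - x b \<le> 2 * (\<Sum>a\<in>I. \<bar>x a\<bar>)" by linarith
qed

text \<open>The index set is a separate argument, so that all blocks of a matrix share one entry
  function and differ only in the set summed over.\<close>

definition mat_apply :: "'a set \<Rightarrow> ('a \<Rightarrow> 'a \<Rightarrow> real) \<Rightarrow> ('a \<Rightarrow> real) \<Rightarrow> 'a \<Rightarrow> real" where
  "mat_apply I S x = (\<lambda>a. \<Sum>b\<in>I. S a b * x b)"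

definition unit_fun :: "'a \<Rightarrow> 'a \<Rightarrow> real" where
  "unit_fun b = (\<lambda>a. if a = b then 1 else 0)"

lemma mat_apply_cmult: "mat_apply I S (\<lambda>a. c * x a) = (\<lambda>a. c * mat_apply I S x a)"
  by (simp add: mat_apply_def sum_distrib_left algebra_simps)

lemma mat_apply_sum: "mat_apply I S (\<lambda>a. \<Sum>i\<in>J. x i a) = (\<lambda>a. \<Sum>i\<in>J. mat_apply I S (x i) a)"
  by (simp add: mat_apply_def sum_distrib_left sum.swap[of _ J I])

lemma mat_apply_cong: "(\<And>b. b \<in> I \<Longrightarrow> x b = y b) \<Longrightarrow> mat_apply I S x = mat_apply I S y"
  by (auto simp: mat_apply_def intro!: sum.cong)

lemma mat_apply_pow_sum:
  "(mat_apply I S ^^ n) (\<lambda>a. \<Sum>i\<in>J. c i * x i a) = (\<lambda>a. \<Sum>i\<in>J. c i * (mat_apply I S ^^ n) (x i) a)"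
  by (induction n) (simp_all add: mat_apply_sum mat_apply_cmult)

text \<open>The n-th iterate on \<open>unit_fun b\<close>, evaluated at \<open>a\<close>, plays the
  role of the entry (a, b) of the n-th matrix power.\<close>

lemma mat_apply_pow_unit:
  assumes "finite I" "a \<in> I"
  shows "(mat_apply I S ^^ n) x a = (\<Sum>b\<in>I. (mat_apply I S ^^ n) (unit_fun b) a * x b)"
proof -
  have x: "x b = (\<Sum>i\<in>I. x i * unit_fun i b)" if "b \<in> I" for b
  proof -
    have "(\<Sum>i\<in>I. x i * unit_fun i b) = (\<Sum>i\<in>I. if i = b then x i else 0)"
      by (intro sum.cong refl) (auto simp: unit_fun_def)
    thus ?thesis using assms(1) that by simp
  qed
  have eq: "\<forall>a\<in>I. (mat_apply I S ^^ n) x a = (mat_apply I S ^^ n) (\<lambda>b. \<Sum>i\<in>I. x i * unit_fun i b) a"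
  proof (induction n)
    case 0
    show ?case unfolding funpow_0 using x by blast
  next
    case (Suc n)
    have "mat_apply I S ((mat_apply I S ^^ n) x)
        = mat_apply I S ((mat_apply I S ^^ n) (\<lambda>b. \<Sum>i\<in>I. x i * unit_fun i b))"
      by (rule mat_apply_cong) (rule Suc[rule_format])
    then show ?case by simp
  qed
  thus ?thesis using assms(2) by (simp add: mat_apply_pow_sum mult.commute)
qed

locale primitive_stochastic =
  fixes I :: "'a set" and S :: "'a \<Rightarrow> 'a \<Rightarrow> real" and N :: nat
  assumes fin: "finite I" and ne: "I \<noteq> {}"
    and S_nonneg: "\<And>a b. a \<in> I \<Longrightarrow> b \<in> I \<Longrightarrow> 0 \<le> S a b"
    and S_rows: "\<And>a. a \<in> I \<Longrightarrow> (\<Sum>b\<in>I. S a b) = 1"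
    and N1: "N \<ge> 1"
    and S_pos: "\<And>a b. a \<in> I \<Longrightarrow> b \<in> I \<Longrightarrow> 0 < (mat_apply I S ^^ N) (unit_fun b) a"
begin

abbreviation "step \<equiv> mat_apply I S"

lemma step_mono:
  assumes "\<And>b. b \<in> I \<Longrightarrow> x b \<le> y b" "a \<in> I"
  shows "step x a \<le> step y a"
  unfolding mat_apply_def
proof (rule sum_mono)
  fix b assume "b \<in> I"
  thus "S a b * x b \<le> S a b * y b" using assms S_nonneg by (intro mult_left_mono) auto
qed

lemma step_const: "a \<in> I \<Longrightarrow> step (\<lambda>_. c) a = c"
  using S_rows by (simp add: mat_apply_def sum_distrib_right[symmetric])

lemma step_le_Max: "a \<in> I \<Longrightarrow> step x a \<le> Max (x ` I)"
  using step_mono[of x "\<lambda>_. Max (x ` I)" a] fin step_const by simp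

lemma Min_le_step: "a \<in> I \<Longrightarrow> Min (x ` I) \<le> step x a"
  using step_mono[of "\<lambda>_. Min (x ` I)" x a] fin step_const by simp

lemma osc_step: "osc I (step x) \<le> osc I x"
proof (rule osc_leI[OF fin ne])
  fix a b assume "a \<in> I" "b \<in> I"
  thus "step x a - step x b \<le> osc I x"
    using step_le_Max[of a x] Min_le_step[of b x] by (simp add: osc_def)
qed

lemma pow_const: "a \<in> I \<Longrightarrow> (step ^^ n) (\<lambda>_. c) a = c"
proof (induction n arbitrary: a)
  case (Suc n)
  have "step ((step ^^ n) (\<lambda>_. c)) a = step (\<lambda>_. c) a"
    using Suc.IH by (intro fun_cong[OF mat_apply_cong])
  then show ?case using step_const Suc.prems by simp
qed simp

lemma pow_mono: "(\<And>b. b \<in> I \<Longrightarrow> x b \<le> y b) \<Longrightarrow> a \<in> I \<Longrightarrow> (step ^^ n) x a \<le> (step ^^ n) y a"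
  by (induction n arbitrary: a) (auto intro: step_mono)

text \<open>Doeblin's argument: all entries of the \<open>N\<close>-th power are at least some
  \<open>\<epsilon> > 0\<close>, so every row gives weight at least \<open>\<epsilon>\<close> to a
  minimiser of \<open>x\<close>. This lowers the maximum by \<open>\<epsilon> * osc I x\<close>,
  while the minimum cannot drop.\<close>

lemma osc_contraction: "\<exists>q\<ge>0. q < 1 \<and> (\<forall>x. osc I ((step ^^ N) x) \<le> q * osc I x)"
proof -
  define W where "W a b = (step ^^ N) (unit_fun b) a" for a b
  define \<epsilon> where "\<epsilon> = Min ((\<lambda>(a, b). W a b) ` (I \<times> I))"
  have W: "\<epsilon> \<le> W a b" if "a \<in> I" "b \<in> I" for a b
    unfolding \<epsilon>_def using fin that by (intro Min_le) auto
  have "\<epsilon> \<in> (\<lambda>(a, b). W a b) ` (I \<times> I)"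
    unfolding \<epsilon>_def using fin ne by (intro Min_in) auto
  hence \<epsilon>: "0 < \<epsilon>" using S_pos by (auto simp: W_def)
  have W0: "0 \<le> W a b" if "a \<in> I" "b \<in> I" for a b using W[OF that] \<epsilon> by simp
  have rows: "(\<Sum>b\<in>I. W a b) = 1" if "a \<in> I" for a
    using mat_apply_pow_unit[OF fin that, of N S "\<lambda>_. 1"] pow_const[OF that] by (simp add: W_def)
  obtain a0 where a0: "a0 \<in> I" using ne by auto
  \<comment> \<open>An entry is at most its row sum 1, so the factor \<open>1 - \<epsilon>\<close>
    is not negative.\<close>
  have "\<epsilon> \<le> W a0 a0" using W a0 by simp
  also have "\<dots> \<le> (\<Sum>b\<in>I. W a0 b)"
    using fin a0 W0 by (intro member_le_sum) auto
  finally have \<epsilon>1: "\<epsilon> \<le> 1" using rows a0 by simp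
  have "osc I ((step ^^ N) x) \<le> (1 - \<epsilon>) * osc I x" for x
  proof (rule osc_leI[OF fin ne])
    fix a b assume ab: "a \<in> I" "b \<in> I"
    have "Min (x ` I) \<in> x ` I" using fin ne by (intro Min_in) auto
    then obtain m where m: "m \<in> I" "x m = Min (x ` I)" by (rule imageE) (rule that, simp_all)
    have lo: "Min (x ` I) \<le> (step ^^ N) x b"
    proof -
      have mn: "Min (x ` I) \<le> x c" if "c \<in> I" for c using fin that by (intro Min_le) auto
      have "(step ^^ N) (\<lambda>_. Min (x ` I)) b \<le> (step ^^ N) x b" by (rule pow_mono) (fact mn, fact ab(2))
      thus ?thesis by (simp only: pow_const[OF ab(2)])
    qed
    have "(step ^^ N) x a = (\<Sum>c\<in>I. W a c * x c)"
      unfolding W_def by (rule mat_apply_pow_unit[OF fin ab(1)])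
    also have "\<dots> = W a m * Min (x ` I) + (\<Sum>c\<in>I - {m}. W a c * x c)"
      unfolding m(2)[symmetric] using fin m(1) by (rule sum.remove)
    also have "(\<Sum>c\<in>I - {m}. W a c * x c) \<le> (\<Sum>c\<in>I - {m}. W a c * Max (x ` I))"
      using fin W0[OF ab(1)] by (intro sum_mono mult_left_mono) auto
    also have "\<dots> = (1 - W a m) * Max (x ` I)"
      using rows[OF ab(1)] sum.remove[OF fin m(1), of "W a"] by (simp add: sum_distrib_right[symmetric])
    also have "W a m * Min (x ` I) + (1 - W a m) * Max (x ` I) = Max (x ` I) - W a m * osc I x"
      by (simp only: osc_def algebra_simps)
    finally have "(step ^^ N) x a \<le> Max (x ` I) - W a m * osc I x" by simp
    moreover have "\<epsilon> * osc I x \<le> W a m * osc I x"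
      using W[OF ab(1) m(1)] osc_nonneg[OF fin ne] by (rule mult_right_mono)
    moreover have "(1 - \<epsilon>) * osc I x = Max (x ` I) - Min (x ` I) - \<epsilon> * osc I x"
      by (simp add: left_diff_distrib osc_def)
    ultimately show "(step ^^ N) x a - (step ^^ N) x b \<le> (1 - \<epsilon>) * osc I x"
      using lo by linarith
  qed
  thus ?thesis using \<epsilon> \<epsilon>1 by (intro exI[of _ "1 - \<epsilon>"]) auto
qed

text \<open>A step never increases the oscillation, so over a window of length \<open>N\<close> the
  forced and the free evolution differ by at most the accumulated source, while the free one
  contracts by \<open>q\<close>.\<close>

lemma forced_osc_tendsto_zero:
  assumes rec: "\<And>n a. a \<in> I \<Longrightarrow> y (Suc n) a = step (y n) a + z n a"
    and z: "\<And>a. a \<in> I \<Longrightarrow> (\<lambda>n. z n a / real (Suc n) ^ h) \<longlonglongrightarrow> 0"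
  shows "(\<lambda>n. osc I (y n) / real (Suc n) ^ h) \<longlonglongrightarrow> 0"
proof -
  obtain q where q: "0 \<le> q" "q < 1" "\<And>x. osc I ((step ^^ N) x) \<le> q * osc I x"
    using osc_contraction by blast
  define \<delta> where "\<delta> n = 2 * (\<Sum>a\<in>I. \<bar>z n a\<bar>)" for n
  have \<delta>0: "0 \<le> \<delta> n" for n by (simp add: \<delta>_def sum_nonneg)
  have window: "osc I (\<lambda>a. y (n + m) a - (step ^^ m) (y n) a) \<le> (\<Sum>i<m. \<delta> (n + i))" for n m
  proof (induction m)
    case 0
    then show ?case by (intro osc_leI[OF fin ne]) auto
  next
    case (Suc m)
    have "osc I (\<lambda>a. y (n + Suc m) a - (step ^^ Suc m) (y n) a)
        = osc I (\<lambda>a. step (\<lambda>a. y (n + m) a - (step ^^ m) (y n) a) a + z (n + m) a)"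
    proof (rule osc_cong)
      fix a assume "a \<in> I"
      thus "y (n + Suc m) a - (step ^^ Suc m) (y n) a
          = step (\<lambda>a. y (n + m) a - (step ^^ m) (y n) a) a + z (n + m) a"
        by (simp add: rec mat_apply_def right_diff_distrib sum_subtractf)
    qed
    also have "\<dots> \<le> osc I (step (\<lambda>a. y (n + m) a - (step ^^ m) (y n) a)) + osc I (z (n + m))"
      by (rule osc_add[OF fin ne])
    also have "osc I (z (n + m)) \<le> \<delta> (n + m)"
      unfolding \<delta>_def by (rule osc_le_sum_abs[OF fin ne])
    also have "osc I (step (\<lambda>a. y (n + m) a - (step ^^ m) (y n) a)) \<le> (\<Sum>i<m. \<delta> (n + i))"
      using osc_step Suc by (rule order_trans)
    finally show ?case by simp
  qed
  have rec': "osc I (y (n + N)) \<le> q * osc I (y n) + (\<Sum>i<N. \<delta> (n + i))" for n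
  proof -
    have "osc I (y (n + N)) = osc I (\<lambda>a. (step ^^ N) (y n) a + (y (n + N) a - (step ^^ N) (y n) a))"
      by simp
    also have "\<dots> \<le> osc I ((step ^^ N) (y n)) + osc I (\<lambda>a. y (n + N) a - (step ^^ N) (y n) a)"
      by (rule osc_add[OF fin ne])
    finally show ?thesis using q(3)[of "y n"] window[of n N] by linarith
  qed
  have \<delta>lim: "(\<lambda>n. \<delta> n / real (Suc n) ^ h) \<longlonglongrightarrow> 0"
  proof -
    have "(\<lambda>n. 2 * (\<Sum>a\<in>I. \<bar>z n a / real (Suc n) ^ h\<bar>)) \<longlonglongrightarrow> 2 * (\<Sum>a\<in>I. 0)"
      by (intro tendsto_mult_left tendsto_sum tendsto_rabs_zero z)
    moreover have "2 * (\<Sum>a\<in>I. \<bar>z n a / real (Suc n) ^ h\<bar>) = \<delta> n / real (Suc n) ^ h" for n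
      by (simp add: \<delta>_def sum_divide_distrib[symmetric] del: of_nat_Suc)
    ultimately show ?thesis by (simp only: sum.neutral_const mult_zero_right)
  qed
  have "(\<lambda>n. \<Sum>i<N. \<delta> (n + i) / real (Suc (n + i)) ^ h) \<longlonglongrightarrow> (\<Sum>i<N. 0)"
    by (intro tendsto_sum LIMSEQ_ignore_initial_segment[OF \<delta>lim])
  hence lim: "(\<lambda>n. \<Sum>i<N. \<delta> (n + i) / real (Suc (n + i)) ^ h) \<longlonglongrightarrow> 0" by simp
  have "osc I (y (n + N)) / real (Suc (n + N)) ^ h
      \<le> q * (osc I (y n) / real (Suc n) ^ h) + (\<Sum>i<N. \<delta> (n + i) / real (Suc (n + i)) ^ h)" for n
  proof -
    \<comment> \<open>A nonnegative term only grows when it is divided by the smaller power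
      belonging to its own time.\<close>
    have le: "x / real (Suc (n + N)) ^ h \<le> x / real (Suc (n + i)) ^ h" if "i \<le> N" "0 \<le> x" for i x
      using that by (intro divide_left_mono power_mono) auto
    have "osc I (y (n + N)) / real (Suc (n + N)) ^ h
        \<le> (q * osc I (y n) + (\<Sum>i<N. \<delta> (n + i))) / real (Suc (n + N)) ^ h"
      using rec'[of n] by (intro divide_right_mono) auto
    also have "\<dots> = q * osc I (y n) / real (Suc (n + N)) ^ h + (\<Sum>i<N. \<delta> (n + i) / real (Suc (n + N)) ^ h)"
      by (simp add: add_divide_distrib sum_divide_distrib)
    also have "\<dots> \<le> q * osc I (y n) / real (Suc n) ^ h + (\<Sum>i<N. \<delta> (n + i) / real (Suc (n + i)) ^ h)"
    proof (rule add_mono)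
      show "q * osc I (y n) / real (Suc (n + N)) ^ h \<le> q * osc I (y n) / real (Suc n) ^ h"
        using le[of 0 "q * osc I (y n)"] q(1) osc_nonneg[OF fin ne, of "y n"] by simp
      show "(\<Sum>i<N. \<delta> (n + i) / real (Suc (n + N)) ^ h) \<le> (\<Sum>i<N. \<delta> (n + i) / real (Suc (n + i)) ^ h)"
        by (rule sum_mono, rule le) (use \<delta>0 in auto)
    qed
    finally show ?thesis by simp
  qed
  hence ev: "\<forall>\<^sub>F n in sequentially. osc I (y (n + N)) / real (Suc (n + N)) ^ h
      \<le> q * (osc I (y n) / real (Suc n) ^ h) + (\<Sum>i<N. \<delta> (n + i) / real (Suc (n + i)) ^ h)"
    by (intro always_eventually allI)
  show ?thesis
    by (rule contracting_windows_tendsto_zero[OF N1 q(1,2) _ ev lim]) (simp add: osc_nonneg[OF fin ne])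
qed

text \<open>The rows of the matrix powers converge to a common limit, because minima over the states
  increase and oscillations tend to zero. This limit row is stationary, and it inherits a positive
  lower bound from the \<open>N\<close>-th power.\<close>

lemma stationary_exists:
  "\<exists>u. (\<forall>b\<in>I. 0 < u b) \<and> (\<Sum>b\<in>I. u b) = 1 \<and> (\<forall>b\<in>I. (\<Sum>a\<in>I. u a * S a b) = u b)"
proof -
  obtain a0 where a0: "a0 \<in> I" using ne by auto
  have osc0: "(\<lambda>n. osc I ((step ^^ n) x)) \<longlonglongrightarrow> 0" for x
    using forced_osc_tendsto_zero[of "\<lambda>n. (step ^^ n) x" "\<lambda>_ _. 0" 0] by simp
  have conv: "\<exists>L. \<forall>a\<in>I. (\<lambda>n. (step ^^ n) x a) \<longlonglongrightarrow> L" for x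
  proof -
    define m where "m n = Min ((step ^^ n) x ` I)" for n
    have m_le: "m n \<le> (step ^^ n) x a" if "a \<in> I" for n a
      using fin that by (auto simp: m_def)
    have "m n \<le> m (Suc n)" for n
      unfolding m_def[of "Suc n"] using fin ne Min_le_step[of _ "(step ^^ n) x"] by (auto simp: m_def)
    hence "incseq m" by (rule incseq_SucI)
    moreover have "m n \<le> Max (x ` I)" for n
    proof -
      have "m n \<le> (step ^^ n) x a0" using m_le a0 by blast
      also have "\<dots> \<le> (step ^^ n) (\<lambda>_. Max (x ` I)) a0" using fin a0 by (intro pow_mono) auto
      finally show ?thesis using pow_const[OF a0] by simp
    qed
    ultimately obtain L where L: "m \<longlonglongrightarrow> L"
      using incseq_convergent by blast
    have "(\<lambda>n. (step ^^ n) x a) \<longlonglongrightarrow> L" if a: "a \<in> I" for a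
    proof (rule tendsto_sandwich[OF _ _ L])
      show "\<forall>\<^sub>F n in sequentially. m n \<le> (step ^^ n) x a" using m_le a by simp
      have "(step ^^ n) x a \<le> m n + osc I ((step ^^ n) x)" for n
        using a fin by (simp add: m_def osc_def)
      thus "\<forall>\<^sub>F n in sequentially. (step ^^ n) x a \<le> m n + osc I ((step ^^ n) x)" by simp
      show "(\<lambda>n. m n + osc I ((step ^^ n) x)) \<longlonglongrightarrow> L"
        using tendsto_add[OF L osc0] by simp
    qed
    thus ?thesis by blast
  qed
  define u where "u b = lim (\<lambda>n. (step ^^ n) (unit_fun b) a0)" for b
  have u: "(\<lambda>n. (step ^^ n) (unit_fun b) a) \<longlonglongrightarrow> u b" if "a \<in> I" for a b
  proof -
    obtain L where L: "\<forall>a\<in>I. (\<lambda>n. (step ^^ n) (unit_fun b) a) \<longlonglongrightarrow> L" using conv by blast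
    hence "u b = L" unfolding u_def using a0 by (intro limI) blast
    thus ?thesis using L that by blast
  qed
  have lin: "(\<lambda>n. (step ^^ n) x a0) \<longlonglongrightarrow> (\<Sum>b\<in>I. u b * x b)" for x
    unfolding mat_apply_pow_unit[OF fin a0, of _ S x] by (intro tendsto_intros u a0)
  have "(\<Sum>b\<in>I. u b) = 1"
    using LIMSEQ_unique[OF lin[of "\<lambda>_. 1"]] pow_const[OF a0, of _ 1] by simp
  moreover have "(\<Sum>a\<in>I. u a * S a b) = u b" if b: "b \<in> I" for b
  proof -
    \<comment> \<open>Column \<open>b\<close> of \<open>S\<close>. The shifted sequence tends to
      \<open>u b\<close> by definition of \<open>u\<close>, and by \<open>lin\<close> to the average
      of this column under \<open>u\<close>.\<close>
    have "step (unit_fun b) = (\<lambda>a. S a b)"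
      using fin b by (simp add: mat_apply_def unit_fun_def if_distrib cong: if_cong)
    hence "(\<lambda>n. (step ^^ Suc n) (unit_fun b) a0) \<longlonglongrightarrow> (\<Sum>a\<in>I. u a * S a b)"
      using lin[of "step (unit_fun b)"] by (simp only: funpow_Suc_right o_apply)
    thus ?thesis using LIMSEQ_unique LIMSEQ_Suc[OF u[OF a0]] by blast
  qed
  moreover have "0 < u b" if b: "b \<in> I" for b
  proof -
    define \<epsilon> where "\<epsilon> = Min ((step ^^ N) (unit_fun b) ` I)"
    have "\<epsilon> \<in> (step ^^ N) (unit_fun b) ` I" unfolding \<epsilon>_def using fin ne by (intro Min_in) auto
    hence \<epsilon>: "0 < \<epsilon>" using S_pos b by auto
    have "\<epsilon> \<le> (step ^^ (n + N)) (unit_fun b) a0" for n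
    proof -
      have "\<epsilon> = (step ^^ n) (\<lambda>_. \<epsilon>) a0" using pow_const[OF a0] by simp
      also have "\<dots> \<le> (step ^^ n) ((step ^^ N) (unit_fun b)) a0"
        using fin a0 by (intro pow_mono) (auto simp: \<epsilon>_def)
      finally show ?thesis by (simp add: funpow_add)
    qed
    hence "\<epsilon> \<le> u b"
      by (intro LIMSEQ_le_const[OF LIMSEQ_ignore_initial_segment[OF u[OF a0], of N]]) auto
    thus ?thesis using \<epsilon> by simp
  qed
  ultimately show ?thesis by blast
qed

text \<open>The iterates of a fixed function form a constant sequence, so its oscillation equals its
  limit zero.\<close>

lemma fixed_point_const:
  assumes "\<And>a. a \<in> I \<Longrightarrow> step g a = g a" "a \<in> I" "b \<in> I"
  shows "g a = g b"
proof -
  have "(\<lambda>n. osc I g / real (Suc n) ^ 0) \<longlonglongrightarrow> 0"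
    by (rule forced_osc_tendsto_zero[where z = "\<lambda>_ _. 0"]) (use assms in auto)
  hence "osc I g = 0" using LIMSEQ_unique tendsto_const by fastforce
  thus ?thesis using osc_bounds[OF fin assms(2,3), of g] osc_bounds[OF fin assms(3,2), of g] by simp
qed

text \<open>Averaging with the stationary weights removes \<open>S\<close>: the average
  \<open>s\<close> just sums the averaged source, which raises the order by one. The deviation of
  \<open>y n a\<close> from \<open>s n\<close> is at most the oscillation, which is o(n^h).\<close>

lemma stationary_growth:
  assumes u: "(\<Sum>b\<in>I. u b) = 1" "\<And>b. b \<in> I \<Longrightarrow> (\<Sum>a\<in>I. u a * S a b) = u b"
    and rec: "\<And>n a. a \<in> I \<Longrightarrow> y (Suc n) a = step (y n) a + z n a" and y0: "\<And>a. a \<in> I \<Longrightarrow> y 0 a = 0"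
    and z: "\<And>a. a \<in> I \<Longrightarrow> growth h (\<lambda>n. z n a) (c a)" and a: "a \<in> I"
    and u0: "\<And>b. b \<in> I \<Longrightarrow> 0 \<le> u b"
  shows "growth (Suc h) (\<lambda>n. y n a) (\<Sum>b\<in>I. u b * c b)"
proof (rule growth_SucI)
  define s where "s n = (\<Sum>b\<in>I. u b * y n b)" for n
  have s: "s n = (\<Sum>m<n. \<Sum>b\<in>I. u b * z m b)" for n
  proof (induction n)
    case 0
    then show ?case using y0 by (simp add: s_def)
  next
    case (Suc n)
    have "s (Suc n) = (\<Sum>b\<in>I. u b * step (y n) b) + (\<Sum>b\<in>I. u b * z n b)"
      using rec by (simp add: s_def distrib_left sum.distrib)
    also have "(\<Sum>b\<in>I. u b * step (y n) b) = (\<Sum>b\<in>I. \<Sum>e\<in>I. u b * S b e * y n e)"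
      by (simp add: mat_apply_def sum_distrib_left mult.assoc)
    also have "\<dots> = (\<Sum>e\<in>I. (\<Sum>b\<in>I. u b * S b e) * y n e)"
      by (subst sum.swap) (simp add: sum_distrib_right)
    also have "\<dots> = s n" using u(2) by (simp add: s_def)
    finally show ?case using Suc by simp
  qed
  have slim: "(\<lambda>n. s n / real (Suc n) ^ h) \<longlonglongrightarrow> (\<Sum>b\<in>I. u b * c b) / fact h"
    using growth_sum[of I h "\<lambda>b n. u b * z n b", OF growth_cmult[OF z]] by (simp add: s growth_def)
  \<comment> \<open>This is the pointwise half of \<open>growth\<close> at order
    \<open>Suc h\<close> with coefficient zero.\<close>
  have "(\<lambda>n. z n a / real (Suc n) ^ h) \<longlonglongrightarrow> 0" if "a \<in> I" for a
    using growth_Suc_zero[OF z[OF that]] by (simp add: growth_def)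
  hence osc0: "(\<lambda>n. osc I (y n) / real (Suc n) ^ h) \<longlonglongrightarrow> 0"
    using rec by (intro forced_osc_tendsto_zero) auto
  have dev: "\<bar>y n a - s n\<bar> \<le> osc I (y n)" for n
  proof -
    have "y n a - s n = (\<Sum>b\<in>I. u b * (y n a - y n b))"
      using u(1) by (simp add: s_def right_diff_distrib sum_subtractf sum_distrib_right[symmetric])
    also have "\<bar>\<dots>\<bar> \<le> (\<Sum>b\<in>I. \<bar>u b * (y n a - y n b)\<bar>)" by (rule sum_abs)
    also have "\<dots> \<le> (\<Sum>b\<in>I. u b * osc I (y n))"
    proof (rule sum_mono)
      fix b assume b: "b \<in> I"
      have "\<bar>y n a - y n b\<bar> \<le> osc I (y n)"
        using osc_bounds[OF fin a b, of "y n"] osc_bounds[OF fin b a, of "y n"] by linarith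
      thus "\<bar>u b * (y n a - y n b)\<bar> \<le> u b * osc I (y n)"
        using u0[OF b] by (simp add: abs_mult mult_left_mono)
    qed
    also have "\<dots> = osc I (y n)" using u(1) by (simp add: sum_distrib_right[symmetric])
    finally show ?thesis .
  qed
  have "norm ((y n a - s n) / real (Suc n) ^ h) \<le> norm (osc I (y n) / real (Suc n) ^ h) * 1" for n
    using dev[of n] osc_nonneg[OF fin ne, of "y n"] by (simp add: divide_right_mono)
  hence "(\<lambda>n. (y n a - s n) / real (Suc n) ^ h) \<longlonglongrightarrow> 0"
    by (intro tendsto_0_le[OF osc0, where K = 1] always_eventually allI)
  from tendsto_add[OF this slim] show "(\<lambda>n. y n a / real (Suc n) ^ h) \<longlonglongrightarrow> (\<Sum>b\<in>I. u b * c b) / fact h"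
    by (simp add: diff_divide_distrib)
qed

end

section \<open>Perron-Frobenius eigenvectors\<close>

locale primitive_eigenvector =
  fixes I :: "'a set" and A :: "'a \<Rightarrow> 'a \<Rightarrow> real" and v :: "'a \<Rightarrow> real" and r :: real and N :: nat
  assumes fin: "finite I" and ne: "I \<noteq> {}"
    and A_nonneg: "\<And>a b. a \<in> I \<Longrightarrow> b \<in> I \<Longrightarrow> 0 \<le> A a b"
    and v_pos: "\<And>a. a \<in> I \<Longrightarrow> 0 < v a"
    and eig: "\<And>a. a \<in> I \<Longrightarrow> mat_apply I A v a = r * v a"
    and N1: "N \<ge> 1"
    and A_pos: "\<And>a b. a \<in> I \<Longrightarrow> b \<in> I \<Longrightarrow> 0 < (mat_apply I A ^^ N) (unit_fun b) a"
begin

lemma pow_eig: "a \<in> I \<Longrightarrow> (mat_apply I A ^^ n) v a = r ^ n * v a"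
proof (induction n arbitrary: a)
  case (Suc n)
  have "mat_apply I A ((mat_apply I A ^^ n) v) = mat_apply I A (\<lambda>a. r ^ n * v a)"
    using Suc.IH by (rule mat_apply_cong)
  hence "(mat_apply I A ^^ Suc n) v a = mat_apply I A (\<lambda>a. r ^ n * v a) a" by simp
  also have "\<dots> = r ^ Suc n * v a" using eig[OF Suc.prems] by (simp add: mat_apply_cmult)
  finally show ?case .
qed simp

lemma r_pos: "0 < r"
proof -
  obtain a where a: "a \<in> I" using ne by auto
  have "0 \<le> mat_apply I A v a"
    using A_nonneg v_pos a by (simp add: mat_apply_def sum_nonneg less_imp_le)
  hence "0 \<le> r" using eig[OF a] v_pos[OF a] by (simp add: zero_le_mult_iff)
  have "0 < (\<Sum>b\<in>I. (mat_apply I A ^^ N) (unit_fun b) a * v b)"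
    using A_pos v_pos a fin ne by (intro sum_pos) auto
  hence "0 < r ^ N * v a" using mat_apply_pow_unit[OF fin a, of N A v] pow_eig[OF a] by simp
  hence "r \<noteq> 0" using N1 by (cases "r = 0") (simp_all add: power_0_left)
  thus ?thesis using \<open>0 \<le> r\<close> by simp
qed

text \<open>The Doob transform of \<open>A\<close>: conjugation by the diagonal matrix of
  \<open>v\<close>, divided by \<open>r\<close>. Its rows sum to one because \<open>v\<close> is an
  eigenvector.\<close>

definition stoch :: "'a \<Rightarrow> 'a \<Rightarrow> real" where
  "stoch a b = A a b * v b / (r * v a)"

lemma stoch_apply:
  "a \<in> I \<Longrightarrow> mat_apply I stoch x a = mat_apply I A (\<lambda>b. v b * x b) a / (r * v a)"
  by (simp add: mat_apply_def stoch_def sum_divide_distrib mult.assoc)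

lemma stoch_pow:
  "a \<in> I \<Longrightarrow> (mat_apply I stoch ^^ n) x a = (mat_apply I A ^^ n) (\<lambda>b. v b * x b) a / (r ^ n * v a)"
proof (induction n arbitrary: a)
  case 0
  then show ?case using v_pos[of a] by simp
next
  case (Suc n)
  have eq: "mat_apply I A (\<lambda>b. v b * (mat_apply I stoch ^^ n) x b)
      = mat_apply I A (\<lambda>b. inverse (r ^ n) * (mat_apply I A ^^ n) (\<lambda>b. v b * x b) b)"
  proof (rule mat_apply_cong)
    fix b assume b: "b \<in> I"
    show "v b * (mat_apply I stoch ^^ n) x b = inverse (r ^ n) * (mat_apply I A ^^ n) (\<lambda>b. v b * x b) b"
      using v_pos[OF b] by (simp add: Suc.IH[OF b] field_simps)
  qed
  have "(mat_apply I stoch ^^ Suc n) x a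
      = inverse (r ^ n) * (mat_apply I A ^^ Suc n) (\<lambda>b. v b * x b) a / (r * v a)"
    using stoch_apply[OF Suc.prems] by (simp only: funpow.simps o_apply eq mat_apply_cmult)
  then show ?case by (simp add: divide_inverse)
qed

sublocale primitive_stochastic I stoch N
proof
  show "0 \<le> stoch a b" if "a \<in> I" "b \<in> I" for a b
    using A_nonneg[OF that] v_pos that r_pos by (simp add: stoch_def less_imp_le)
  show "(\<Sum>b\<in>I. stoch a b) = 1" if "a \<in> I" for a
    using stoch_apply[OF that, of "\<lambda>_. 1"] eig[OF that] v_pos[OF that] r_pos by (simp add: mat_apply_def)
  show "0 < (mat_apply I stoch ^^ N) (unit_fun b) a" if "a \<in> I" "b \<in> I" for a b
  proof -
    \<comment> \<open>The singleton sum presents \<open>v b\<close> as a coefficient that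
      \<open>mat_apply_pow_sum\<close> can pull out of the iterates.\<close>
    have "(\<lambda>e. v e * unit_fun b e) = (\<lambda>e. \<Sum>i\<in>{()}. v b * unit_fun b e)"
      by (auto simp: unit_fun_def)
    thus ?thesis using A_pos[OF that] that v_pos r_pos
      unfolding stoch_pow[OF that(1)] by (simp only: mat_apply_pow_sum) simp
  qed
qed (use fin ne N1 in auto)

text \<open>Undoing the Doob transform: stationary weights divided by \<open>v\<close>. Their total
  mass becomes the pairing with \<open>v\<close>, whence the normalisation.\<close>

lemma left_eigenvector_exists:
  obtains u where "\<And>b. b \<in> I \<Longrightarrow> 0 < u b" "(\<Sum>b\<in>I. u b * v b) = 1"
    "\<And>b. b \<in> I \<Longrightarrow> (\<Sum>a\<in>I. u a * A a b) = r * u b"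
proof -
  obtain u where u: "\<And>b. b \<in> I \<Longrightarrow> 0 < u b" "(\<Sum>b\<in>I. u b) = 1"
      "\<And>b. b \<in> I \<Longrightarrow> (\<Sum>a\<in>I. u a * stoch a b) = u b"
    using stationary_exists by blast
  show ?thesis
  proof (rule that[of "\<lambda>b. u b / v b"])
    show "0 < u b / v b" if "b \<in> I" for b using u(1) v_pos that by simp
    have "(\<Sum>b\<in>I. u b / v b * v b) = (\<Sum>b\<in>I. u b)"
      using v_pos by (intro sum.cong) (auto simp: less_imp_neq[symmetric])
    thus "(\<Sum>b\<in>I. u b / v b * v b) = 1" using u(2) by simp
    show "(\<Sum>a\<in>I. u a / v a * A a b) = r * (u b / v b)" if b: "b \<in> I" for b
    proof -
      have "(\<Sum>a\<in>I. u a / v a * A a b) = (\<Sum>a\<in>I. u a * stoch a b) * (r / v b)"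
        unfolding sum_distrib_right
        using r_pos v_pos[OF b] by (intro sum.cong) (auto simp: stoch_def field_simps)
      thus ?thesis using u(3)[OF b] by simp
    qed
  qed
qed

text \<open>The quotient of \<open>g\<close> by \<open>v\<close> is fixed by the stochastic matrix,
  hence constant, so \<open>g\<close> is a multiple of \<open>v\<close> and the pairing with
  \<open>u\<close> determines the multiple. This is the geometric simplicity of
  \<open>r\<close>.\<close>

lemma eigenvector_zero:
  assumes u: "(\<Sum>b\<in>I. u b * v b) = 1" and g: "\<And>a. a \<in> I \<Longrightarrow> mat_apply I A g a = r * g a"
    and ug: "(\<Sum>b\<in>I. u b * g b) = 0" and a: "a \<in> I"
  shows "g a = 0"
proof -
  have fixed: "mat_apply I stoch (\<lambda>b. g b / v b) a = g a / v a" if "a \<in> I" for a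
  proof -
    have "mat_apply I A (\<lambda>b. v b * (g b / v b)) = mat_apply I A g"
      using v_pos by (intro mat_apply_cong) (auto simp: less_imp_neq[symmetric])
    thus ?thesis using g[OF that] r_pos by (simp add: stoch_apply[OF that])
  qed
  have gb: "g b = g a / v a * v b" if "b \<in> I" for b
    using fixed_point_const[of "\<lambda>b. g b / v b" a b, OF fixed a that] v_pos[OF that] by (simp add: field_simps)
  have "0 = (\<Sum>b\<in>I. u b * (g a / v a * v b))" using ug gb by simp
  also have "\<dots> = g a / v a * (\<Sum>b\<in>I. u b * v b)" by (simp add: sum_distrib_left algebra_simps)
  finally show ?thesis using u v_pos[OF a] by simp
qed

text \<open>Division by \<open>r ^ n * v a\<close> yields the stochastic recursion with stationary
  weights \<open>u b * v b\<close>. The factor 1 / r arises because the source at time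
  \<open>n\<close> enters at time \<open>Suc n\<close>.\<close>

lemma eigenvector_growth:
  assumes u: "\<And>b. b \<in> I \<Longrightarrow> 0 < u b" "(\<Sum>b\<in>I. u b * v b) = 1"
    "\<And>b. b \<in> I \<Longrightarrow> (\<Sum>a\<in>I. u a * A a b) = r * u b"
    and rec: "\<And>n a. a \<in> I \<Longrightarrow> y (Suc n) a = mat_apply I A (y n) a + z n a"
    and y0: "\<And>a. a \<in> I \<Longrightarrow> y 0 a = 0"
    and z: "\<And>a. a \<in> I \<Longrightarrow> growth h (\<lambda>n. z n a / r ^ n) (c a)" and a: "a \<in> I"
  shows "growth (Suc h) (\<lambda>n. y n a / r ^ n) ((\<Sum>b\<in>I. u b * c b) / r * v a)"
proof -
  have "growth (Suc h) (\<lambda>n. y n a / (r ^ n * v a)) (\<Sum>b\<in>I. (u b * v b) * (1 / (r * v b) * c b))"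
  proof (rule stationary_growth[where z = "\<lambda>n a. 1 / (r * v a) * (z n a / r ^ n)"])
    show "(\<Sum>a\<in>I. u a * v a * stoch a b) = u b * v b" if b: "b \<in> I" for b
    proof -
      have "(\<Sum>a\<in>I. u a * v a * stoch a b) = (\<Sum>a\<in>I. u a * A a b) * (v b / r)"
        unfolding sum_distrib_right
        using r_pos v_pos by (intro sum.cong) (auto simp: stoch_def field_simps less_imp_neq[symmetric])
      thus ?thesis using u(3)[OF b] r_pos by simp
    qed
    show "y (Suc n) a / (r ^ Suc n * v a) = mat_apply I stoch (\<lambda>a. y n a / (r ^ n * v a)) a
        + 1 / (r * v a) * (z n a / r ^ n)" if a: "a \<in> I" for n a
    proof -
      have eq: "mat_apply I A (\<lambda>b. v b * (y n b / (r ^ n * v b))) = mat_apply I A (\<lambda>b. inverse (r ^ n) * y n b)"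
      proof (rule mat_apply_cong)
        fix b assume "b \<in> I"
        thus "v b * (y n b / (r ^ n * v b)) = inverse (r ^ n) * y n b" using v_pos[of b] by (simp add: field_simps)
      qed
      have "mat_apply I stoch (\<lambda>a. y n a / (r ^ n * v a)) a = inverse (r ^ n) * mat_apply I A (y n) a / (r * v a)"
        using stoch_apply[OF a] by (simp only: eq mat_apply_cmult)
      thus ?thesis using rec[OF a] by (simp add: divide_inverse algebra_simps)
    qed
    show "growth h (\<lambda>n. 1 / (r * v a) * (z n a / r ^ n)) (1 / (r * v a) * c a)" if "a \<in> I" for a
      by (rule growth_cmult[OF z[OF that]])
  qed (use u y0 a v_pos in \<open>auto intro!: mult_nonneg_nonneg less_imp_le\<close>)
  from growth_cmult[OF this, of "v a"]
  have g: "growth (Suc h) (\<lambda>n. v a * (y n a / (r ^ n * v a))) (v a * (\<Sum>b\<in>I. (u b * v b) * (1 / (r * v b) * c b)))" .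
  have "(\<lambda>n. v a * (y n a / (r ^ n * v a))) = (\<lambda>n. y n a / r ^ n)"
    using v_pos[OF a] by (auto simp: field_simps)
  moreover have "(\<Sum>b\<in>I. (u b * v b) * (1 / (r * v b) * c b)) = (\<Sum>b\<in>I. u b * c b) / r"
    unfolding sum_divide_distrib using v_pos
    by (intro sum.cong) (auto simp: field_simps less_imp_neq[symmetric])
  ultimately show ?thesis using g by (simp add: mult.commute)
qed

end

section \<open>Decomposition along descending block paths\<close>

text \<open>Index \<open>Suc n\<close> belongs to time \<open>n\<close>: all path sums vanish at
  index 0, so every recursion starts from zero. The source \<open>s\<close> may depend on the whole
  path; the last summand is the inflow from the path without its first block.\<close>

fun path_sum :: "(nat \<Rightarrow> 'a set) \<Rightarrow> ('a \<Rightarrow> 'a \<Rightarrow> real) \<Rightarrow> (nat list \<Rightarrow> nat \<Rightarrow> 'a \<Rightarrow> real)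
    \<Rightarrow> nat list \<Rightarrow> nat \<Rightarrow> 'a \<Rightarrow> real" where
  "path_sum B q s [] n a = 0"
| "path_sum B q s (i # t) 0 a = 0"
| "path_sum B q s (i # t) (Suc n) a = mat_apply (B i) q (\<lambda>b. path_sum B q s (i # t) n b) a + s (i # t) n a
     + (if t = [] then 0 else mat_apply (B (hd t)) q (\<lambda>b. path_sum B q s t n b) a)"

lemma path_sum_0 [simp]: "path_sum B q s \<theta> 0 a = 0"
  by (cases \<theta>) auto

text \<open>Whether consecutive blocks are coupled is ignored here; uncoupled sequences later turn
  out to contribute zero, which keeps the decomposition independent of admissibility.\<close>

definition desc_paths :: "nat \<Rightarrow> nat list set" where
  "desc_paths i = {\<theta>. \<theta> \<noteq> [] \<and> hd \<theta> = i \<and> sorted_wrt (>) \<theta> \<and> set \<theta> \<subseteq> {1..}}"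

lemma sorted_wrt_greater_distinct: "sorted_wrt (>) (xs :: nat list) \<Longrightarrow> distinct xs"
  by (induction xs) auto

lemma finite_desc_paths: "finite (desc_paths i)"
proof (rule finite_subset)
  show "desc_paths i \<subseteq> {xs. set xs \<subseteq> {1..i} \<and> length xs \<le> i}"
  proof
    fix \<theta> assume "\<theta> \<in> desc_paths i"
    then obtain t where t: "\<theta> = i # t" "sorted_wrt (>) \<theta>" "set \<theta> \<subseteq> {1..}"
      by (cases \<theta>) (auto simp: desc_paths_def)
    have s: "set \<theta> \<subseteq> {1..i}" using t by (auto simp: less_imp_le dest: subsetD)
    have "length \<theta> = card (set \<theta>)" using sorted_wrt_greater_distinct[OF t(2)] by (simp add: distinct_card)
    also have "\<dots> \<le> card {1..i}" using s by (intro card_mono) auto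
    finally show "\<theta> \<in> {xs. set xs \<subseteq> {1..i} \<and> length xs \<le> i}" using s by simp
  qed
qed (use finite_lists_length_le[of "{1..i}"] in simp)

lemma desc_paths_eq:
  assumes "i \<ge> 1"
  shows "desc_paths i = (#) i ` ({[]} \<union> (\<Union>j\<in>{1..<i}. desc_paths j))"
proof (intro equalityI subsetI)
  fix \<theta> assume "\<theta> \<in> desc_paths i"
  then obtain t where t: "\<theta> = i # t" "sorted_wrt (>) (i # t)" "set (i # t) \<subseteq> {1..}"
    by (cases \<theta>) (auto simp: desc_paths_def)
  show "\<theta> \<in> (#) i ` ({[]} \<union> (\<Union>j\<in>{1..<i}. desc_paths j))"
    using t by (cases t) (auto simp: desc_paths_def)
next
  fix \<theta> assume "\<theta> \<in> (#) i ` ({[]} \<union> (\<Union>j\<in>{1..<i}. desc_paths j))"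
  then obtain t where t: "\<theta> = i # t" "t = [] \<or> (\<exists>j\<in>{1..<i}. t \<in> desc_paths j)" by auto
  show "\<theta> \<in> desc_paths i"
    using t assms by (cases t) (auto simp: desc_paths_def)
qed

text \<open>Removing the first block is a bijection onto the empty list together with the paths from
  smaller blocks.\<close>

lemma sum_desc_paths:
  fixes g :: "nat list \<Rightarrow> real"
  assumes "i \<ge> 1"
  shows "(\<Sum>\<theta>\<in>desc_paths i. g (tl \<theta>)) = g [] + (\<Sum>j\<in>{1..<i}. \<Sum>t\<in>desc_paths j. g t)"
proof -
  have "(\<Sum>\<theta>\<in>desc_paths i. g (tl \<theta>)) = (\<Sum>t\<in>{[]} \<union> (\<Union>j\<in>{1..<i}. desc_paths j). g t)"
    unfolding desc_paths_eq[OF assms] by (subst sum.reindex) (auto simp: inj_on_def)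
  also have "\<dots> = g [] + (\<Sum>t\<in>(\<Union>j\<in>{1..<i}. desc_paths j). g t)"
    by (subst sum.union_disjoint) (auto simp: finite_desc_paths, auto simp: desc_paths_def)
  also have "(\<Sum>t\<in>(\<Union>j\<in>{1..<i}. desc_paths j). g t) = (\<Sum>j\<in>{1..<i}. \<Sum>t\<in>desc_paths j. g t)"
    by (rule sum.UNION_disjoint) (auto simp: finite_desc_paths, auto simp: desc_paths_def)
  finally show ?thesis .
qed

text \<open>Grouping the paths of the chain by the blocks they visit: the solution of the linear
  recursion driven by \<open>q\<close> splits into its contributions along descending block sequences.\<close>

lemma path_sum_decomposition:
  fixes B :: "nat \<Rightarrow> 'a set"
  assumes fin: "\<And>i. i \<in> {1..k} \<Longrightarrow> finite (B i)"
    and disj: "\<And>i j. i \<in> {1..k} \<Longrightarrow> j \<in> {1..k} \<Longrightarrow> i \<noteq> j \<Longrightarrow> B i \<inter> B j = {}"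
    and tri: "\<And>i j a b. i \<in> {1..k} \<Longrightarrow> j \<in> {1..k} \<Longrightarrow> i < j \<Longrightarrow> a \<in> B i \<Longrightarrow> b \<in> B j \<Longrightarrow> q a b = 0"
    and X0: "\<And>i a. i \<in> {1..k} \<Longrightarrow> a \<in> B i \<Longrightarrow> X 0 a = (\<Sum>\<theta>\<in>desc_paths i. s \<theta> 0 a)"
    and XS: "\<And>n i a. i \<in> {1..k} \<Longrightarrow> a \<in> B i \<Longrightarrow>
      X (Suc n) a = mat_apply (\<Union>j\<in>{1..k}. B j) q (X n) a + (\<Sum>\<theta>\<in>desc_paths i. s \<theta> (Suc n) a)"
    and i: "i \<in> {1..k}" and a: "a \<in> B i"
  shows "X n a = (\<Sum>\<theta>\<in>desc_paths i. path_sum B q s \<theta> (Suc n) a)"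
  using i a
proof (induction n arbitrary: i a)
  case 0
  have "path_sum B q s \<theta> (Suc 0) a = s \<theta> 0 a" if "\<theta> \<in> desc_paths i" for \<theta>
    using that by (cases \<theta>) (auto simp: desc_paths_def mat_apply_def)
  then show ?case using X0[OF 0] by simp
next
  case (Suc n)
  let ?Y = "\<lambda>\<theta>. path_sum B q s \<theta> (Suc n)"
  \<comment> \<open>The inflow along a path depends on its tail \<open>t\<close> only, so summing it
    over the paths from \<open>i\<close> is a case of \<open>sum_desc_paths\<close>.\<close>
  define g where "g t = (if t = [] then 0 else mat_apply (B (hd t)) q (?Y t) a)" for t
  have i1: "i \<ge> 1" using Suc.prems by simp
  have Y: "path_sum B q s \<theta> (Suc (Suc n)) a = mat_apply (B i) q (?Y \<theta>) a + s \<theta> (Suc n) a + g (tl \<theta>)"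
    if "\<theta> \<in> desc_paths i" for \<theta>
    using that by (cases \<theta>) (auto simp: desc_paths_def g_def simp del: path_sum.simps(3)
        simp: path_sum.simps(3)[of B q s _ _ "Suc n"])
  have block: "mat_apply (B j) q (X n) a = (\<Sum>\<theta>\<in>desc_paths j. mat_apply (B j) q (?Y \<theta>) a)"
    if "j \<in> {1..k}" for j
  proof -
    have "mat_apply (B j) q (X n) a = mat_apply (B j) q (\<lambda>b. \<Sum>\<theta>\<in>desc_paths j. ?Y \<theta> b) a"
      using Suc.IH[OF that] by (intro fun_cong[OF mat_apply_cong])
    thus ?thesis by (simp add: mat_apply_sum)
  qed
  have "mat_apply (\<Union>j\<in>{1..k}. B j) q (X n) a = (\<Sum>j\<in>{1..k}. mat_apply (B j) q (X n) a)"
    unfolding mat_apply_def using fin disj by (intro sum.UNION_disjoint) auto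
  also have "\<dots> = (\<Sum>j\<in>{1..<i} \<union> {i}. mat_apply (B j) q (X n) a)"
  proof (rule sum.mono_neutral_right)
    show "\<forall>j\<in>{1..k} - ({1..<i} \<union> {i}). mat_apply (B j) q (X n) a = 0"
      using tri[OF Suc.prems(1) _ _ Suc.prems(2)] by (auto simp: mat_apply_def intro!: sum.neutral)
  qed (use Suc.prems in auto)
  also have "\<dots> = (\<Sum>j\<in>{1..<i}. mat_apply (B j) q (X n) a) + mat_apply (B i) q (X n) a"
    by (subst sum.union_disjoint) auto
  also have "(\<Sum>j\<in>{1..<i}. mat_apply (B j) q (X n) a) = (\<Sum>j\<in>{1..<i}. \<Sum>t\<in>desc_paths j. g t)"
    using Suc.prems block by (intro sum.cong) (auto simp: g_def desc_paths_def intro!: sum.cong)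
  also have "\<dots> = (\<Sum>\<theta>\<in>desc_paths i. g (tl \<theta>))"
    using sum_desc_paths[OF i1, of g] by (simp add: g_def)
  finally show ?case
    using XS[OF Suc.prems] block[OF Suc.prems(1)] by (simp only: Y sum.distrib cong: sum.cong)
qed

section \<open>Generalised eigenspaces\<close>

text \<open>Passing from matrix powers to iterated application lets inductions peel off one factor
  at a time.\<close>

lemma pow_mat_mult_vec:
  assumes "B \<in> carrier_mat n n" "w \<in> carrier_vec n"
  shows "(B ^\<^sub>m m) *\<^sub>v w = ((*\<^sub>v) B ^^ m) w"
  using assms(2)
proof (induction m arbitrary: w)
  case (Suc m)
  have "(B ^\<^sub>m Suc m) *\<^sub>v w = (B ^\<^sub>m m) *\<^sub>v (B *\<^sub>v w)"
    using assms(1) Suc.prems by (simp add: assoc_mult_mat_vec[of _ n n _ n])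
  also have "\<dots> = ((*\<^sub>v) B ^^ m) (B *\<^sub>v w)"
    using assms(1) Suc by (intro Suc.IH) auto
  finally show ?case by (simp only: funpow_Suc_right o_apply)
qed (use assms in simp)

lemma pow_mat_vec_carrier:
  "B \<in> carrier_mat n n \<Longrightarrow> w \<in> carrier_vec n \<Longrightarrow> ((*\<^sub>v) B ^^ m) w \<in> carrier_vec n"
  by (induction m) auto

lemma gen_eigenspace_iff:
  assumes "A \<in> carrier_mat n n"
  shows "w \<in> gen_eigenspace A \<mu> \<longleftrightarrow> w \<in> carrier_vec n \<and>
    (\<exists>m. ((*\<^sub>v) (A - \<mu> \<cdot>\<^sub>m 1\<^sub>m n) ^^ m) w = 0\<^sub>v n)"
proof -
  have B: "A - \<mu> \<cdot>\<^sub>m 1\<^sub>m n \<in> carrier_mat n n" using assms by auto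
  show ?thesis using assms pow_mat_mult_vec[OF B] by (auto simp: gen_eigenspace_def)
qed

lemma shifted_mult_vec:
  fixes A :: "'a :: comm_ring_1 mat"
  assumes "A \<in> carrier_mat n n" "w \<in> carrier_vec n"
  shows "(A - \<mu> \<cdot>\<^sub>m 1\<^sub>m n) *\<^sub>v w = A *\<^sub>v w - \<mu> \<cdot>\<^sub>v w"
proof -
  have "(\<mu> \<cdot>\<^sub>m 1\<^sub>m n) *\<^sub>v w = \<mu> \<cdot>\<^sub>v w"
    using assms(2) by (intro eq_vecI) (auto simp: scalar_prod_def if_distrib[of "\<lambda>x. _ * x"] if_distrib[of "\<lambda>x. x * _"] cong: if_cong)
  thus ?thesis using assms by (simp add: minus_mult_distrib_mat_vec[of _ n n])
qed

text \<open>Peeling off one factor at a time: a property preserved by \<open>A - \<mu>\<close> that excludes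
  eigenvectors for \<open>\<mu>\<close> excludes generalised eigenvectors.\<close>

lemma gen_eigenspace_eq_zeroI:
  fixes A :: "complex mat"
  assumes A: "A \<in> carrier_mat n n" and w: "w \<in> gen_eigenspace A \<mu>" and P: "P w"
    and step: "\<And>x. x \<in> carrier_vec n \<Longrightarrow> P x \<Longrightarrow> P (A *\<^sub>v x - \<mu> \<cdot>\<^sub>v x)"
    and zero: "\<And>x. x \<in> carrier_vec n \<Longrightarrow> P x \<Longrightarrow> A *\<^sub>v x = \<mu> \<cdot>\<^sub>v x \<Longrightarrow> x = 0\<^sub>v n"
  shows "w = 0\<^sub>v n"
proof -
  obtain m where m: "((*\<^sub>v) (A - \<mu> \<cdot>\<^sub>m 1\<^sub>m n) ^^ m) w = 0\<^sub>v n" "w \<in> carrier_vec n"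
    using w gen_eigenspace_iff[OF A] by auto
  thus ?thesis using P
  proof (induction m arbitrary: w)
    case (Suc m)
    define x where "x = A *\<^sub>v w - \<mu> \<cdot>\<^sub>v w"
    have x: "x = (A - \<mu> \<cdot>\<^sub>m 1\<^sub>m n) *\<^sub>v w" using shifted_mult_vec[OF A Suc.prems(2)] by (simp add: x_def)
    have Aw: "A *\<^sub>v w \<in> carrier_vec n" using A Suc.prems(2) by auto
    have "x = 0\<^sub>v n"
    proof (rule Suc.IH)
      show "((*\<^sub>v) (A - \<mu> \<cdot>\<^sub>m 1\<^sub>m n) ^^ m) x = 0\<^sub>v n"
        using Suc.prems(1) by (simp add: x funpow_swap1)
      show "x \<in> carrier_vec n" using Aw Suc.prems(2) by (simp add: x_def)
      show "P x" unfolding x_def using Suc.prems by (intro step)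
    qed
    hence "A *\<^sub>v w = \<mu> \<cdot>\<^sub>v w"
      using Aw Suc.prems(2) unfolding x_def
      using A by (intro eq_vecI) (auto simp: vec_eq_iff)
    thus ?case using Suc.prems by (intro zero)
  qed simp
qed

lemma gen_eigenspace_add:
  fixes A :: "complex mat"
  assumes A: "A \<in> carrier_mat n n" and xy: "x \<in> gen_eigenspace A \<mu>" "y \<in> gen_eigenspace A \<mu>"
  shows "x + y \<in> gen_eigenspace A \<mu>"
proof -
  let ?B = "A - \<mu> \<cdot>\<^sub>m 1\<^sub>m n"
  have B: "?B \<in> carrier_mat n n" using A by auto
  obtain m k where c: "x \<in> carrier_vec n" "y \<in> carrier_vec n"
    and m: "((*\<^sub>v) ?B ^^ m) x = 0\<^sub>v n" and k: "((*\<^sub>v) ?B ^^ k) y = 0\<^sub>v n"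
    using xy gen_eigenspace_iff[OF A] by auto
  have lin: "((*\<^sub>v) ?B ^^ j) (x + y) = ((*\<^sub>v) ?B ^^ j) x + ((*\<^sub>v) ?B ^^ j) y" for j
    by (induction j) (use B c in \<open>auto simp: mult_add_distrib_mat_vec[OF B] pow_mat_vec_carrier[OF B]\<close>)
  have z: "((*\<^sub>v) ?B ^^ j) (0\<^sub>v n) = 0\<^sub>v n" for j
    by (induction j) (use B in auto)
  have "((*\<^sub>v) ?B ^^ (k + m)) x = 0\<^sub>v n" by (simp add: funpow_add m z)
  moreover have "((*\<^sub>v) ?B ^^ (k + m)) y = 0\<^sub>v n" by (subst add.commute) (simp add: funpow_add k z)
  ultimately have "((*\<^sub>v) ?B ^^ (k + m)) (x + y) = 0\<^sub>v n" by (simp add: lin)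
  thus ?thesis using c gen_eigenspace_iff[OF A] by auto
qed

lemma gen_eigenspace_smult:
  fixes A :: "complex mat"
  assumes A: "A \<in> carrier_mat n n" and x: "x \<in> gen_eigenspace A \<mu>"
  shows "c \<cdot>\<^sub>v x \<in> gen_eigenspace A \<mu>"
proof -
  let ?B = "A - \<mu> \<cdot>\<^sub>m 1\<^sub>m n"
  have B: "?B \<in> carrier_mat n n" using A by auto
  obtain m where c: "x \<in> carrier_vec n" and m: "((*\<^sub>v) ?B ^^ m) x = 0\<^sub>v n"
    using x gen_eigenspace_iff[OF A] by auto
  have "((*\<^sub>v) ?B ^^ j) (c \<cdot>\<^sub>v x) = c \<cdot>\<^sub>v ((*\<^sub>v) ?B ^^ j) x" for j
    by (induction j) (use B c in \<open>auto simp: mult_mat_vec[OF B] pow_mat_vec_carrier[OF B]\<close>)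
  from this[of m] have "((*\<^sub>v) ?B ^^ m) (c \<cdot>\<^sub>v x) = 0\<^sub>v n" by (auto simp: m)
  thus ?thesis using c gen_eigenspace_iff[OF A] by auto
qed

lemma zero_in_gen_eigenspace: "A \<in> carrier_mat n n \<Longrightarrow> 0\<^sub>v n \<in> gen_eigenspace A \<mu>"
  by (subst gen_eigenspace_iff, assumption, auto intro: exI[of _ 0])

lemma gen_eigenspace_sum:
  fixes A :: "complex mat"
  assumes A: "A \<in> carrier_mat n n" and "finite X"
    and p: "\<And>j. j \<in> X \<Longrightarrow> p j \<in> gen_eigenspace A \<mu>"
  shows "vec n (\<lambda>a. \<Sum>j\<in>X. c j * p j $ a) \<in> gen_eigenspace A \<mu>"
  using assms(2) p
proof (induction X rule: finite_induct)
  case empty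
  have "vec n (\<lambda>a. \<Sum>j\<in>{}. c j * p j $ a) = 0\<^sub>v n" by auto
  then show ?case using zero_in_gen_eigenspace[OF A] by (simp only:)
next
  case (insert j X)
  have "p j \<in> carrier_vec n" using insert.prems gen_eigenspace_iff[OF A] by auto
  hence "vec n (\<lambda>a. \<Sum>j\<in>insert j X. c j * p j $ a) = c j \<cdot>\<^sub>v p j + vec n (\<lambda>a. \<Sum>j\<in>X. c j * p j $ a)"
    using insert.hyps by (intro eq_vecI) auto
  then show ?case using insert by (auto intro!: gen_eigenspace_add[OF A] gen_eigenspace_smult[OF A])
qed

text \<open>It allows the columns of a Jordan basis to be handled in order without tracking block
  boundaries.\<close>

lemma jordan_matrix_offdiag:
  assumes "i < sum_list (map fst n_as)" "j < sum_list (map fst n_as)" "i \<noteq> j"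
    "jordan_matrix n_as $$ (i, j) \<noteq> 0"
  shows "Suc i = j \<and> jordan_matrix n_as $$ (i, i) = jordan_matrix n_as $$ (j, j)"
  using assms
proof (induction n_as arbitrary: i j)
  case (Cons na n_as)
  obtain n a where na: "na = (n, a)" by (cases na)
  show ?case
  proof (cases "i < n \<or> j < n")
    case True
    then show ?thesis using Cons.prems by (auto simp: na jordan_matrix_Cons jordan_block_def split: if_splits)
  next
    case False
    then obtain i' j' where ij: "i = n + i'" "j = n + j'" using le_Suc_ex not_less by metis
    show ?thesis using Cons.IH[of i' j'] Cons.prems by (auto simp: na jordan_matrix_Cons ij)
  qed
qed simp

text \<open>The columns of \<open>P\<close> form a Jordan basis: \<open>A - \<mu>\<close> maps each
  column to a multiple of the previous one, and a nonzero multiple occurs only inside a block, where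
  \<mu> is the same. The coordinates of \<open>w\<close> are grouped by diagonal entry.\<close>

lemma gen_eigenspace_decomposition:
  fixes A :: "complex mat"
  assumes A: "A \<in> carrier_mat n n" and w: "w \<in> carrier_vec n"
  obtains f where "\<And>\<mu>. f \<mu> \<in> gen_eigenspace A \<mu>" "\<And>a. a < n \<Longrightarrow> w $ a = (\<Sum>\<mu>\<in>spectrum A. f \<mu> $ a)"
proof -
  obtain as where "char_poly A = (\<Prod>a\<leftarrow>as. [:- a, 1:])" using char_poly_factorized[OF A] by blast
  from jordan_nf_exists[OF A this] obtain n_as where "jordan_nf A n_as" by blast
  then obtain P P' where wit: "similar_mat_wit A (jordan_matrix n_as) P P'"
    by (auto simp: jordan_nf_def similar_mat_def)
  define J where "J = jordan_matrix n_as"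
  note wit' = similar_mat_witD2[OF A wit[folded J_def]]
  note PP = wit'(1,2) and car = wit'(5,6,7)
  have n: "sum_list (map fst n_as) = n" using carrier_matD(1)[OF car(1)] by (simp add: J_def)
  have J0: "J $$ (i, j) = 0" if "i < n" "j < n" "i \<noteq> j" "Suc i \<noteq> j" for i j
    using jordan_matrix_offdiag[of i n_as j] that by (auto simp: n J_def)
  have "A * P = P * J * (P' * P)" unfolding wit'(3) using car by (intro assoc_mult_mat) auto
  hence AP: "A * P = P * J" unfolding PP(2) using car by simp
  have colA: "A *\<^sub>v col P j = vec n (\<lambda>a. \<Sum>i<n. P $$ (a, i) * J $$ (i, j))" if "j < n" for j
  proof -
    have "A *\<^sub>v col P j = col (A * P) j"
      using A car that by (intro eq_vecI) auto
    thus ?thesis unfolding AP using car that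
      by (intro eq_vecI) (auto simp: scalar_prod_def atLeast0LessThan)
  qed
  have gen: "col P j \<in> gen_eigenspace A (J $$ (j, j))" if "j < n" for j
    using that
  proof (induction j)
    case 0
    have "(\<Sum>i<n. P $$ (a, i) * J $$ (i, 0)) = J $$ (0, 0) * P $$ (a, 0)" for a
    proof -
      have "(\<Sum>i<n. P $$ (a, i) * J $$ (i, 0)) = (\<Sum>i\<in>{0}. P $$ (a, i) * J $$ (i, 0))"
        using 0 by (intro sum.mono_neutral_right) (auto simp: J0)
      thus ?thesis by simp
    qed
    hence "(A - J $$ (0, 0) \<cdot>\<^sub>m 1\<^sub>m n) *\<^sub>v col P 0 = 0\<^sub>v n"
      using car A 0 by (subst shifted_mult_vec[OF A]) (auto simp: colA intro!: eq_vecI)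
    then show ?case using car 0 by (subst gen_eigenspace_iff[OF A]) (auto intro!: exI[of _ 1])
  next
    case (Suc j)
    let ?\<mu> = "J $$ (Suc j, Suc j)" and ?c = "J $$ (j, Suc j)"
    have "(\<Sum>i<n. P $$ (a, i) * J $$ (i, Suc j)) = ?\<mu> * P $$ (a, Suc j) + ?c * P $$ (a, j)" for a
    proof -
      have "(\<Sum>i<n. P $$ (a, i) * J $$ (i, Suc j)) = (\<Sum>i\<in>{j, Suc j}. P $$ (a, i) * J $$ (i, Suc j))"
        using Suc.prems by (intro sum.mono_neutral_right) (auto simp: J0)
      thus ?thesis by simp
    qed
    hence eq: "(A - ?\<mu> \<cdot>\<^sub>m 1\<^sub>m n) *\<^sub>v col P (Suc j) = ?c \<cdot>\<^sub>v col P j"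
      using car A Suc.prems by (subst shifted_mult_vec[OF A]) (auto simp: colA intro!: eq_vecI)
    have "?c \<cdot>\<^sub>v col P j \<in> gen_eigenspace A ?\<mu>"
    proof (cases "?c = 0")
      case True
      have "0 \<cdot>\<^sub>v col P j = 0\<^sub>v n" using car Suc.prems by auto
      then show ?thesis using True zero_in_gen_eigenspace[OF A] by simp
    next
      case False
      hence "J $$ (j, j) = ?\<mu>" using jordan_matrix_offdiag[of j n_as "Suc j"] Suc.prems by (simp add: n J_def)
      then show ?thesis using gen_eigenspace_smult[OF A Suc.IH] Suc.prems by simp
    qed
    then obtain m where "((*\<^sub>v) (A - ?\<mu> \<cdot>\<^sub>m 1\<^sub>m n) ^^ m) ((A - ?\<mu> \<cdot>\<^sub>m 1\<^sub>m n) *\<^sub>v col P (Suc j)) = 0\<^sub>v n"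
      unfolding eq gen_eigenspace_iff[OF A] by blast
    hence "((*\<^sub>v) (A - ?\<mu> \<cdot>\<^sub>m 1\<^sub>m n) ^^ Suc m) (col P (Suc j)) = 0\<^sub>v n" by (simp add: funpow_swap1)
    moreover have "col P (Suc j) \<in> carrier_vec n" using car Suc.prems by auto
    ultimately show ?case unfolding gen_eigenspace_iff[OF A] by blast
  qed
  define c where "c = P' *\<^sub>v w"
  have cdim: "dim_vec c = n" using car by (simp add: c_def)
  define f where "f \<mu> = vec n (\<lambda>a. \<Sum>j\<in>{j. j < n \<and> J $$ (j, j) = \<mu>}. c $ j * col P j $ a)" for \<mu>
  have f: "f \<mu> \<in> gen_eigenspace A \<mu>" for \<mu>
    unfolding f_def using gen by (intro gen_eigenspace_sum[OF A]) auto
  have f0: "f \<mu> $ a = 0" if "\<mu> \<notin> spectrum A" "a < n" for \<mu> a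
  proof -
    have "f \<mu> = 0\<^sub>v n"
    proof (rule gen_eigenspace_eq_zeroI[OF A f, where P = "\<lambda>_. True"])
      fix x assume "x \<in> carrier_vec n" "A *\<^sub>v x = \<mu> \<cdot>\<^sub>v x"
      thus "x = 0\<^sub>v n" using that(1) A by (auto simp: spectrum_def eigenvalue_def eigenvector_def)
    qed auto
    thus ?thesis using that by simp
  qed
  show ?thesis
  proof (rule that[of f, OF f])
    fix a assume a: "a < n"
    define D where "D = (\<lambda>j. J $$ (j, j)) ` {..<n}"
    have "(P * P') *\<^sub>v w = P *\<^sub>v c" unfolding c_def using car w by (intro assoc_mult_mat_vec)
    hence "w = P *\<^sub>v c" using PP(1) w by simp
    hence "w $ a = (\<Sum>j<n. P $$ (a, j) * c $ j)"
      using a car w index_mult_mat_vec[of a P c] by (simp add: scalar_prod_def atLeast0LessThan c_def[symmetric] cdim)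
    also have "\<dots> = (\<Sum>\<mu>\<in>D. \<Sum>j\<in>{j\<in>{..<n}. J $$ (j, j) = \<mu>}. P $$ (a, j) * c $ j)"
      unfolding D_def by (rule sum.image_gen) simp
    also have "\<dots> = (\<Sum>\<mu>\<in>D. f \<mu> $ a)"
      using a car by (intro sum.cong) (auto simp: f_def intro!: sum.cong)
    \<comment> \<open>The diagonal need not be identified with the spectrum: \<open>f\<close>
      vanishes off \<open>D\<close> as an empty sum, and off the spectrum by
      \<open>f0\<close>.\<close>
    also have "\<dots> = (\<Sum>\<mu>\<in>D \<union> spectrum A. f \<mu> $ a)"
      using a card_finite_spectrum(1)[OF A]
      by (intro sum.mono_neutral_left) (auto simp: D_def f_def intro!: sum.neutral)
    also have "\<dots> = (\<Sum>\<mu>\<in>spectrum A. f \<mu> $ a)"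
      using a card_finite_spectrum(1)[OF A] f0 by (intro sum.mono_neutral_right) (auto simp: D_def)
    finally show "w $ a = (\<Sum>\<mu>\<in>spectrum A. f \<mu> $ a)" .
  qed
qed

text \<open>The reason is that \<open>Vminus\<close> is the kernel of pairing with the left
  eigenvector \<open>u\<close>. Applying \<open>A - \<mu>\<close> multiplies the pairing by r -
  \<mu>, so it vanishes on generalised eigenspaces for \<mu> different from r. Conversely, if the
  pairing with \<open>w\<close> is zero, so is the pairing with the component of \<open>w\<close>
  for r, and simplicity makes that component zero.\<close>

lemma Vminus_coefficient:
  fixes Q :: "real mat" and ds :: "nat \<Rightarrow> nat" and i :: nat and u :: "nat \<Rightarrow> real"
  defines "n \<equiv> ds i" and "A \<equiv> blk Q ds i i" and "r \<equiv> rho Q ds i"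
  assumes left: "\<And>b. b < n \<Longrightarrow> (\<Sum>a<n. u a * A $$ (a, b)) = r * u b"
    and v: "v \<in> carrier_vec n" "A *\<^sub>v v = r \<cdot>\<^sub>v v" and uv: "(\<Sum>a<n. u a * v $ a) = 1"
    and simple: "\<And>g a. (\<And>a. a < n \<Longrightarrow> (\<Sum>b<n. A $$ (a, b) * g b) = r * g a) \<Longrightarrow>
        (\<Sum>a<n. u a * g a) = 0 \<Longrightarrow> a < n \<Longrightarrow> g a = 0"
    and x: "x \<in> carrier_vec n"
  shows "(THE \<alpha>. \<exists>w\<in>Vminus Q ds i. x = \<alpha> \<cdot>\<^sub>v v + w) = (\<Sum>a<n. u a * x $ a)"
proof -
  define C where "C = cmat A"
  define L where "L y = (\<Sum>a<n. of_real (u a) * y $ a)" for y :: "complex vec"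
  have A: "A \<in> carrier_mat n n" by (simp add: A_def n_def blk_def)
  have C: "C \<in> carrier_mat n n" using A by (simp add: C_def cmat_def)
  have Cind: "C $$ (a, b) = of_real (A $$ (a, b))" if "a < n" "b < n" for a b
    using A that by (simp add: C_def cmat_def)
  have Cy: "(C *\<^sub>v y) $ a = (\<Sum>b<n. of_real (A $$ (a, b)) * y $ b)" if "y \<in> carrier_vec n" "a < n" for y a
    using C that by (simp add: scalar_prod_def Cind atLeast0LessThan)
  have LC: "L (C *\<^sub>v y) = of_real r * L y" if y: "y \<in> carrier_vec n" for y
  proof -
    have "L (C *\<^sub>v y) = (\<Sum>b<n. \<Sum>a<n. of_real (u a * A $$ (a, b)) * y $ b)"
      unfolding L_def using y by (subst sum.swap) (simp add: Cy sum_distrib_left mult.assoc)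
    also have "\<dots> = (\<Sum>b<n. of_real (\<Sum>a<n. u a * A $$ (a, b)) * y $ b)"
      by (simp add: sum_distrib_right)
    also have "\<dots> = of_real r * L y" by (simp add: left L_def sum_distrib_left mult.assoc)
    finally show ?thesis .
  qed
  have Lstep: "L (C *\<^sub>v y - \<mu> \<cdot>\<^sub>v y) = (of_real r - \<mu>) * L y" if y: "y \<in> carrier_vec n" for y \<mu>
  proof -
    have "L (C *\<^sub>v y - \<mu> \<cdot>\<^sub>v y) = L (C *\<^sub>v y) - \<mu> * L y"
      using C y by (simp add: L_def right_diff_distrib sum_subtractf sum_distrib_left algebra_simps del: index_mult_mat_vec)
    thus ?thesis by (simp add: LC[OF y] algebra_simps)
  qed
  have Lgen: "L y = 0" if y: "y \<in> gen_eigenspace C \<mu>" and "\<mu> \<noteq> of_real r" for y \<mu>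
  proof -
    obtain m where m: "((*\<^sub>v) (C - \<mu> \<cdot>\<^sub>m 1\<^sub>m n) ^^ m) y = 0\<^sub>v n" "y \<in> carrier_vec n"
      using y unfolding gen_eigenspace_iff[OF C] by blast
    thus ?thesis
    proof (induction m arbitrary: y)
      case 0
      then show ?case by (simp add: L_def)
    next
      case (Suc m)
      have eq: "(C - \<mu> \<cdot>\<^sub>m 1\<^sub>m n) *\<^sub>v y = C *\<^sub>v y - \<mu> \<cdot>\<^sub>v y" using shifted_mult_vec[OF C Suc.prems(2)] .
      have "L ((C - \<mu> \<cdot>\<^sub>m 1\<^sub>m n) *\<^sub>v y) = 0"
        using Suc.prems C by (intro Suc.IH mult_mat_vec_carrier) (auto simp: funpow_swap1)
      thus ?case unfolding eq using Lstep[OF Suc.prems(2)] \<open>\<mu> \<noteq> of_real r\<close> by auto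
    qed
  qed
  have Lzero: "y = 0\<^sub>v n" if "y \<in> gen_eigenspace C (of_real r)" "L y = 0" for y
  proof (rule gen_eigenspace_eq_zeroI[OF C that(1), where P = "\<lambda>y. L y = 0"])
    show "L (C *\<^sub>v y - of_real r \<cdot>\<^sub>v y) = 0" if "y \<in> carrier_vec n" for y
      using Lstep[OF that] by simp
    fix y assume y: "y \<in> carrier_vec n" "L y = 0" "C *\<^sub>v y = of_real r \<cdot>\<^sub>v y"
    have e: "(\<Sum>b<n. of_real (A $$ (a, b)) * y $ b) = of_real r * y $ a" if "a < n" for a
      using Cy[OF y(1) that] y that by simp
    \<comment> \<open>Simplicity is a statement about real functions, and \<open>A\<close>,
      \<open>r\<close> and \<open>u\<close> are real, so it is applied to real and imaginary parts
      separately.\<close>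
    have "Re (y $ a) = 0" if "a < n" for a
    proof (rule simple[OF _ _ that])
      show "(\<Sum>b<n. A $$ (a, b) * Re (y $ b)) = r * Re (y $ a)" if "a < n" for a
        using arg_cong[OF e[OF that], of Re] by simp
      show "(\<Sum>a<n. u a * Re (y $ a)) = 0" using arg_cong[OF y(2), of Re] by (simp add: L_def)
    qed
    moreover have "Im (y $ a) = 0" if "a < n" for a
    proof (rule simple[OF _ _ that])
      show "(\<Sum>b<n. A $$ (a, b) * Im (y $ b)) = r * Im (y $ a)" if "a < n" for a
        using arg_cong[OF e[OF that], of Im] by simp
      show "(\<Sum>a<n. u a * Im (y $ a)) = 0" using arg_cong[OF y(2), of Im] by (simp add: L_def)
    qed
    ultimately show "y = 0\<^sub>v n" using y(1) by (intro eq_vecI) (auto simp: complex_eq_iff)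
  qed (use that in auto)
  have fin: "finite (spectrum C)" using card_finite_spectrum(1)[OF C] .
  have V: "w \<in> Vminus Q ds i \<longleftrightarrow> w \<in> carrier_vec n \<and> (\<exists>f. (\<forall>\<mu>\<in>spectrum C - {of_real r}. f \<mu> \<in> gen_eigenspace C \<mu>) \<and>
        (\<forall>a<n. complex_of_real (w $ a) = (\<Sum>\<mu>\<in>spectrum C - {of_real r}. f \<mu> $ a)))" for w
    by (simp add: Vminus_def Let_def C_def A_def r_def n_def)
  have ker: "w \<in> Vminus Q ds i \<longleftrightarrow> w \<in> carrier_vec n \<and> (\<Sum>a<n. u a * w $ a) = 0" for w
  proof (intro iffI conjI; (elim conjE)?)
    assume w: "w \<in> Vminus Q ds i"
    then show "w \<in> carrier_vec n" using V by blast
    obtain f where f: "\<And>\<mu>. \<mu> \<in> spectrum C - {of_real r} \<Longrightarrow> f \<mu> \<in> gen_eigenspace C \<mu>"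
      "\<And>a. a < n \<Longrightarrow> complex_of_real (w $ a) = (\<Sum>\<mu>\<in>spectrum C - {of_real r}. f \<mu> $ a)"
      using w V by blast
    have "complex_of_real (\<Sum>a<n. u a * w $ a) = (\<Sum>a<n. \<Sum>\<mu>\<in>spectrum C - {of_real r}. of_real (u a) * f \<mu> $ a)"
      by (simp add: f(2) sum_distrib_left)
    also have "\<dots> = (\<Sum>\<mu>\<in>spectrum C - {of_real r}. L (f \<mu>))"
      unfolding L_def by (rule sum.swap)
    also have "\<dots> = 0" using f(1) Lgen by (intro sum.neutral) blast
    finally show "(\<Sum>a<n. u a * w $ a) = 0" using of_real_eq_0_iff by blast
  next
    assume w: "w \<in> carrier_vec n" "(\<Sum>a<n. u a * w $ a) = 0"
    define W where "W = map_vec complex_of_real w"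
    have W: "W \<in> carrier_vec n" using w by (simp add: W_def)
    obtain f where f: "\<And>\<mu>. f \<mu> \<in> gen_eigenspace C \<mu>"
      "\<And>a. a < n \<Longrightarrow> W $ a = (\<Sum>\<mu>\<in>spectrum C. f \<mu> $ a)"
      using gen_eigenspace_decomposition[OF C W] by blast
    have "f (of_real r) $ a = 0" if "a < n" "of_real r \<in> spectrum C" for a
    proof -
      have "0 = L W" using w by (simp add: L_def W_def of_real_mult[symmetric] of_real_sum[symmetric] del: of_real_mult of_real_sum)
      also have "\<dots> = (\<Sum>\<mu>\<in>spectrum C. L (f \<mu>))"
        unfolding L_def by (subst sum.swap) (simp add: f(2) sum_distrib_left)
      also have "\<dots> = L (f (of_real r)) + (\<Sum>\<mu>\<in>spectrum C - {of_real r}. L (f \<mu>))"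
        using fin that by (rule_tac sum.remove)
      also have "(\<Sum>\<mu>\<in>spectrum C - {of_real r}. L (f \<mu>)) = 0"
        using f(1) Lgen by (intro sum.neutral) blast
      finally have "f (of_real r) = 0\<^sub>v n" using Lzero[OF f(1)] by simp
      thus ?thesis using that by simp
    qed
    \<comment> \<open>Whether r lies in the spectrum is left open: if it does not, its removal
      changes nothing.\<close>
    hence "complex_of_real (w $ a) = (\<Sum>\<mu>\<in>spectrum C - {of_real r}. f \<mu> $ a)" if "a < n" for a
      using f(2)[OF that] that w(1) sum.remove[OF fin, of "of_real r" "\<lambda>\<mu>. f \<mu> $ a"]
      by (cases "complex_of_real r \<in> spectrum C") (auto simp: W_def)
    thus "w \<in> Vminus Q ds i" unfolding V using w(1) f(1) by blast
  qed
  show ?thesis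
  proof (rule the_equality)
    define w where "w = x - (\<Sum>a<n. u a * x $ a) \<cdot>\<^sub>v v"
    have "(\<Sum>a<n. u a * w $ a) = (\<Sum>a<n. u a * x $ a) - (\<Sum>a<n. u a * x $ a) * (\<Sum>a<n. u a * v $ a)"
      unfolding sum_distrib_left[of "\<Sum>a<n. u a * x $ a"] sum_subtractf[symmetric]
      using v x by (intro sum.cong) (auto simp: w_def algebra_simps)
    hence "w \<in> Vminus Q ds i" using uv v x by (simp add: ker w_def)
    moreover have "x = (\<Sum>a<n. u a * x $ a) \<cdot>\<^sub>v v + w" using v x by (intro eq_vecI) (auto simp: w_def)
    ultimately show "\<exists>w\<in>Vminus Q ds i. x = (\<Sum>a<n. u a * x $ a) \<cdot>\<^sub>v v + w" by blast
  next
    fix \<alpha> assume "\<exists>w\<in>Vminus Q ds i. x = \<alpha> \<cdot>\<^sub>v v + w"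
    then obtain w where w: "w \<in> carrier_vec n" "(\<Sum>a<n. u a * w $ a) = 0" "x = \<alpha> \<cdot>\<^sub>v v + w"
      using ker by blast
    have "(\<Sum>a<n. u a * x $ a) = \<alpha> * (\<Sum>a<n. u a * v $ a) + (\<Sum>a<n. u a * w $ a)"
      unfolding w(3) sum_distrib_left[of \<alpha>] sum.distrib[symmetric]
      using v w(1) by (intro sum.cong) (auto simp: algebra_simps)
    thus "\<alpha> = (\<Sum>a<n. u a * x $ a)" using uv w(2) by simp
  qed
qed

section \<open>Occupation times of the absorbed chain\<close>

definition survival :: "nat \<Rightarrow> real mat \<Rightarrow> nat \<Rightarrow> nat \<Rightarrow> real" where
  "survival d Q n = (mat_apply {..<d} (\<lambda>a b. Q $$ (a, b)) ^^ n) (\<lambda>_. 1)"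

text \<open>Solves to the sum over m up to n of Q^m D Q^(n-m) 1, the expected number of visits to
  \<open>B\<close> during times 0 to n on the event of survival up to time n. The second summand is
  the visit at time 0.\<close>

fun occupation :: "nat \<Rightarrow> real mat \<Rightarrow> nat set \<Rightarrow> nat \<Rightarrow> nat \<Rightarrow> real" where
  "occupation d Q B 0 a = of_bool (a \<in> B)"
| "occupation d Q B (Suc n) a = mat_apply {..<d} (\<lambda>a b. Q $$ (a, b)) (\<lambda>b. occupation d Q B n b) a
     + of_bool (a \<in> B) * survival d Q (Suc n) a"

text \<open>The initial factor of \<open>path_prob\<close> is left out so that a state can be
  prepended.\<close>

definition trajectory_weight :: "real mat \<Rightarrow> real vec \<Rightarrow> nat list \<Rightarrow> real" where
  "trajectory_weight Q R xs = (\<Prod>m<length xs - 1. Ptrans Q R (xs ! m) (xs ! Suc m))"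

definition alive :: "nat \<Rightarrow> nat \<Rightarrow> nat list set" where
  "alive d n = {xs. length xs = Suc n \<and> set xs \<subseteq> {1..d}}"

lemma alive_eq: "{xs \<in> state_paths d n. T_gt n xs} = alive d n"
proof (intro equalityI subsetI)
  fix xs assume "xs \<in> {xs \<in> state_paths d n. T_gt n xs}"
  hence xs: "length xs = Suc n" "set xs \<subseteq> {0..d}" "\<And>m. m \<le> n \<Longrightarrow> xs ! m \<noteq> 0"
    by (auto simp: state_paths_def T_gt_def)
  have "x \<in> {1..d}" if x: "x \<in> set xs" for x
  proof -
    obtain m where "m \<le> n" "x = xs ! m" using x xs(1) by (auto simp: in_set_conv_nth less_Suc_eq_le)
    hence "x \<noteq> 0" using xs(3) by blast
    moreover have "x \<le> d" using x xs(2) by auto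
    ultimately show ?thesis by simp
  qed
  thus "xs \<in> alive d n" using xs(1) by (auto simp: alive_def)
next
  fix xs assume xs: "xs \<in> alive d n"
  have "xs ! m \<noteq> 0" if "m \<le> n" for m
  proof -
    have "xs ! m \<in> set xs" using xs that by (intro nth_mem) (simp add: alive_def)
    thus ?thesis using xs by (auto simp: alive_def)
  qed
  moreover have "set xs \<subseteq> {0..d}" using xs by (auto simp: alive_def)
  ultimately show "xs \<in> {xs \<in> state_paths d n. T_gt n xs}"
    using xs by (simp add: alive_def state_paths_def T_gt_def)
qed

lemma sum_alive_0: "(\<Sum>xs\<in>alive d 0. f xs) = (\<Sum>a\<in>{1..d}. f [a])"
proof -
  have "alive d 0 = (\<lambda>a. [a]) ` {1..d}" by (auto simp: alive_def length_Suc_conv)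
  thus ?thesis by (simp add: sum.reindex inj_on_def)
qed

lemma sum_alive_Suc: "(\<Sum>xs\<in>alive d (Suc n). f xs) = (\<Sum>a\<in>{1..d}. \<Sum>xs\<in>alive d n. f (a # xs))"
proof -
  have "alive d (Suc n) = (\<lambda>(a, xs). a # xs) ` ({1..d} \<times> alive d n)"
    by (auto simp: alive_def length_Suc_conv image_iff)
  thus ?thesis by (simp add: sum.reindex inj_on_def sum.cartesian_product case_prod_unfold)
qed

lemma trajectory_weight_Cons:
  "xs \<in> alive d n \<Longrightarrow> trajectory_weight Q R (a # xs) = Ptrans Q R a (hd xs) * trajectory_weight Q R xs"
  by (cases xs) (auto simp: alive_def trajectory_weight_def prod.lessThan_Suc_shift simp del: prod.lessThan_Suc)

lemma sum_shift_states:
  assumes "a \<in> {1..d}"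
  shows "(\<Sum>b\<in>{1..d}. Ptrans Q R a b * x (b - 1)) = mat_apply {..<d} (\<lambda>a b. Q $$ (a, b)) x (a - 1)"
proof -
  have "(\<Sum>b\<in>{1..d}. Ptrans Q R a b * x (b - 1)) = (\<Sum>b<d. Ptrans Q R a (Suc b) * x b)"
    by (rule sum.reindex_bij_witness[of _ Suc "\<lambda>b. b - 1"]) auto
  thus ?thesis using assms by (simp add: mat_apply_def Ptrans_def)
qed

text \<open>First-step analysis. The weight \<open>f\<close> stays arbitrary because in the
  induction step it becomes the transition row of the prepended state.\<close>

lemma sum_alive_survival:
  "(\<Sum>xs\<in>alive d n. f (hd xs) * trajectory_weight Q R xs) = (\<Sum>a\<in>{1..d}. f a * survival d Q n (a - 1))"
proof (induction n arbitrary: f)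
  case 0
  then show ?case by (simp add: sum_alive_0 trajectory_weight_def survival_def)
next
  case (Suc n)
  have "(\<Sum>xs\<in>alive d (Suc n). f (hd xs) * trajectory_weight Q R xs)
      = (\<Sum>a\<in>{1..d}. f a * (\<Sum>xs\<in>alive d n. Ptrans Q R a (hd xs) * trajectory_weight Q R xs))"
    by (simp add: sum_alive_Suc trajectory_weight_Cons sum_distrib_left mult.assoc cong: sum.cong)
  also have "\<dots> = (\<Sum>a\<in>{1..d}. f a * survival d Q (Suc n) (a - 1))"
    by (intro sum.cong refl) (simp only: Suc.IH sum_shift_states, simp add: survival_def)
  finally show ?case .
qed

text \<open>The prepended state adds its own visit, and the trajectories behind it then count with
  their survival weight only; this is the second summand of \<open>occupation\<close>.\<close>

lemma sum_alive_occupation: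
  "(\<Sum>xs\<in>alive d n. f (hd xs) * trajectory_weight Q R xs * (\<Sum>x\<leftarrow>xs. of_bool (x - 1 \<in> B)))
    = (\<Sum>a\<in>{1..d}. f a * occupation d Q B n (a - 1))"
proof (induction n arbitrary: f)
  case 0
  then show ?case by (simp add: sum_alive_0 trajectory_weight_def)
next
  case (Suc n)
  let ?w = "trajectory_weight Q R" and ?o = "\<lambda>xs. (\<Sum>x\<leftarrow>xs. of_bool (x - 1 \<in> B)) :: real"
  have inner: "(\<Sum>xs\<in>alive d n. f a * ?w (a # xs) * ?o (a # xs))
      = f a * occupation d Q B (Suc n) (a - 1)" if a: "a \<in> {1..d}" for a
  proof -
    have "(\<Sum>xs\<in>alive d n. f a * ?w (a # xs) * ?o (a # xs))
        = (\<Sum>xs\<in>alive d n. f a * (Ptrans Q R a (hd xs) * ?w xs * ?o xs)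
          + f a * (of_bool (a - 1 \<in> B) * (Ptrans Q R a (hd xs) * ?w xs)))"
      by (intro sum.cong refl) (simp add: trajectory_weight_Cons algebra_simps)
    also have "\<dots> = f a * (\<Sum>xs\<in>alive d n. Ptrans Q R a (hd xs) * ?w xs * ?o xs)
        + f a * (of_bool (a - 1 \<in> B) * (\<Sum>xs\<in>alive d n. Ptrans Q R a (hd xs) * ?w xs))"
      by (simp only: sum_distrib_left sum.distrib)
    also have "\<dots> = f a * mat_apply {..<d} (\<lambda>a b. Q $$ (a, b)) (occupation d Q B n) (a - 1)
        + f a * (of_bool (a - 1 \<in> B) * survival d Q (Suc n) (a - 1))"
      using a by (simp only: Suc.IH sum_alive_survival sum_shift_states) (simp add: survival_def)
    finally show ?thesis by (simp add: distrib_left)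
  qed
  show ?case by (simp only: sum_alive_Suc list.sel inner cong: sum.cong)
qed

lemma occ_frac_alive:
  assumes "xs \<in> alive d n"
  shows "occ_frac ds l n xs = (\<Sum>x\<leftarrow>xs. of_bool (x - 1 \<in> blk_idx ds l)) / real (Suc n)"
proof -
  have len: "length xs = Suc n" using assms by (simp add: alive_def)
  have pos: "xs ! m \<noteq> 0" if "m \<le> n" for m
  proof -
    have "xs ! m \<in> set xs" using len that by (intro nth_mem) simp
    thus ?thesis using assms by (auto simp: alive_def)
  qed
  have "{m \<in> {0..n}. xs ! m \<noteq> 0 \<and> xs ! m - 1 \<in> blk_idx ds l} = {m \<in> {0..n}. xs ! m - 1 \<in> blk_idx ds l}"
    using pos by auto
  hence "real (card {m \<in> {0..n}. xs ! m \<noteq> 0 \<and> xs ! m - 1 \<in> blk_idx ds l})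
      = (\<Sum>m\<in>{0..n}. of_bool (xs ! m - 1 \<in> blk_idx ds l))"
    by (simp add: of_bool_def sum.If_cases Int_def)
  also have "\<dots> = (\<Sum>x\<leftarrow>xs. of_bool (x - 1 \<in> blk_idx ds l))"
    using len by (simp add: sum_list_sum_nth atLeastLessThanSuc_atLeastAtMost)
  finally show ?thesis by (simp add: occ_frac_def)
qed

lemma cond_occ_eq:
  "cond_occ d Q R \<pi> ds l n = ((\<Sum>a<d. \<pi> $ a * occupation d Q (blk_idx ds l) n a) / real (Suc n)) /
     (\<Sum>a<d. \<pi> $ a * survival d Q n a)"
proof -
  have shift: "(\<Sum>a\<in>{1..d}. init_dist \<pi> a * x (a - 1)) = (\<Sum>a<d. \<pi> $ a * x a)" for x
    by (rule sum.reindex_bij_witness[of _ Suc "\<lambda>b. b - 1"]) (auto simp: init_dist_def)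
  have prob: "path_prob Q R \<pi> xs = init_dist \<pi> (hd xs) * trajectory_weight Q R xs" if "xs \<in> alive d n" for xs
    using that by (cases xs) (auto simp: path_prob_def trajectory_weight_def alive_def)
  have "(\<Sum>xs\<in>alive d n. path_prob Q R \<pi> xs * occ_frac ds l n xs)
      = (\<Sum>xs\<in>alive d n. init_dist \<pi> (hd xs) * trajectory_weight Q R xs
          * (\<Sum>x\<leftarrow>xs. of_bool (x - 1 \<in> blk_idx ds l))) / real (Suc n)"
    unfolding sum_divide_distrib by (intro sum.cong) (auto simp: prob occ_frac_alive)
  moreover have "(\<Sum>xs\<in>alive d n. path_prob Q R \<pi> xs)
      = (\<Sum>xs\<in>alive d n. init_dist \<pi> (hd xs) * trajectory_weight Q R xs)"
    by (intro sum.cong) (auto simp: prob)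
  ultimately show ?thesis
    unfolding cond_occ_def alive_eq by (simp only: sum_alive_survival sum_alive_occupation shift)
qed

section \<open>Matrices in Frobenius normal form\<close>

lemma blk_off_Suc: "i \<ge> 1 \<Longrightarrow> blk_off ds (Suc i) = blk_off ds i + ds i"
  by (simp add: blk_off_def)

lemma blk_off_mono: "i \<le> j \<Longrightarrow> blk_off ds i \<le> blk_off ds j"
  by (auto simp: blk_off_def intro!: sum_mono2)

lemma finite_blk_idx [simp]: "finite (blk_idx ds i)"
  by (simp add: blk_idx_def)

lemma blk_idx_disjoint:
  assumes "1 \<le> i" "i < j"
  shows "blk_idx ds i \<inter> blk_idx ds j = {}"
proof -
  have "blk_off ds i + ds i \<le> blk_off ds j"
    using blk_off_mono[of "Suc i" j ds] blk_off_Suc[of i ds] assms by simp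
  thus ?thesis by (auto simp: blk_idx_def)
qed

lemma UN_blk_idx: "(\<Union>i\<in>{1..m}. blk_idx ds i) = {..<\<Sum>i\<in>{1..m}. ds i}"
proof (induction m)
  case (Suc m)
  have "{1..Suc m} = insert (Suc m) {1..m}" by auto
  moreover have "blk_off ds (Suc m) = (\<Sum>i\<in>{1..m}. ds i)" by (simp add: blk_off_def atLeastLessThanSuc_atLeastAtMost)
  ultimately show ?case using Suc by (auto simp: blk_idx_def)
qed simp

lemma sum_blk_idx: "(\<Sum>b\<in>blk_idx ds i. f b) = (\<Sum>c<ds i. f (blk_off ds i + c))"
  unfolding blk_idx_def
  by (rule sum.reindex_bij_witness[of _ "\<lambda>c. blk_off ds i + c" "\<lambda>b. b - blk_off ds i"]) auto

lemma blk_idxE: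
  assumes "a \<in> blk_idx ds i"
  obtains a' where "a = blk_off ds i + a'" "a' < ds i"
proof -
  have "a = blk_off ds i + (a - blk_off ds i)" "a - blk_off ds i < ds i"
    using assms by (auto simp: blk_idx_def)
  thus ?thesis by (rule that)
qed

lemma blk_idxI: "a < ds i \<Longrightarrow> blk_off ds i + a \<in> blk_idx ds i"
  by (simp add: blk_idx_def)

lemma mat_apply_blk:
  assumes "w \<in> carrier_vec (ds j)" "\<And>b. b < ds j \<Longrightarrow> x (blk_off ds j + b) = w $ b" "a < ds i"
  shows "mat_apply (blk_idx ds j) (\<lambda>a b. Q $$ (a, b)) x (blk_off ds i + a) = (blk Q ds i j *\<^sub>v w) $ a"
  using assms by (simp add: mat_apply_def sum_blk_idx blk_def scalar_prod_def atLeast0LessThan)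

lemma mat_apply_pow_blk:
  assumes "w \<in> carrier_vec (ds i)" "\<And>b. b < ds i \<Longrightarrow> x (blk_off ds i + b) = w $ b" "a < ds i"
  shows "(mat_apply (blk_idx ds i) (\<lambda>a b. Q $$ (a, b)) ^^ m) x (blk_off ds i + a)
    = ((blk Q ds i i ^\<^sub>m m) *\<^sub>v w) $ a"
proof -
  have A: "blk Q ds i i \<in> carrier_mat (ds i) (ds i)" by (simp add: blk_def)
  show ?thesis
    unfolding pow_mat_mult_vec[OF A assms(1)] using assms(3)
  proof (induction m arbitrary: a)
    case 0
    then show ?case using assms(2) by simp
  next
    case (Suc m)
    have "mat_apply (blk_idx ds i) (\<lambda>a b. Q $$ (a, b)) ((mat_apply (blk_idx ds i) (\<lambda>a b. Q $$ (a, b)) ^^ m) x)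
        (blk_off ds i + a) = (blk Q ds i i *\<^sub>v ((*\<^sub>v) (blk Q ds i i) ^^ m) w) $ a"
      by (rule mat_apply_blk) (use pow_mat_vec_carrier[OF A assms(1)] Suc in auto)
    then show ?case by simp
  qed
qed

text \<open>The blocks are addressed by their global matrix positions \<open>blk_idx ds i\<close>, so \<open>gv i\<close> is the
  eigenvector \<open>v i\<close> shifted to these positions.\<close>

locale frobenius_form =
  fixes d k :: nat and ds :: "nat \<Rightarrow> nat" and Q :: "real mat" and v :: "nat \<Rightarrow> real vec"
  assumes Q_nonneg: "\<And>a b. a < d \<Longrightarrow> b < d \<Longrightarrow> 0 \<le> Q $$ (a, b)"
    and k_pos: "k \<ge> 1"
    and ds_pos: "\<And>i. i \<in> {1..k} \<Longrightarrow> ds i \<ge> 1"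
    and ds_sum: "(\<Sum>i\<in>{1..k}. ds i) = d"
    and lower_tri: "\<And>i j. i \<in> {1..k} \<Longrightarrow> j \<in> {1..k} \<Longrightarrow> i < j \<Longrightarrow> blk Q ds i j = 0\<^sub>m (ds i) (ds j)"
    and ev_pos: "\<And>i. i \<in> {1..k} \<Longrightarrow> eventually_positive (blk Q ds i i)"
    and v_carrier: "\<And>i. i \<in> {1..k} \<Longrightarrow> v i \<in> carrier_vec (ds i)"
    and v_pos: "\<And>i a. i \<in> {1..k} \<Longrightarrow> a < ds i \<Longrightarrow> 0 < v i $ a"
    and v_eig: "\<And>i. i \<in> {1..k} \<Longrightarrow> blk Q ds i i *\<^sub>v v i = rho Q ds i \<cdot>\<^sub>v v i"
    and v_scalar: "\<And>i. i \<in> {1..k} \<Longrightarrow> ds i = 1 \<Longrightarrow> v i = ones_vec 1"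
    and scalar: "\<And>i. i \<in> {1..k} \<Longrightarrow> rho Q ds i < rho_max k Q ds \<Longrightarrow> \<exists>c. blk Q ds i i = c \<cdot>\<^sub>m 1\<^sub>m (ds i)"
begin

abbreviation "B \<equiv> blk_idx ds"
abbreviation "q \<equiv> \<lambda>a b. Q $$ (a, b)"
abbreviation "\<rho> \<equiv> rho Q ds"
abbreviation "r \<equiv> rho_max k Q ds"

definition gv :: "nat \<Rightarrow> nat \<Rightarrow> real" where
  "gv i a = v i $ (a - blk_off ds i)"

lemma B_union: "(\<Union>i\<in>{1..k}. B i) = {..<d}"
  using UN_blk_idx[where m = k and ds = ds] ds_sum by simp

lemma B_less: "i \<in> {1..k} \<Longrightarrow> a \<in> B i \<Longrightarrow> a < d"
  using B_union by blast

lemma B_disjoint: "i \<in> {1..k} \<Longrightarrow> j \<in> {1..k} \<Longrightarrow> i \<noteq> j \<Longrightarrow> B i \<inter> B j = {}"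
  using blk_idx_disjoint[of i j ds] blk_idx_disjoint[of j i ds] by (cases "i < j") (auto simp: Int_commute)

lemma B_nonempty: "i \<in> {1..k} \<Longrightarrow> B i \<noteq> {}"
  using ds_pos[of i] by (auto simp: blk_idx_def)

lemma q_block_zero:
  assumes "blk Q ds i j = 0\<^sub>m (ds i) (ds j)" "a \<in> B i" "b \<in> B j"
  shows "q a b = 0"
proof -
  obtain a' where a: "a = blk_off ds i + a'" "a' < ds i" using assms(2) by (rule blk_idxE)
  obtain b' where b: "b = blk_off ds j + b'" "b' < ds j" using assms(3) by (rule blk_idxE)
  note ab = a b
  have "blk Q ds i j $$ (a', b') = 0" unfolding assms(1) using ab by simp
  thus ?thesis using ab by (simp add: blk_def)
qed

lemma rho_le: "i \<in> {1..k} \<Longrightarrow> \<rho> i \<le> r"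
  unfolding rho_max_def by (intro Max_ge) auto

lemma gv_eig:
  assumes i: "i \<in> {1..k}" and "a \<in> B i"
  shows "mat_apply (B i) q (gv i) a = \<rho> i * gv i a"
proof -
  obtain a' where a: "a = blk_off ds i + a'" "a' < ds i" using assms(2) by (rule blk_idxE)
  have "mat_apply (B i) q (gv i) (blk_off ds i + a') = (blk Q ds i i *\<^sub>v v i) $ a'"
    by (rule mat_apply_blk) (use v_carrier[OF i] a in \<open>auto simp: gv_def\<close>)
  thus ?thesis using v_eig[OF i] v_carrier[OF i] a by (simp add: gv_def)
qed

lemma primitive_block:
  assumes i: "i \<in> {1..k}"
  shows "\<exists>N. primitive_eigenvector (B i) q (gv i) (\<rho> i) N"
proof -
  obtain N where N: "\<And>n a b. n \<ge> N \<Longrightarrow> a < ds i \<Longrightarrow> b < ds i \<Longrightarrow> 0 < (blk Q ds i i ^\<^sub>m n) $$ (a, b)"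
    using ev_pos[OF i] by (auto simp: eventually_positive_def blk_def)
  have A: "blk Q ds i i \<in> carrier_mat (ds i) (ds i)" by (simp add: blk_def)
  \<comment> \<open>The successor guarantees an exponent of at least one.\<close>
  have "primitive_eigenvector (B i) q (gv i) (\<rho> i) (Suc N)"
  proof
    show "0 \<le> q a b" if "a \<in> B i" "b \<in> B i" for a b
      using B_less[OF i that(1)] B_less[OF i that(2)] by (rule Q_nonneg)
    show "0 < gv i a" if "a \<in> B i" for a
      using that v_pos[OF i] by (elim blk_idxE) (simp add: gv_def)
    show "0 < (mat_apply (B i) q ^^ Suc N) (unit_fun b) a" if "a \<in> B i" "b \<in> B i" for a b
    proof -
      obtain a' where a: "a = blk_off ds i + a'" "a' < ds i" using \<open>a \<in> B i\<close> by (rule blk_idxE)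
      obtain b' where b: "b = blk_off ds i + b'" "b' < ds i" using \<open>b \<in> B i\<close> by (rule blk_idxE)
      note ab = a b
      have "(mat_apply (B i) q ^^ Suc N) (unit_fun b) (blk_off ds i + a')
          = ((blk Q ds i i ^\<^sub>m Suc N) *\<^sub>v unit_vec (ds i) b') $ a'"
        using ab by (intro mat_apply_pow_blk) (auto simp: unit_fun_def)
      also have "\<dots> = (blk Q ds i i ^\<^sub>m Suc N) $$ (a', b')"
        using ab A pow_carrier_mat[OF A, of "Suc N"] by (simp add: scalar_prod_right_unit del: pow_mat.simps)
      finally show ?thesis unfolding ab(1) using N[of "Suc N" a' b'] ab(2,4) by simp
    qed
  qed (use i B_nonempty gv_eig in auto)
  thus ?thesis by blast
qed

lemma rho_pos:
  assumes "i \<in> {1..k}"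
  shows "0 < \<rho> i"
proof -
  obtain N where "primitive_eigenvector (B i) q (gv i) (\<rho> i) N" using primitive_block[OF assms] by blast
  thus ?thesis by (rule primitive_eigenvector.r_pos)
qed

lemma r_pos: "0 < r"
proof -
  have "1 \<in> {1..k}" using k_pos by simp
  thus ?thesis using rho_pos rho_le by (meson less_le_trans)
qed

lemma gv_pos:
  assumes "i \<in> {1..k}" "a \<in> B i"
  shows "0 < gv i a"
proof -
  obtain N where "primitive_eigenvector (B i) q (gv i) (\<rho> i) N" using primitive_block[OF assms(1)] by blast
  thus ?thesis using assms(2) by (rule primitive_eigenvector.v_pos)
qed

text \<open>Left Perron-Frobenius eigenvector of the diagonal block at global positions, normalised
  to have pairing 1 with the given right eigenvector.\<close>

definition lf :: "nat \<Rightarrow> nat \<Rightarrow> real" where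
  "lf i = (SOME u. (\<forall>b\<in>B i. 0 < u b) \<and> (\<Sum>b\<in>B i. u b * gv i b) = 1
      \<and> (\<forall>b\<in>B i. (\<Sum>a\<in>B i. u a * q a b) = \<rho> i * u b))"

lemma lf:
  assumes i: "i \<in> {1..k}"
  shows "(\<forall>b\<in>B i. 0 < lf i b) \<and> (\<Sum>b\<in>B i. lf i b * gv i b) = 1
      \<and> (\<forall>b\<in>B i. (\<Sum>a\<in>B i. lf i a * q a b) = \<rho> i * lf i b)"
proof -
  obtain N where N: "primitive_eigenvector (B i) q (gv i) (\<rho> i) N" using primitive_block[OF i] by blast
  obtain u where u: "\<And>b. b \<in> B i \<Longrightarrow> 0 < u b" "(\<Sum>b\<in>B i. u b * gv i b) = 1"
      "\<And>b. b \<in> B i \<Longrightarrow> (\<Sum>a\<in>B i. u a * q a b) = \<rho> i * u b"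
    by (rule primitive_eigenvector.left_eigenvector_exists[OF N]) blast
  show ?thesis unfolding lf_def by (rule someI[of _ u], intro conjI ballI) (use u in simp_all)
qed

lemma lf_pos: "i \<in> {1..k} \<Longrightarrow> b \<in> B i \<Longrightarrow> 0 < lf i b"
  and lf_gv: "i \<in> {1..k} \<Longrightarrow> (\<Sum>b\<in>B i. lf i b * gv i b) = 1"
  and lf_eig: "i \<in> {1..k} \<Longrightarrow> b \<in> B i \<Longrightarrow> (\<Sum>a\<in>B i. lf i a * q a b) = \<rho> i * lf i b"
  using lf by blast+

text \<open>Both alpha coefficients of a path have this form, so they become pairings with
  \<open>lf i\<close>; the simplicity needed comes from \<open>eigenvector_zero\<close>.\<close>

lemma lf_coefficient:
  assumes i: "i \<in> {1..k}" and w: "w \<in> carrier_vec (ds i)"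
  shows "(THE \<alpha>. \<exists>x\<in>Vminus Q ds i. w = \<alpha> \<cdot>\<^sub>v v i + x) = (\<Sum>a<ds i. lf i (blk_off ds i + a) * w $ a)"
proof -
  let ?o = "blk_off ds i"
  obtain N where N: "primitive_eigenvector (B i) q (gv i) (\<rho> i) N" using primitive_block[OF i] by blast
  have left: "(\<Sum>a<ds i. lf i (?o + a) * blk Q ds i i $$ (a, b)) = \<rho> i * lf i (?o + b)" if "b < ds i" for b
  proof -
    have "(\<Sum>a<ds i. lf i (?o + a) * blk Q ds i i $$ (a, b)) = (\<Sum>a<ds i. lf i (?o + a) * q (?o + a) (?o + b))"
      using that by (simp add: blk_def)
    thus ?thesis using lf_eig[OF i blk_idxI[of b ds i, OF that]] by (simp add: sum_blk_idx)
  qed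
  have uv: "(\<Sum>a<ds i. lf i (?o + a) * v i $ a) = 1"
    using lf_gv[OF i] by (simp add: sum_blk_idx gv_def)
  have simple: "g a = 0" if g: "\<And>a. a < ds i \<Longrightarrow> (\<Sum>b<ds i. blk Q ds i i $$ (a, b) * g b) = \<rho> i * g a"
    and ug: "(\<Sum>a<ds i. lf i (?o + a) * g a) = 0" and a: "a < ds i" for g a
  proof -
    have "mat_apply (B i) q (\<lambda>a. g (a - ?o)) a = \<rho> i * g (a - ?o)" if "a \<in> B i" for a
    proof -
      obtain a' where a: "a = ?o + a'" "a' < ds i" using \<open>a \<in> B i\<close> by (rule blk_idxE)
      have "mat_apply (B i) q (\<lambda>a. g (a - ?o)) a = (\<Sum>b<ds i. blk Q ds i i $$ (a', b) * g b)"
        using a by (simp add: mat_apply_def sum_blk_idx blk_def)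
      thus ?thesis using g a by simp
    qed
    moreover have "(\<Sum>b\<in>B i. lf i b * g (b - ?o)) = 0" using ug by (simp add: sum_blk_idx)
    ultimately have "g (?o + a - ?o) = 0"
      using primitive_eigenvector.eigenvector_zero[OF N lf_gv[OF i], of "\<lambda>a. g (a - ?o)"] blk_idxI[of a ds i, OF a] by blast
    thus ?thesis by simp
  qed
  show ?thesis
  proof (rule Vminus_coefficient[of ds i "\<lambda>a. lf i (?o + a)" Q "v i" w])
    show "g a = 0" if "\<And>a. a < ds i \<Longrightarrow> (\<Sum>b<ds i. blk Q ds i i $$ (a, b) * g b) = \<rho> i * g a"
      "(\<Sum>a<ds i. lf i (?o + a) * g a) = 0" "a < ds i" for g a
      using that by (rule simple[of g a])
  qed (fact left v_carrier[OF i] v_eig[OF i] uv w)+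
qed

lemma alpha_last_eq: "i \<in> {1..k} \<Longrightarrow> alpha_last Q ds v i = (\<Sum>b\<in>B i. lf i b)"
  using lf_coefficient[of i "ones_vec (ds i)"] by (simp add: alpha_last_def ones_vec_def sum_blk_idx)

lemma alpha_step_eq:
  assumes "i \<in> {1..k}" "j \<in> {1..k}"
  shows "alpha_step Q ds v i j = (\<Sum>b\<in>B i. lf i b * mat_apply (B j) q (gv j) b)"
proof -
  have "blk Q ds i j *\<^sub>v v j \<in> carrier_vec (ds i)" by (rule carrier_vecI) (simp add: blk_def)
  hence "alpha_step Q ds v i j = (\<Sum>a<ds i. lf i (blk_off ds i + a) * (blk Q ds i j *\<^sub>v v j) $ a)"
    unfolding alpha_step_def by (rule lf_coefficient[OF assms(1)])
  also have "\<dots> = (\<Sum>a<ds i. lf i (blk_off ds i + a) * mat_apply (B j) q (gv j) (blk_off ds i + a))"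
  proof (intro sum.cong refl)
    fix a assume "a \<in> {..<ds i}"
    hence "mat_apply (B j) q (gv j) (blk_off ds i + a) = (blk Q ds i j *\<^sub>v v j) $ a"
      using mat_apply_blk[of "v j" ds j "gv j" a i Q] v_carrier[OF assms(2)] by (simp add: gv_def)
    thus "lf i (blk_off ds i + a) * (blk Q ds i j *\<^sub>v v j) $ a
        = lf i (blk_off ds i + a) * mat_apply (B j) q (gv j) (blk_off ds i + a)" by simp
  qed
  finally show ?thesis by (simp add: sum_blk_idx)
qed

end

section \<open>Growth along block paths\<close>

context frobenius_form
begin

text \<open>All powers of a multiple of the identity have zero off-diagonal entries, which
  contradicts eventual positivity as soon as there are two positions.\<close>

lemma nonmax_block_size:
  assumes i: "i \<in> {1..k}" and less: "\<rho> i < r"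
  shows "ds i = 1"
proof (rule ccontr)
  assume "ds i \<noteq> 1"
  hence ds: "1 < ds i" using ds_pos[OF i] by simp
  obtain c where c: "blk Q ds i i = c \<cdot>\<^sub>m 1\<^sub>m (ds i)" using scalar[OF i less] by blast
  obtain N where N: "primitive_eigenvector (B i) q (gv i) (\<rho> i) N" using primitive_block[OF i] by blast
  have off: "q a b = 0" if ab: "a \<in> B i" "b \<in> B i" "a \<noteq> b" for a b
  proof -
    obtain a' where a: "a = blk_off ds i + a'" "a' < ds i" using ab(1) by (rule blk_idxE)
    obtain b' where b: "b = blk_off ds i + b'" "b' < ds i" using ab(2) by (rule blk_idxE)
    have "blk Q ds i i $$ (a', b') = 0" unfolding c using a b ab(3) by simp
    thus ?thesis using a b by (simp add: blk_def)
  qed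
  define b where "b = Suc (blk_off ds i)"
  have b: "b \<in> B i" and o: "blk_off ds i \<in> B i" using ds by (auto simp: b_def blk_idx_def)
  have zero: "(mat_apply (B i) q ^^ m) (unit_fun b) a = 0" if "a \<in> B i" "a \<noteq> b" for m a
    using that
  proof (induction m arbitrary: a)
    case 0
    then show ?case by (simp add: unit_fun_def)
  next
    case (Suc m)
    have "q a e * (mat_apply (B i) q ^^ m) (unit_fun b) e = 0" if "e \<in> B i" for e
      using off[OF Suc.prems(1) that] Suc.IH[OF Suc.prems] by (cases "e = a") auto
    hence "(\<Sum>e\<in>B i. q a e * (mat_apply (B i) q ^^ m) (unit_fun b) e) = 0" by (intro sum.neutral) blast
    then show ?case by (simp add: mat_apply_def[of _ _ "(mat_apply (B i) q ^^ m) (unit_fun b)"])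
  qed
  show False
    using primitive_eigenvector.A_pos[OF N o b] zero[OF o, of N] by (simp add: b_def)
qed

text \<open>The scalar gained when a block is put in front of a path: 1 / r is the one-step delay
  under normalisation by \<open>r ^ n\<close>, and 1 / (r - \<rho>) is the geometric series (1 / r)
  / (1 - \<rho> / r), with \<rho> the eigenvalue of the block.\<close>

definition fac :: "nat \<Rightarrow> real" where
  "fac i = (if \<rho> i = r then 1 / r else 1 / (r - \<rho> i))"

text \<open>One induction step along a path, in a form that treats both kinds of blocks alike: the
  source is paired with \<open>lf i\<close> and the result is proportional to
  \<open>gv i\<close>.\<close>

lemma block_growth:
  assumes i: "i \<in> {1..k}"
    and rec: "\<And>n a. a \<in> B i \<Longrightarrow> y (Suc n) a = mat_apply (B i) q (y n) a + z n a"
    and y0: "\<And>a. a \<in> B i \<Longrightarrow> y 0 a = 0"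
    and z: "\<And>a. a \<in> B i \<Longrightarrow> growth h (\<lambda>n. z n a / r ^ n) (c a)" and a: "a \<in> B i"
  shows "growth (if \<rho> i = r then Suc h else h) (\<lambda>n. y n a / r ^ n) ((\<Sum>b\<in>B i. lf i b * c b) * fac i * gv i a)"
proof (cases "\<rho> i = r")
  case True
  obtain N where N: "primitive_eigenvector (B i) q (gv i) r N" using primitive_block[OF i] True by auto
  have "growth (Suc h) (\<lambda>n. y n a / r ^ n) ((\<Sum>b\<in>B i. lf i b * c b) / r * gv i a)"
    by (rule primitive_eigenvector.eigenvector_growth[OF N lf_pos[OF i] lf_gv[OF i] lf_eig[OF i, unfolded True] rec y0 z a])
  thus ?thesis using True by (simp add: fac_def)
next
  case False
  hence less: "\<rho> i < r" using rho_le[OF i] by simp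
  have ds: "ds i = 1" by (rule nonmax_block_size[OF i less])
  \<comment> \<open>With a single position the block is the number \<open>\<rho> i\<close>, and
    \<open>v_scalar\<close> with the normalisation makes both eigenvectors equal to one.\<close>
  have Bi: "B i = {a}" using a ds by (auto simp: blk_idx_def)
  have gv: "gv i a = 1" using a ds v_scalar[OF i ds] by (simp add: gv_def blk_idx_def ones_vec_def)
  have lf1: "lf i a = 1" using lf_gv[OF i] gv by (simp add: Bi)
  have qa: "q a a = \<rho> i" using gv_eig[OF i a] gv by (simp add: Bi mat_apply_def)
  have "growth h (\<lambda>n. y n a / r ^ n) (1 / r * c a / (1 - \<rho> i / r))"
  proof (rule growth_contraction[where z = "\<lambda>n. 1 / r * (z n a / r ^ n)"])
    show "y (Suc n) a / r ^ Suc n = \<rho> i / r * (y n a / r ^ n) + 1 / r * (z n a / r ^ n)" for n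
      using rec[OF a, of n] by (simp add: Bi mat_apply_def qa add_divide_distrib)
    show "y 0 a / r ^ 0 = 0" using y0[OF a] by simp
    show "\<bar>\<rho> i / r\<bar> < 1" using less rho_pos[OF i] r_pos by simp
    show "growth h (\<lambda>n. 1 / r * (z n a / r ^ n)) (1 / r * c a)" by (rule growth_cmult[OF z[OF a]])
  qed
  moreover have "1 / r * c a / (1 - \<rho> i / r) = c a / (r - \<rho> i)"
  proof -
    have "r * (1 - \<rho> i / r) = r - \<rho> i" using r_pos by (simp add: right_diff_distrib)
    thus ?thesis by simp
  qed
  ultimately have "growth h (\<lambda>n. y n a / r ^ n) (c a / (r - \<rho> i))" by (simp only:)
  thus ?thesis using False by (simp add: fac_def gv lf1 Bi)
qed

section \<open>Contributions of a single block path\<close>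

lemma growth_mat_apply:
  assumes "\<And>b. b \<in> B j \<Longrightarrow> growth h (\<lambda>n. y n b / r ^ n) (C * gv j b)"
  shows "growth h (\<lambda>n. mat_apply (B j) q (y n) a / r ^ n) (C * mat_apply (B j) q (gv j) a)"
proof -
  have "growth h (\<lambda>n. \<Sum>b\<in>B j. q a b * (y n b / r ^ n)) (\<Sum>b\<in>B j. q a b * (C * gv j b))"
    by (intro growth_sum growth_cmult assms)
  moreover have "(\<lambda>n. \<Sum>b\<in>B j. q a b * (y n b / r ^ n)) = (\<lambda>n. mat_apply (B j) q (y n) a / r ^ n)"
    by (simp add: mat_apply_def sum_divide_distrib)
  moreover have "(\<Sum>b\<in>B j. q a b * (C * gv j b)) = C * mat_apply (B j) q (gv j) a"
    by (simp add: mat_apply_def sum_distrib_left mult.left_commute)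
  ultimately show ?thesis by simp
qed

text \<open>The source is the all-ones vector at time 0, placed on the last block: only paths of one
  block have an empty tail.\<close>

definition surv_path :: "nat list \<Rightarrow> nat \<Rightarrow> nat \<Rightarrow> real" where
  "surv_path = path_sum B q (\<lambda>\<theta> n a. if tl \<theta> = [] \<and> n = 0 then 1 else 0)"

text \<open>The source is the survival contribution from block \<open>l\<close> onwards; its index
  \<open>Suc n\<close> is time \<open>n\<close>.\<close>

definition occ_path :: "nat \<Rightarrow> nat list \<Rightarrow> nat \<Rightarrow> nat \<Rightarrow> real" where
  "occ_path l = path_sum B q (\<lambda>\<theta> n a. if hd \<theta> = l then surv_path \<theta> (Suc n) a else 0)"

definition max_count :: "nat list \<Rightarrow> nat" where
  "max_count \<theta> = length (filter (\<lambda>i. \<rho> i = r) \<theta>)"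

definition coef :: "nat list \<Rightarrow> real" where
  "coef \<theta> = alpha_path Q ds v \<theta> * prod_list (map fac \<theta>)"

lemma surv_path_0: "surv_path \<theta> 0 a = 0"
  by (simp add: surv_path_def)

lemma occ_path_0: "occ_path l \<theta> 0 a = 0"
  by (simp add: occ_path_def)

lemma surv_path_single: "surv_path [i] (Suc n) a = mat_apply (B i) q (surv_path [i] n) a + (if n = 0 then 1 else 0)"
  by (simp add: surv_path_def)

lemma surv_path_Cons: "surv_path (i # j # t) (Suc n) a
    = mat_apply (B i) q (surv_path (i # j # t) n) a + mat_apply (B j) q (surv_path (j # t) n) a"
  by (simp add: surv_path_def)

lemma occ_path_Cons: "occ_path l (i # t) (Suc n) a
    = mat_apply (B i) q (occ_path l (i # t) n) a + ((if i = l then surv_path (i # t) (Suc n) a else 0)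
      + (if t = [] then 0 else mat_apply (B (hd t)) q (occ_path l t n) a))"
  unfolding occ_path_def by (subst path_sum.simps(3)) simp

lemma coef_Cons:
  assumes "i \<in> {1..k}" "j \<in> {1..k}"
  shows "(\<Sum>b\<in>B i. lf i b * (coef (j # t) * mat_apply (B j) q (gv j) b)) * fac i = coef (i # j # t)"
proof -
  have "(\<Sum>b\<in>B i. lf i b * (coef (j # t) * mat_apply (B j) q (gv j) b)) = coef (j # t) * alpha_step Q ds v i j"
    unfolding alpha_step_eq[OF assms] by (simp add: sum_distrib_left mult.left_commute)
  thus ?thesis by (simp add: coef_def)
qed

text \<open>Induction from the last block upwards: the last block is driven by the impulse of order
  0, and each further block by the contribution of the tail behind it.\<close>

lemma surv_path_growth:
  assumes "\<theta> \<noteq> []" "set \<theta> \<subseteq> {1..k}" "a \<in> B (hd \<theta>)"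
  shows "growth (max_count \<theta>) (\<lambda>n. surv_path \<theta> n a / r ^ n) (coef \<theta> * gv (hd \<theta>) a)"
  using assms
proof (induction \<theta> arbitrary: a)
  case (Cons i t)
  have i: "i \<in> {1..k}" and a: "a \<in> B i" using Cons.prems by auto
  show ?case
  proof (cases t)
    case Nil
    have z: "growth 0 (\<lambda>n. (if n = 0 then 1 else 0) / r ^ n) 1"
    proof -
      \<comment> \<open>Normalisation does not affect the impulse, since
        \<open>r ^ 0 = 1\<close>.\<close>
      have "(\<lambda>n. (if n = 0 then 1 else 0) / r ^ n) = (\<lambda>n. if n = 0 then 1 else 0)" by auto
      thus ?thesis using growth_impulse by simp
    qed
    have "growth (if \<rho> i = r then Suc 0 else 0) (\<lambda>n. surv_path [i] n a / r ^ n)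
        ((\<Sum>b\<in>B i. lf i b * 1) * fac i * gv i a)"
      by (rule block_growth[OF i surv_path_single surv_path_0 z a])
    then show ?thesis using alpha_last_eq[OF i] by (cases "\<rho> i = r") (simp_all add: Nil max_count_def coef_def)
  next
    case t: (Cons j t')
    have j: "j \<in> {1..k}" using Cons.prems t by auto
    have IH: "growth (max_count t) (\<lambda>n. surv_path t n b / r ^ n) (coef t * gv j b)" if "b \<in> B j" for b
      using Cons.IH[of b] Cons.prems t that by auto
    have "growth (if \<rho> i = r then Suc (max_count t) else max_count t) (\<lambda>n. surv_path (i # j # t') n a / r ^ n)
        ((\<Sum>b\<in>B i. lf i b * (coef t * mat_apply (B j) q (gv j) b)) * fac i * gv i a)"
      unfolding t
      by (rule block_growth[OF i surv_path_Cons surv_path_0 growth_mat_apply[OF IH[unfolded t]] a])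
    then show ?thesis using coef_Cons[OF i j, of t'] by (cases "\<rho> i = r") (simp_all add: t max_count_def)
  qed
qed simp

lemma occ_path_absent: "l \<notin> set \<theta> \<Longrightarrow> occ_path l \<theta> n a = 0"
proof (induction \<theta> arbitrary: n a)
  case Nil
  then show ?case by (simp add: occ_path_def)
next
  case (Cons i t)
  show ?case
  proof (induction n arbitrary: a)
    case 0
    then show ?case by (rule occ_path_0)
  next
    case (Suc n)
    then show ?case using Cons.IH Cons.prems by (simp add: occ_path_Cons mat_apply_def)
  qed
qed

text \<open>Summing over the time spent in block \<open>l\<close> doubles this block with coupling matrix \<open>1\<close>. Since
  \<open>lf l\<close> is normalised against \<open>gv l\<close>, the doubling raises the order by one and leaves the
  coefficient unchanged when \<open>l\<close> is a maximal block.\<close>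

lemma occ_path_growth:
  assumes "distinct \<theta>" "set \<theta> \<subseteq> {1..k}" "l \<in> set \<theta>"
  shows "\<exists>C. (\<rho> l = r \<longrightarrow> C = coef \<theta>) \<and> (\<forall>a\<in>B (hd \<theta>).
    growth (if \<rho> l = r then Suc (max_count \<theta>) else max_count \<theta>) (\<lambda>n. occ_path l \<theta> n a / r ^ n) (C * gv (hd \<theta>) a))"
  using assms
proof (induction \<theta>)
  case (Cons i t)
  have i: "i \<in> {1..k}" using Cons.prems by auto
  show ?case
  proof (cases "i = l")
    case True
    have t0: "occ_path l t n b = 0" for n b
      using Cons.prems True by (intro occ_path_absent) auto
    \<comment> \<open>The survival index is ahead by one while the divisor is still
      \<open>r ^ n\<close>. The resulting factor \<open>r\<close> is cancelled by
      \<open>fac i\<close> when block \<open>i\<close> is maximal.\<close>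
    have z: "growth (max_count (i # t)) (\<lambda>n. surv_path (i # t) (Suc n) b / r ^ n) (r * (coef (i # t) * gv i b))"
      if "b \<in> B i" for b
    proof -
      have "growth (max_count (i # t)) (\<lambda>n. surv_path (i # t) n b / r ^ n) (coef (i # t) * gv i b)"
        using surv_path_growth[of "i # t" b] Cons.prems that by simp
      from growth_cmult[OF growth_Suc_shift[OF this], of r]
      have "growth (max_count (i # t)) (\<lambda>n. r * (surv_path (i # t) (Suc n) b / r ^ Suc n)) (r * (coef (i # t) * gv i b))"
        by (simp add: surv_path_0)
      moreover have "(\<lambda>n. r * (surv_path (i # t) (Suc n) b / r ^ Suc n)) = (\<lambda>n. surv_path (i # t) (Suc n) b / r ^ n)"
        using r_pos by (auto simp: fun_eq_iff)
      ultimately show ?thesis by simp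
    qed
    have rec: "occ_path l (i # t) (Suc n) b = mat_apply (B i) q (occ_path l (i # t) n) b + surv_path (i # t) (Suc n) b"
      for n b
      using True by (simp add: occ_path_Cons t0 mat_apply_def)
    \<comment> \<open>If block \<open>l\<close> is below the maximum, only the order will matter, so
      nothing is claimed about \<open>C\<close> there.\<close>
    define C where "C = (\<Sum>b\<in>B i. lf i b * (r * (coef (i # t) * gv i b))) * fac i"
    have "growth (if \<rho> i = r then Suc (max_count (i # t)) else max_count (i # t))
        (\<lambda>n. occ_path l (i # t) n a / r ^ n) (C * gv i a)" if "a \<in> B i" for a
      unfolding C_def by (rule block_growth[OF i rec occ_path_0 z that])
    moreover have "C = coef (i # t)" if "\<rho> i = r"
    proof -
      have "(\<Sum>b\<in>B i. lf i b * (r * (coef (i # t) * gv i b))) = r * coef (i # t) * (\<Sum>b\<in>B i. lf i b * gv i b)"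
        by (simp add: sum_distrib_left mult_ac)
      thus ?thesis using that r_pos lf_gv[OF i] by (simp add: C_def fac_def)
    qed
    ultimately show ?thesis using True by (intro exI[of _ C]) auto
  next
    case False
    then obtain j t' where t: "t = j # t'" using Cons.prems by (cases t) auto
    have j: "j \<in> {1..k}" using Cons.prems t by auto
    define h where "h = (if \<rho> l = r then Suc (max_count t) else max_count t)"
    obtain C where C: "\<rho> l = r \<Longrightarrow> C = coef t"
      and gr: "\<And>b. b \<in> B j \<Longrightarrow> growth h (\<lambda>n. occ_path l t n b / r ^ n) (C * gv j b)"
      using Cons.IH Cons.prems False t unfolding h_def by auto
    define C' where "C' = (\<Sum>b\<in>B i. lf i b * (C * mat_apply (B j) q (gv j) b)) * fac i"
    have rec: "occ_path l (i # t) (Suc n) b = mat_apply (B i) q (occ_path l (i # t) n) b + mat_apply (B j) q (occ_path l t n) b"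
      for n b
      using False t by (simp add: occ_path_Cons)
    have "growth (if \<rho> i = r then Suc h else h) (\<lambda>n. occ_path l (i # t) n a / r ^ n) (C' * gv i a)"
      if "a \<in> B i" for a
      unfolding C'_def by (rule block_growth[OF i rec occ_path_0 growth_mat_apply[OF gr] that])
    moreover have "(if \<rho> i = r then Suc h else h)
        = (if \<rho> l = r then Suc (max_count (i # t)) else max_count (i # t))"
      by (simp add: h_def max_count_def)
    moreover have "C' = coef (i # t)" if "\<rho> l = r"
      using coef_Cons[OF i j, of t'] C[OF that] by (simp add: C'_def t)
    ultimately show ?thesis by (intro exI[of _ C']) auto
  qed
qed simp

end

section \<open>Maximal paths\<close>

lemma growth_ratio:
  assumes y': "growth (Suc H) y' c'" and y: "growth H y c" and c: "c \<noteq> 0" and H: "H \<ge> 1"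
  shows "(\<lambda>n. y' (Suc n) / real (Suc n) / y (Suc n)) \<longlonglongrightarrow> c' / (real H * c)"
proof -
  have "(\<lambda>n. y' n / (real (Suc n) ^ Suc H / real (Suc n)) / (y n / (real (Suc n) ^ H / real (Suc n))))
      \<longlonglongrightarrow> c' * real (Suc H) / fact (Suc H) / (c * real H / fact H)"
    using c H by (intro tendsto_divide[OF conjunct2[OF y'[unfolded growth_def]] conjunct2[OF y[unfolded growth_def]]]) simp
  moreover have "c' * real (Suc H) / fact (Suc H) / (c * real H / fact H) = c' / (real H * c)"
  proof -
    have "c' * real (Suc H) / fact (Suc H) = c' / fact H" by (simp del: of_nat_Suc)
    thus ?thesis by (simp add: mult.commute)
  qed
  moreover have "y' n / (real (Suc n) ^ Suc H / real (Suc n)) / (y n / (real (Suc n) ^ H / real (Suc n)))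
      = y' n / real (Suc n) / y n" for n
    by (simp del: of_nat_Suc)
  ultimately have "(\<lambda>n. y' n / real (Suc n) / y n) \<longlonglongrightarrow> c' / (real H * c)" by (simp only:)
  hence "(\<lambda>n. y' (Suc n) / real (Suc (Suc n)) / y (Suc n)) \<longlonglongrightarrow> c' / (real H * c)" by (rule LIMSEQ_Suc)
  \<comment> \<open>Replaces the divisor n + 2 coming from index \<open>Suc n\<close> by the n + 1
    time points that are averaged.\<close>
  moreover have "(\<lambda>n. inverse (real (Suc n) / real (Suc (Suc n)))) \<longlonglongrightarrow> inverse 1"
    by (intro tendsto_inverse Suc_ratio_tendsto_1) simp
  ultimately have "(\<lambda>n. y' (Suc n) / real (Suc (Suc n)) / y (Suc n) * inverse (real (Suc n) / real (Suc (Suc n))))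
      \<longlonglongrightarrow> c' / (real H * c) * inverse 1" by (rule tendsto_mult)
  moreover have "y' (Suc n) / real (Suc (Suc n)) / y (Suc n) * inverse (real (Suc n) / real (Suc (Suc n)))
      = y' (Suc n) / real (Suc n) / y (Suc n)" for n
    by (simp del: of_nat_Suc)
  ultimately show ?thesis by (simp only: inverse_1 mult_1_right)
qed

lemma sum_if_subset:
  assumes "finite A" "M \<subseteq> A"
  shows "(\<Sum>x\<in>A. if x \<in> M then f x else 0) = (\<Sum>x\<in>M. f x)"
proof -
  have "(\<Sum>x\<in>A. if x \<in> M then f x else 0) = (\<Sum>x\<in>A \<inter> M. f x)"
    using assms(1) by (rule sum.inter_restrict[symmetric])
  also have "A \<inter> M = M" using assms(2) by blast
  finally show ?thesis .
qed

lemma desc_paths_subset: "\<theta> \<in> desc_paths i \<Longrightarrow> set \<theta> \<subseteq> {1..i}"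
  by (cases \<theta>) (auto simp: desc_paths_def less_imp_le dest: subsetD)

lemma admissible_Cons:
  assumes "i # j # t \<in> desc_paths i" "i \<le> k"
  shows "admissible k Q ds (i # j # t) \<longleftrightarrow> blk Q ds i j \<noteq> 0\<^sub>m (ds i) (ds j) \<and> admissible k Q ds (j # t)"
proof -
  let ?P = "\<lambda>\<theta> u. Suc u < length \<theta> \<longrightarrow>
     blk Q ds (\<theta> ! u) (\<theta> ! Suc u) \<noteq> 0\<^sub>m (ds (\<theta> ! u)) (ds (\<theta> ! Suc u))"
  have nat_split: "(\<forall>u. S u) \<longleftrightarrow> S 0 \<and> (\<forall>u. S (Suc u))" for S
    by (metis not0_implies_Suc)
  have "(\<forall>u. ?P (i # j # t) u) \<longleftrightarrow> blk Q ds i j \<noteq> 0\<^sub>m (ds i) (ds j) \<and> (\<forall>u. ?P (j # t) u)"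
    by (subst nat_split) simp
  moreover have "set (i # j # t) \<subseteq> {1..k}" using desc_paths_subset[OF assms(1)] assms(2) by auto
  moreover have "sorted_wrt (>) (i # j # t)" using assms(1) by (simp add: desc_paths_def)
  ultimately show ?thesis unfolding admissible_def by auto
qed

lemma desc_paths_tl: "i # j # t \<in> desc_paths i \<Longrightarrow> j # t \<in> desc_paths j \<and> 1 \<le> j \<and> j < i"
  by (auto simp: desc_paths_def)

lemma admissible_single: "i \<in> {1..k} \<Longrightarrow> admissible k Q ds [i]"
  by (simp add: admissible_def)

lemma admissible_desc:
  assumes "admissible k Q ds \<theta>"
  shows "hd \<theta> \<in> {1..k} \<and> \<theta> \<in> desc_paths (hd \<theta>)"
proof -
  have "\<theta> \<noteq> []" "sorted_wrt (>) \<theta>" and s: "set \<theta> \<subseteq> {1..k}" using assms by (auto simp: admissible_def)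
  moreover from s have "set \<theta> \<subseteq> {1..}" by auto
  moreover have "hd \<theta> \<in> {1..k}" using s hd_in_set[OF \<open>\<theta> \<noteq> []\<close>] by blast
  ultimately show ?thesis by (simp add: desc_paths_def)
qed

context frobenius_form
begin

text \<open>A vanishing coupling block cuts the inflow, and otherwise the inadmissible tail itself
  contributes zero. A path of at least two blocks has no other source, so the recursion stays at its
  initial value zero.\<close>

lemma surv_path_not_admissible:
  assumes "\<theta> \<in> desc_paths i" "i \<in> {1..k}" "\<not> admissible k Q ds \<theta>" "a \<in> B i"
  shows "surv_path \<theta> n a = 0"
  using assms
proof (induction \<theta> arbitrary: i n a)
  case (Cons i' t)
  have i': "i' = i" using Cons.prems(1) by (simp add: desc_paths_def)
  obtain j t' where t: "t = j # t'"
    using Cons.prems(2,3) admissible_single[of i k Q ds] by (cases t) (auto simp: i')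
  have th: "i # j # t' \<in> desc_paths i" using Cons.prems(1) i' t by simp
  note tl = desc_paths_tl[OF th]
  have j: "j \<in> {1..k}" using tl Cons.prems(2) by simp
  have z: "mat_apply (B j) q (surv_path (j # t') m) b = 0" if b: "b \<in> B i" for m b
  proof (cases "blk Q ds i j = 0\<^sub>m (ds i) (ds j)")
    case True
    then show ?thesis using q_block_zero[OF True b] by (simp add: mat_apply_def)
  next
    case False
    hence "\<not> admissible k Q ds (j # t')"
      using Cons.prems(2,3) admissible_Cons[OF th, of k Q ds] i' t by simp
    hence "surv_path (j # t') m e = 0" if "e \<in> B j" for e
      using Cons.IH[of j] tl j t that by blast
    then show ?thesis by (simp add: mat_apply_def)
  qed
  have "surv_path (i # j # t') n a = 0" using Cons.prems(4)
  proof (induction n arbitrary: a)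
    case 0
    then show ?case by (simp add: surv_path_0)
  next
    case (Suc n)
    then show ?case by (simp add: surv_path_Cons z) (simp add: mat_apply_def)
  qed
  then show ?case by (simp add: i' t)
qed (simp add: desc_paths_def)

text \<open>As for survival, with one more source at paths starting in \<open>l\<close>; it vanishes
  because the survival contribution of the same path does.\<close>

lemma occ_path_not_admissible:
  assumes "\<theta> \<in> desc_paths i" "i \<in> {1..k}" "\<not> admissible k Q ds \<theta>" "a \<in> B i"
  shows "occ_path l \<theta> n a = 0"
  using assms
proof (induction \<theta> arbitrary: i n a)
  case (Cons i' t)
  have i': "i' = i" using Cons.prems(1) by (simp add: desc_paths_def)
  obtain j t' where t: "t = j # t'"
    using Cons.prems(2,3) admissible_single[of i k Q ds] by (cases t) (auto simp: i')
  have th: "i # j # t' \<in> desc_paths i" using Cons.prems(1) i' t by simp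
  note tl = desc_paths_tl[OF th]
  have j: "j \<in> {1..k}" using tl Cons.prems(2) by simp
  have s: "surv_path (i # j # t') m b = 0" if "b \<in> B i" for m b
    using surv_path_not_admissible[OF th Cons.prems(2) _ that] Cons.prems(3) i' t by simp
  have z: "mat_apply (B j) q (occ_path l (j # t') m) b = 0" if b: "b \<in> B i" for m b
  proof (cases "blk Q ds i j = 0\<^sub>m (ds i) (ds j)")
    case True
    then show ?thesis using q_block_zero[OF True b] by (simp add: mat_apply_def)
  next
    case False
    hence "\<not> admissible k Q ds (j # t')"
      using Cons.prems(2,3) admissible_Cons[OF th, of k Q ds] i' t by simp
    hence "occ_path l (j # t') m e = 0" if "e \<in> B j" for e
      using Cons.IH[of j] tl j t that by blast
    then show ?thesis by (simp add: mat_apply_def)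
  qed
  have "occ_path l (i # j # t') n a = 0" using Cons.prems(4)
  proof (induction n arbitrary: a)
    case 0
    then show ?case by (simp add: occ_path_0)
  next
    case (Suc n)
    have m: "mat_apply (B i) q (occ_path l (i # j # t') n) a = 0" using Suc.IH by (simp add: mat_apply_def)
    have e: "(if i = l then surv_path (i # j # t') (Suc n) a else 0) = 0" by (simp only: s[OF Suc.prems] if_cancel)
    show ?case using z[OF Suc.prems, of n] by (simp only: occ_path_Cons m e list.sel list.distinct if_False add_0_left)
  qed
  then show ?case by (simp add: i' t)
qed (simp add: desc_paths_def)

text \<open>At time 0 the sources of all paths from \<open>i\<close> must add up to the value 1 of
  the all-ones vector; only the path consisting of \<open>i\<close> alone has one.\<close>

lemma survival_eq_sum:
  assumes "i \<in> {1..k}" "a \<in> B i"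
  shows "survival d Q n a = (\<Sum>\<theta>\<in>desc_paths i. surv_path \<theta> (Suc n) a)"
  unfolding surv_path_def
proof (rule path_sum_decomposition[where k = k])
  show "q a b = 0" if "i \<in> {1..k}" "j \<in> {1..k}" "i < j" "a \<in> B i" "b \<in> B j" for i j a b
    using q_block_zero[OF lower_tri[OF that(1-3)] that(4,5)] .
  have one: "(\<Sum>\<theta>\<in>desc_paths i. if tl \<theta> = [] then 1 else 0) = (1 :: real)" if "i \<in> {1..k}" for i
  proof -
    have "(\<Sum>j\<in>{1..<i}. \<Sum>t\<in>desc_paths j. if t = [] then 1 else 0) = (0 :: real)"
      by (intro sum.neutral ballI) (auto simp: desc_paths_def)
    thus ?thesis using sum_desc_paths[of i "\<lambda>t. if t = [] then 1 else 0"] that by simp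
  qed
  show "survival d Q 0 a = (\<Sum>\<theta>\<in>desc_paths i. if tl \<theta> = [] \<and> (0::nat) = 0 then 1 else 0)"
    if "i \<in> {1..k}" "a \<in> B i" for i a
    using one[OF that(1)] by (simp add: survival_def)
  show "survival d Q (Suc n) a = mat_apply (\<Union>j\<in>{1..k}. B j) q (survival d Q n) a
      + (\<Sum>\<theta>\<in>desc_paths i. if tl \<theta> = [] \<and> Suc n = 0 then 1 else 0)" for n i a
    by (simp add: survival_def B_union[simplified])
qed (use assms B_disjoint in auto)

text \<open>By disjointness of the blocks, a position of block \<open>i\<close> lies in block
  \<open>l\<close> only if \<open>i = l\<close>. Its survival value is then distributed over the
  paths starting in \<open>l\<close>.\<close>

lemma occupation_eq_sum:
  assumes "i \<in> {1..k}" "a \<in> B i" "l \<in> {1..k}"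
  shows "occupation d Q (B l) n a = (\<Sum>\<theta>\<in>desc_paths i. occ_path l \<theta> (Suc n) a)"
  unfolding occ_path_def
proof (rule path_sum_decomposition[where k = k])
  show "q a b = 0" if "i \<in> {1..k}" "j \<in> {1..k}" "i < j" "a \<in> B i" "b \<in> B j" for i j a b
    using q_block_zero[OF lower_tri[OF that(1-3)] that(4,5)] .
  have src: "of_bool (a \<in> B l) * survival d Q n a
      = (\<Sum>\<theta>\<in>desc_paths i. if hd \<theta> = l then surv_path \<theta> (Suc n) a else 0)"
    if "i \<in> {1..k}" "a \<in> B i" for n i a
  proof -
    have mem: "a \<in> B l \<longleftrightarrow> i = l" using B_disjoint[OF that(1) assms(3)] that(2) by auto
    have "(\<Sum>\<theta>\<in>desc_paths i. if hd \<theta> = l then surv_path \<theta> (Suc n) a else 0)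
        = (\<Sum>\<theta>\<in>desc_paths i. if i = l then surv_path \<theta> (Suc n) a else 0)"
      by (intro sum.cong) (auto simp: desc_paths_def)
    thus ?thesis using mem survival_eq_sum[OF that] by simp
  qed
  show "occupation d Q (B l) 0 a = (\<Sum>\<theta>\<in>desc_paths i. if hd \<theta> = l then surv_path \<theta> (Suc 0) a else 0)"
    if "i \<in> {1..k}" "a \<in> B i" for i a
    using src[OF that, of 0] by (simp add: survival_def)
  show "occupation d Q (B l) (Suc n) a = mat_apply (\<Union>j\<in>{1..k}. B j) q (occupation d Q (B l) n) a
      + (\<Sum>\<theta>\<in>desc_paths i. if hd \<theta> = l then surv_path \<theta> (Suc (Suc n)) a else 0)"
    if "i \<in> {1..k}" "a \<in> B i" for n i a
    unfolding src[OF that, symmetric] B_union by simp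
qed (use assms B_disjoint in auto)

section \<open>Maximal paths, their coefficients and the limit\<close>

lemma max_count_eq: "max_count \<theta> = card {u. u < length \<theta> \<and> \<rho> (\<theta> ! u) = r}"
  by (simp add: max_count_def length_filter_conv_card)

lemma rho_path_eq_iff:
  assumes "\<theta> \<noteq> []" "set \<theta> \<subseteq> {1..k}"
  shows "rho_path Q ds \<theta> = r \<longleftrightarrow> 0 < max_count \<theta>"
proof -
  let ?R = "(\<lambda>u. \<rho> (\<theta> ! u)) ` {..<length \<theta>}"
  have fin: "finite ?R" and ne: "?R \<noteq> {}" using assms(1) by auto
  have le: "\<rho> (\<theta> ! u) \<le> r" if "u < length \<theta>" for u
    using rho_le assms(2) nth_mem[OF that] by blast
  have "rho_path Q ds \<theta> = r \<longleftrightarrow> (\<exists>u<length \<theta>. \<rho> (\<theta> ! u) = r)"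
  proof
    assume "rho_path Q ds \<theta> = r"
    hence "r \<in> ?R" using Max_in[OF fin ne] by (simp add: rho_path_def)
    thus "\<exists>u<length \<theta>. \<rho> (\<theta> ! u) = r" by (auto simp: image_iff)
  next
    assume "\<exists>u<length \<theta>. \<rho> (\<theta> ! u) = r"
    then obtain u where u: "u < length \<theta>" "\<rho> (\<theta> ! u) = r" by blast
    have "r \<in> ?R" using u by (intro image_eqI[of _ _ u]) auto
    thus "rho_path Q ds \<theta> = r" unfolding rho_path_def using le by (intro Max_eqI[OF fin]) auto
  qed
  also have "\<dots> \<longleftrightarrow> {u. u < length \<theta> \<and> \<rho> (\<theta> ! u) = r} \<noteq> {}" by blast
  finally show ?thesis by (simp add: max_count_eq card_gt_0_iff)
qed

lemma hplus_eq: "rho_path Q ds \<theta> = r \<Longrightarrow> hplus Q ds \<theta> = max_count \<theta>"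
  by (simp add: hplus_def Hplus_def max_count_eq)

lemma finite_adm_paths: "finite (adm_paths k Q ds)"
proof (rule finite_subset)
  show "adm_paths k Q ds \<subseteq> (\<Union>i\<in>{1..k}. desc_paths i)"
    using admissible_desc[of k Q ds] by (auto simp: adm_paths_def simp del: atLeastAtMost_iff)
qed (simp add: finite_desc_paths)

text \<open>Since the maximal count is positive, a path attaining it contains a block with
  eigenvalue \<open>r\<close>, so the condition on \<open>rho_path\<close> is automatic.\<close>

lemma P_max_iff:
  assumes "P_max k Q ds \<noteq> {}"
  shows "\<theta> \<in> P_max k Q ds \<longleftrightarrow> admissible k Q ds \<theta> \<and> max_count \<theta> = hplus_max k Q ds"
    and "1 \<le> hplus_max k Q ds"
proof -
  have adm: "\<theta> \<noteq> []" "set \<theta> \<subseteq> {1..k}" if "admissible k Q ds \<theta>" for \<theta>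
    using that unfolding admissible_def by blast+
  have pos: "0 < max_count \<theta>" if "\<theta> \<in> P_max k Q ds" for \<theta>
  proof -
    have "admissible k Q ds \<theta>" "rho_path Q ds \<theta> = r" using that by (simp_all add: P_max_def adm_paths_def)
    thus ?thesis using rho_path_eq_iff[OF adm] by blast
  qed
  have eq: "hplus_max k Q ds = max_count \<theta>" if "\<theta> \<in> P_max k Q ds" for \<theta>
    using that hplus_eq[of \<theta>] by (simp add: P_max_def)
  obtain \<theta>0 where \<theta>0: "\<theta>0 \<in> P_max k Q ds" using assms by blast
  have "0 < hplus_max k Q ds" using pos[OF \<theta>0] eq[OF \<theta>0] by simp
  thus H: "1 \<le> hplus_max k Q ds" by simp
  show "\<theta> \<in> P_max k Q ds \<longleftrightarrow> admissible k Q ds \<theta> \<and> max_count \<theta> = hplus_max k Q ds"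
  proof
    assume \<theta>: "\<theta> \<in> P_max k Q ds"
    hence "admissible k Q ds \<theta>" by (simp add: P_max_def adm_paths_def)
    thus "admissible k Q ds \<theta> \<and> max_count \<theta> = hplus_max k Q ds" using eq[OF \<theta>] by (simp only: simp_thms)
  next
    assume a: "admissible k Q ds \<theta> \<and> max_count \<theta> = hplus_max k Q ds"
    have "0 < max_count \<theta>" using a H by linarith
    hence rp: "rho_path Q ds \<theta> = r" using a rho_path_eq_iff[OF adm] by blast
    thus "\<theta> \<in> P_max k Q ds" using a hplus_eq[OF rp] by (simp add: P_max_def adm_paths_def)
  qed
qed

lemma max_count_le:
  assumes "admissible k Q ds \<theta>"
  shows "max_count \<theta> \<le> hplus_max k Q ds"
proof (cases "max_count \<theta> = 0")
  case False
  hence rp: "rho_path Q ds \<theta> = r" using rho_path_eq_iff[of \<theta>] assms by (simp add: admissible_def)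
  have "hplus Q ds \<theta> \<le> hplus_max k Q ds"
    unfolding hplus_max_def using rp assms finite_adm_paths by (intro Max_ge) (auto simp: adm_paths_def)
  thus ?thesis using hplus_eq[OF rp] by simp
qed simp

text \<open>Every maximal block contributes 1 / r, and all paths in \<open>P_max\<close> have
  equally many of them. The power of 1 / r is therefore common to all terms and cancels in the final
  quotient.\<close>

lemma coef_path_weight:
  assumes "\<theta> \<in> P_max k Q ds"
  shows "coef \<theta> * pi_v \<pi> ds v (hd \<theta>) = (1 / r) ^ hplus_max k Q ds * path_weight k Q ds v \<pi> \<theta>"
proof -
  have ne: "P_max k Q ds \<noteq> {}" using assms by blast
  have rp: "rho_path Q ds \<theta> = r" and s: "set \<theta> \<subseteq> {1..k}"
    using assms by (auto simp: P_max_def adm_paths_def admissible_def)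
  let ?S = "{u. \<rho> (\<theta> ! u) = r}"
  have le: "\<rho> (\<theta> ! u) \<le> r" if "u < length \<theta>" for u
    using rho_le s nth_mem[OF that] by blast
  have "prod_list (map fac \<theta>) = (\<Prod>u<length \<theta>. fac (\<theta> ! u))"
    by (induction \<theta>) (simp_all add: prod.lessThan_Suc_shift del: prod.lessThan_Suc)
  also have "\<dots> = (\<Prod>u\<in>{..<length \<theta>} \<inter> ?S. 1 / r) * (\<Prod>u\<in>{..<length \<theta>} \<inter> - ?S. 1 / (r - \<rho> (\<theta> ! u)))"
    unfolding fac_def by (rule prod.If_cases) simp
  also have "{..<length \<theta>} \<inter> - ?S = Hminus Q ds \<theta>"
    using le rp by (force simp: Hminus_def)
  also have "(\<Prod>u\<in>{..<length \<theta>} \<inter> ?S. 1 / r) = (1 / r) ^ max_count \<theta>"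
  proof -
    have "{..<length \<theta>} \<inter> ?S = {u. u < length \<theta> \<and> \<rho> (\<theta> ! u) = r}" by auto
    thus ?thesis by (simp add: max_count_eq)
  qed
  also have "max_count \<theta> = hplus_max k Q ds" using P_max_iff(1)[OF ne] assms by blast
  finally show ?thesis by (simp add: coef_def path_weight_def mult_ac)
qed

text \<open>All ingredients of the pairings are nonnegative. This excludes cancellation between the
  terms of the denominator.\<close>

lemma alpha_path_nonneg:
  assumes "\<theta> \<noteq> []" "set \<theta> \<subseteq> {1..k}"
  shows "0 \<le> alpha_path Q ds v \<theta>"
  using assms
proof (induction \<theta>)
  case (Cons i t)
  have i: "i \<in> {1..k}" using Cons.prems by simp
  show ?case
  proof (cases t)
    case Nil
    have "0 \<le> (\<Sum>b\<in>B i. lf i b)" using lf_pos[OF i] by (simp add: sum_nonneg less_imp_le)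
    then show ?thesis using alpha_last_eq[OF i] Nil by simp
  next
    case t: (Cons j t')
    have ij: "i \<in> {1..k}" "j \<in> {1..k}" using Cons.prems t by auto
    have "0 \<le> (\<Sum>b\<in>B i. lf i b * mat_apply (B j) q (gv j) b)"
      unfolding mat_apply_def
    proof (intro sum_nonneg mult_nonneg_nonneg)
      show "0 \<le> lf i b" if "b \<in> B i" for b using lf_pos[OF ij(1) that] by simp
      show "0 \<le> q b e" if "b \<in> B i" "e \<in> B j" for b e
        using Q_nonneg[OF B_less[OF ij(1) that(1)] B_less[OF ij(2) that(2)]] .
      show "0 \<le> gv j e" if "e \<in> B j" for e using gv_pos[OF ij(2) that] by simp
    qed
    moreover have "0 \<le> alpha_path Q ds v (j # t')" using Cons.IH Cons.prems t by simp
    ultimately show ?thesis using alpha_step_eq[OF ij] t by simp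
  qed
qed simp

text \<open>Stated for a subset \<open>M\<close> so that it serves both the denominator, with all
  maximal paths, and the numerator, with those through \<open>l\<close> or none.\<close>

lemma total_growth:
  assumes M: "M \<subseteq> P_max k Q ds"
    and Y: "\<And>i \<theta> a. i \<in> {1..k} \<Longrightarrow> \<theta> \<in> desc_paths i \<Longrightarrow> a \<in> B i \<Longrightarrow>
      growth h (\<lambda>n. Y \<theta> n a / r ^ n) (if \<theta> \<in> M then coef \<theta> * gv i a else 0)"
  shows "growth h (\<lambda>n. (\<Sum>i\<in>{1..k}. \<Sum>a\<in>B i. \<pi> $ a * (\<Sum>\<theta>\<in>desc_paths i. Y \<theta> n a)) / r ^ n)
    ((1 / r) ^ hplus_max k Q ds * (\<Sum>\<theta>\<in>M. path_weight k Q ds v \<pi> \<theta>))"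
proof -
  have "growth h (\<lambda>n. \<Sum>i\<in>{1..k}. \<Sum>a\<in>B i. \<pi> $ a * (\<Sum>\<theta>\<in>desc_paths i. Y \<theta> n a / r ^ n))
      (\<Sum>i\<in>{1..k}. \<Sum>a\<in>B i. \<pi> $ a * (\<Sum>\<theta>\<in>desc_paths i. if \<theta> \<in> M then coef \<theta> * gv i a else 0))"
    by (intro growth_sum growth_cmult Y)
  moreover have "(\<lambda>n. \<Sum>i\<in>{1..k}. \<Sum>a\<in>B i. \<pi> $ a * (\<Sum>\<theta>\<in>desc_paths i. Y \<theta> n a / r ^ n))
      = (\<lambda>n. (\<Sum>i\<in>{1..k}. \<Sum>a\<in>B i. \<pi> $ a * (\<Sum>\<theta>\<in>desc_paths i. Y \<theta> n a)) / r ^ n)"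
    by (simp only: sum_divide_distrib[symmetric] times_divide_eq_right)
  moreover have "(\<Sum>i\<in>{1..k}. \<Sum>a\<in>B i. \<pi> $ a * (\<Sum>\<theta>\<in>desc_paths i. if \<theta> \<in> M then coef \<theta> * gv i a else 0))
      = (1 / r) ^ hplus_max k Q ds * (\<Sum>\<theta>\<in>M. path_weight k Q ds v \<pi> \<theta>)"
  proof -
    define f where "f \<theta> = coef \<theta> * pi_v \<pi> ds v (hd \<theta>)" for \<theta>
    have inner: "(\<Sum>a\<in>B i. \<pi> $ a * (\<Sum>\<theta>\<in>desc_paths i. if \<theta> \<in> M then coef \<theta> * gv i a else 0))
        = (\<Sum>\<theta>\<in>desc_paths i. if \<theta> \<in> M then f \<theta> else 0)" for i
    proof -
      have "(\<Sum>a\<in>B i. \<pi> $ a * (\<Sum>\<theta>\<in>desc_paths i. if \<theta> \<in> M then coef \<theta> * gv i a else 0))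
          = (\<Sum>\<theta>\<in>desc_paths i. \<Sum>a\<in>B i. \<pi> $ a * (if \<theta> \<in> M then coef \<theta> * gv i a else 0))"
        unfolding sum_distrib_left by (rule sum.swap)
      also have "\<dots> = (\<Sum>\<theta>\<in>desc_paths i. if \<theta> \<in> M then f \<theta> else 0)"
      proof (intro sum.cong refl)
        fix \<theta> assume "\<theta> \<in> desc_paths i"
        hence "hd \<theta> = i" by (simp add: desc_paths_def)
        moreover have "pi_v \<pi> ds v i = (\<Sum>a\<in>B i. \<pi> $ a * gv i a)"
          by (simp add: pi_v_def sum_blk_idx gv_def)
        ultimately show "(\<Sum>a\<in>B i. \<pi> $ a * (if \<theta> \<in> M then coef \<theta> * gv i a else 0)) = (if \<theta> \<in> M then f \<theta> else 0)"
          by (simp add: f_def sum_distrib_left mult.left_commute)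
      qed
      finally show ?thesis .
    qed
    have "(\<Sum>i\<in>{1..k}. \<Sum>\<theta>\<in>desc_paths i. if \<theta> \<in> M then f \<theta> else 0)
        = (\<Sum>\<theta>\<in>(\<Union>i\<in>{1..k}. desc_paths i). if \<theta> \<in> M then f \<theta> else 0)"
      by (rule sum.UNION_disjoint[symmetric]) (auto simp: finite_desc_paths, auto simp: desc_paths_def)
    also have "\<dots> = (\<Sum>\<theta>\<in>M. f \<theta>)"
    proof (rule sum_if_subset)
      show "M \<subseteq> (\<Union>i\<in>{1..k}. desc_paths i)"
        using M admissible_desc[of k Q ds] by (auto simp: P_max_def adm_paths_def simp del: atLeastAtMost_iff)
    qed (simp add: finite_desc_paths)
    also have "\<dots> = (\<Sum>\<theta>\<in>M. (1 / r) ^ hplus_max k Q ds * path_weight k Q ds v \<pi> \<theta>)"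
      unfolding f_def using M coef_path_weight by (intro sum.cong) auto
    finally show ?thesis by (simp only: inner sum_distrib_left[where A = M])
  qed
  ultimately show ?thesis by simp
qed

lemma surv_path_growth_max:
  assumes ne: "P_max k Q ds \<noteq> {}" and i: "i \<in> {1..k}" and \<theta>: "\<theta> \<in> desc_paths i" and a: "a \<in> B i"
  shows "growth (hplus_max k Q ds) (\<lambda>n. surv_path \<theta> n a / r ^ n) (if \<theta> \<in> P_max k Q ds then coef \<theta> * gv i a else 0)"
proof (cases "admissible k Q ds \<theta>")
  case False
  hence "\<theta> \<notin> P_max k Q ds" using P_max_iff(1)[OF ne] by blast
  moreover have "surv_path \<theta> n a = 0" for n by (rule surv_path_not_admissible[OF \<theta> i False a])
  ultimately show ?thesis by (simp add: growth_zero)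
next
  case True
  have hd: "hd \<theta> = i" using \<theta> by (simp add: desc_paths_def)
  have gr: "growth (max_count \<theta>) (\<lambda>n. surv_path \<theta> n a / r ^ n) (coef \<theta> * gv i a)"
    using surv_path_growth[of \<theta> a] True a hd by (simp add: admissible_def)
  show ?thesis
  proof (cases "max_count \<theta> = hplus_max k Q ds")
    case eq: True
    then show ?thesis using gr True P_max_iff(1)[OF ne] by simp
  next
    case False
    hence "max_count \<theta> < hplus_max k Q ds" using max_count_le[OF True] by simp
    then show ?thesis using growth_less_zero[OF gr] False P_max_iff(1)[OF ne] by simp
  qed
qed

text \<open>If block \<open>l\<close> is below the maximum, its doubling does not raise the order,
  so even maximal paths stay below order \<open>Suc (hplus_max k Q ds)\<close> and the set of
  relevant paths is empty.\<close>

lemma occ_path_growth_max: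
  assumes ne: "P_max k Q ds \<noteq> {}" and i: "i \<in> {1..k}" and \<theta>: "\<theta> \<in> desc_paths i" and a: "a \<in> B i"
    and l: "l \<in> {1..k}"
  shows "growth (Suc (hplus_max k Q ds)) (\<lambda>n. occ_path l \<theta> n a / r ^ n)
    (if \<theta> \<in> (if \<rho> l = r then P_max_at k Q ds l else {}) then coef \<theta> * gv i a else 0)"
proof (cases "admissible k Q ds \<theta> \<and> l \<in> set \<theta>")
  case False
  have "\<theta> \<notin> (if \<rho> l = r then P_max_at k Q ds l else {})"
    using False P_max_iff(1)[OF ne] by (auto simp: P_max_at_def)
  moreover have "occ_path l \<theta> n a = 0" for n
    using False occ_path_not_admissible[OF \<theta> i _ a] occ_path_absent[of l \<theta>] by blast
  ultimately show ?thesis by (simp add: growth_zero)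
next
  case True
  let ?H = "hplus_max k Q ds"
  have hd: "hd \<theta> = i" using \<theta> by (simp add: desc_paths_def)
  have sub: "set \<theta> \<subseteq> {1..k}" and dis: "distinct \<theta>"
    using True sorted_wrt_greater_distinct by (auto simp: admissible_def)
  obtain C where C: "\<rho> l = r \<Longrightarrow> C = coef \<theta>" and gr: "growth (if \<rho> l = r then Suc (max_count \<theta>) else max_count \<theta>)
      (\<lambda>n. occ_path l \<theta> n a / r ^ n) (C * gv i a)"
    using occ_path_growth[OF dis sub, of l] True a hd by auto
  have le: "max_count \<theta> \<le> ?H" using max_count_le True by blast
  have mem: "\<theta> \<in> P_max_at k Q ds l \<longleftrightarrow> max_count \<theta> = ?H"
    using True P_max_iff(1)[OF ne] by (auto simp: P_max_at_def)
  show ?thesis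
  proof (cases "\<rho> l = r \<and> max_count \<theta> = ?H")
    case eq: True
    then show ?thesis using gr C mem by simp
  next
    case False
    hence "(if \<rho> l = r then Suc (max_count \<theta>) else max_count \<theta>) < Suc ?H" using le by auto
    moreover have "\<theta> \<notin> (if \<rho> l = r then P_max_at k Q ds l else {})" using False mem by auto
    ultimately show ?thesis using growth_less_zero[OF gr] by simp
  qed
qed

lemma cond_occ_limit:
  assumes nonneg: "\<And>a. a < d \<Longrightarrow> 0 \<le> \<pi> $ a"
    and \<theta>0: "\<theta>0 \<in> P_max k Q ds" "alpha_path Q ds v \<theta>0 \<noteq> 0" "pi_v \<pi> ds v (hd \<theta>0) \<noteq> 0"
    and l: "l \<in> {1..k}"
  shows "(\<lambda>n. cond_occ d Q R \<pi> ds l n) \<longlonglongrightarrow>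
    (\<Sum>\<theta>\<in>(if \<rho> l = r then P_max_at k Q ds l else {}). path_weight k Q ds v \<pi> \<theta>) /
    (real (hplus_max k Q ds) * (\<Sum>\<theta>\<in>P_max k Q ds. path_weight k Q ds v \<pi> \<theta>))"
proof -
  let ?H = "hplus_max k Q ds" and ?w = "path_weight k Q ds v \<pi>"
  let ?M = "if \<rho> l = r then P_max_at k Q ds l else {}"
  have ne: "P_max k Q ds \<noteq> {}" using \<theta>0 by blast
  have M: "?M \<subseteq> P_max k Q ds" by (auto simp: P_max_at_def)
  define total where "total Y n = (\<Sum>i\<in>{1..k}. \<Sum>a\<in>B i. \<pi> $ a * (\<Sum>\<theta>\<in>desc_paths i. Y \<theta> n a))"
    for Y :: "nat list \<Rightarrow> nat \<Rightarrow> nat \<Rightarrow> real" and n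
  have gs: "growth ?H (\<lambda>n. total surv_path n / r ^ n) ((1 / r) ^ ?H * (\<Sum>\<theta>\<in>P_max k Q ds. ?w \<theta>))"
    unfolding total_def using surv_path_growth_max[OF ne] by (intro total_growth) auto
  have go: "growth (Suc ?H) (\<lambda>n. total (occ_path l) n / r ^ n) ((1 / r) ^ ?H * (\<Sum>\<theta>\<in>?M. ?w \<theta>))"
    unfolding total_def by (rule total_growth[OF M]) (rule occ_path_growth_max[OF ne _ _ _ l])
  have fac_pos: "0 < (\<Prod>u\<in>Hminus Q ds \<theta>. 1 / (r - \<rho> (\<theta> ! u)))" if "\<theta> \<in> P_max k Q ds" for \<theta>
    using that by (intro prod_pos) (auto simp: Hminus_def P_max_def)
  have w0: "0 \<le> ?w \<theta>" if \<theta>: "\<theta> \<in> P_max k Q ds" for \<theta>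
  proof -
    have adm: "admissible k Q ds \<theta>" using \<theta> by (simp add: P_max_def adm_paths_def)
    have hd: "hd \<theta> \<in> {1..k}" using admissible_desc[OF adm] by blast
    have "0 \<le> alpha_path Q ds v \<theta>" using alpha_path_nonneg adm by (simp add: admissible_def)
    moreover have "0 \<le> pi_v \<pi> ds v (hd \<theta>)"
      unfolding pi_v_def
    proof (intro sum_nonneg mult_nonneg_nonneg)
      fix a assume a: "a \<in> {..<ds (hd \<theta>)}"
      hence "blk_off ds (hd \<theta>) + a \<in> B (hd \<theta>)" by (simp add: blk_idxI)
      thus "0 \<le> \<pi> $ (blk_off ds (hd \<theta>) + a)" using nonneg B_less[OF hd] by blast
      show "0 \<le> v (hd \<theta>) $ a" using v_pos[OF hd] a by (simp add: less_imp_le)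
    qed
    ultimately show ?thesis using fac_pos[OF \<theta>] by (simp add: path_weight_def)
  qed
  have fin: "finite (P_max k Q ds)" using finite_adm_paths by (simp add: P_max_def)
  have "?w \<theta>0 \<noteq> 0" using \<theta>0 fac_pos[OF \<theta>0(1)] by (auto simp: path_weight_def)
  \<comment> \<open>A sum of nonnegative weights can vanish only if the weight of
    \<open>\<theta>0\<close> does.\<close>
  hence W: "(\<Sum>\<theta>\<in>P_max k Q ds. ?w \<theta>) \<noteq> 0"
    using sum_nonneg_eq_0_iff[OF fin, of ?w] w0 \<theta>0(1) by blast
  have r0: "(1 / r) ^ ?H \<noteq> 0" "r \<noteq> 0" using r_pos by auto
  have "(\<lambda>n. total (occ_path l) (Suc n) / r ^ Suc n / real (Suc n) / (total surv_path (Suc n) / r ^ Suc n))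
      \<longlonglongrightarrow> (1 / r) ^ ?H * (\<Sum>\<theta>\<in>?M. ?w \<theta>) / (real ?H * ((1 / r) ^ ?H * (\<Sum>\<theta>\<in>P_max k Q ds. ?w \<theta>)))"
    using growth_ratio[OF go gs _ P_max_iff(2)[OF ne]] W r0 by simp
  moreover have "(1 / r) ^ ?H * (\<Sum>\<theta>\<in>?M. ?w \<theta>) / (real ?H * ((1 / r) ^ ?H * (\<Sum>\<theta>\<in>P_max k Q ds. ?w \<theta>)))
      = (\<Sum>\<theta>\<in>?M. ?w \<theta>) / (real ?H * (\<Sum>\<theta>\<in>P_max k Q ds. ?w \<theta>))"
    using r0(1) by (subst mult.left_commute[of "real ?H"]) (rule mult_divide_mult_cancel_left)
  moreover have "total (occ_path l) (Suc n) / r ^ Suc n / real (Suc n) / (total surv_path (Suc n) / r ^ Suc n)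
      = cond_occ d Q R \<pi> ds l n" for n
  proof -
    have split: "(\<Sum>a<d. f a) = (\<Sum>i\<in>{1..k}. \<Sum>a\<in>B i. f a)" for f :: "nat \<Rightarrow> real"
      unfolding B_union[symmetric] using B_disjoint by (intro sum.UNION_disjoint) auto
    have s: "(\<Sum>a<d. \<pi> $ a * survival d Q n a) = total surv_path (Suc n)"
      unfolding split total_def by (intro sum.cong refl) (simp add: survival_eq_sum)
    have o: "(\<Sum>a<d. \<pi> $ a * occupation d Q (B l) n a) = total (occ_path l) (Suc n)"
      unfolding split total_def using l by (intro sum.cong refl) (simp add: occupation_eq_sum)
    have "x / r ^ Suc n / real (Suc n) / (y / r ^ Suc n) = x / real (Suc n) / y" for x y
      using r0(2) by (simp del: of_nat_Suc power_Suc)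
    thus ?thesis unfolding cond_occ_eq s o .
  qed
  ultimately show ?thesis by (simp only:)
qed

end

theorem theorem3p14:
  fixes d k l :: nat and ds :: "nat \<Rightarrow> nat" and Q :: "real mat" and R \<pi> :: "real vec"
    and v :: "nat \<Rightarrow> real vec"
  assumes d2: "d \<ge> 2"
    and Q_carrier: "Q \<in> carrier_mat d d" and R_carrier: "R \<in> carrier_vec d"
    and Q_nz: "Q \<noteq> 0\<^sub>m d d" and R_nz: "R \<noteq> 0\<^sub>v d"
    and P_nonneg: "\<forall>a\<in>{0..d}. \<forall>b\<in>{0..d}. Ptrans Q R a b \<ge> 0"
    and P_stoch: "\<forall>a\<in>{0..d}. (\<Sum>b\<in>{0..d}. Ptrans Q R a b) = 1"
    and Q_eig: "\<forall>z. eigenvalue (cmat Q) z \<longrightarrow> cmod z < 1"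
    and pi_carrier: "\<pi> \<in> carrier_vec d"
    and pi_nonneg: "\<forall>a<d. \<pi> $ a \<ge> 0" and pi_sum: "(\<Sum>a<d. \<pi> $ a) = 1"
    and k_pos: "k \<ge> 1"
    and ds_pos: "\<forall>i\<in>{1..k}. ds i \<ge> 1"
    and ds_sum: "(\<Sum>i\<in>{1..k}. ds i) = d"
    and lower_tri: "\<forall>i\<in>{1..k}. \<forall>j\<in>{1..k}. j > i \<longrightarrow> blk Q ds i j = 0\<^sub>m (ds i) (ds j)"
    and ev_pos: "\<forall>i\<in>{1..k}. eventually_positive (blk Q ds i i)"
    and v_carrier: "\<forall>i\<in>{1..k}. v i \<in> carrier_vec (ds i)"
    and v_pos: "\<forall>i\<in>{1..k}. \<forall>a<ds i. v i $ a > 0"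
    and v_eig: "\<forall>i\<in>{1..k}. blk Q ds i i *\<^sub>v v i = rho Q ds i \<cdot>\<^sub>v v i"
    and v_normed: "\<forall>i\<in>{1..k}. sqrt (\<Sum>a<ds i. (v i $ a)\<^sup>2) = 1"
    and v_scalar: "\<forall>i\<in>{1..k}. ds i = 1 \<longrightarrow> v i = ones_vec 1"
    and A1: "\<forall>i\<in>{1..k}. rho Q ds i < rho_max k Q ds \<longrightarrow>
               (\<exists>c. blk Q ds i i = c \<cdot>\<^sub>m 1\<^sub>m (ds i))"
    and A2: "\<exists>\<theta>\<in>P_max k Q ds. alpha_path Q ds v \<theta> \<noteq> 0 \<and> pi_v \<pi> ds v (hd \<theta>) \<noteq> 0"
    and l_range: "l \<in> {1..k}"
  shows "(rho Q ds l < rho_max k Q ds \<or> P_max_at k Q ds l = {} \<longrightarrow>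
            (\<lambda>n. cond_occ d Q R \<pi> ds l n) \<longlonglongrightarrow> 0)
       \<and> (rho Q ds l = rho_max k Q ds \<and> P_max_at k Q ds l \<noteq> {} \<longrightarrow>
            (\<lambda>n. cond_occ d Q R \<pi> ds l n) \<longlonglongrightarrow>
              (\<Sum>\<theta>\<in>P_max_at k Q ds l. path_weight k Q ds v \<pi> \<theta>) /
              (real (hplus_max k Q ds) * (\<Sum>\<theta>\<in>P_max k Q ds. path_weight k Q ds v \<pi> \<theta>)))"
proof -
  interpret frobenius_form d k ds Q v
  proof
    show "0 \<le> Q $$ (a, b)" if "a < d" "b < d" for a b
      using P_nonneg[rule_format, of "Suc a" "Suc b"] that by (simp add: Ptrans_def)
  qed (use k_pos ds_pos ds_sum lower_tri ev_pos v_carrier v_pos v_eig v_scalar A1 in blast)+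
  obtain \<theta> where "\<theta> \<in> P_max k Q ds" "alpha_path Q ds v \<theta> \<noteq> 0" "pi_v \<pi> ds v (hd \<theta>) \<noteq> 0"
    using A2 by blast
  hence lim: "(\<lambda>n. cond_occ d Q R \<pi> ds l n) \<longlonglongrightarrow>
      (\<Sum>\<theta>\<in>(if rho Q ds l = rho_max k Q ds then P_max_at k Q ds l else {}). path_weight k Q ds v \<pi> \<theta>) /
      (real (hplus_max k Q ds) * (\<Sum>\<theta>\<in>P_max k Q ds. path_weight k Q ds v \<pi> \<theta>))"
    using pi_nonneg l_range by (intro cond_occ_limit) auto
  show ?thesis
  proof (intro conjI impI)
    assume "rho Q ds l < rho_max k Q ds \<or> P_max_at k Q ds l = {}"
    \<comment> \<open>Each alternative of case (i) empties the index set of the numerator.\<close>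
    hence "(if rho Q ds l = rho_max k Q ds then P_max_at k Q ds l else {}) = {}" by auto
    thus "(\<lambda>n. cond_occ d Q R \<pi> ds l n) \<longlonglongrightarrow> 0" using lim by simp
  next
    assume "rho Q ds l = rho_max k Q ds \<and> P_max_at k Q ds l \<noteq> {}"
    thus "(\<lambda>n. cond_occ d Q R \<pi> ds l n) \<longlonglongrightarrow>
        (\<Sum>\<theta>\<in>P_max_at k Q ds l. path_weight k Q ds v \<pi> \<theta>) /
        (real (hplus_max k Q ds) * (\<Sum>\<theta>\<in>P_max k Q ds. path_weight k Q ds v \<pi> \<theta>))"
      using lim by simp
  qed
qed

end
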